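(* Let $(X,d)$ be a hyperbolic metric space, $o\in X$, $b>1$ a parameter admitting a visual metric $D=D_{b,o}$ on $\partial X$, $G\le\mathrm{Isom}(X)$ a strongly discrete group of general type with Poincaré exponent $\delta$, $\xi\in\partial X$, and $\mu$ an ergodic $\delta$-quasiconformal probability measure on the limit set $\Lambda$ of $G$ with $\mu(\{\xi\})=0$. Let $\Delta_{\mu,\xi}(r)=\mu(B(\xi,r))$, and let $\Phi:[0,\infty)\to(0,\infty)$ be such that $t\mapsto t\Phi(t)$ is nonincreasing. For $K>0$ put $$S_1(K)=\sum_{g\in G}b^{-\delta d(o,g(o))}\Delta_{\mu,\xi}\big(b^{d(o,g(o))}\Phi(Kb^{d(o,g(o))})\big),\qquad S_2(K)=\sum_{g\in G}(g'(\xi))^\delta\Delta_{\mu,\xi}\big(\Phi(Kb^{d(o,g(o))})/g'(\xi)\big).$$ Consider the conditions (a) $\Delta_{\mu,\xi}(r)\asymp_\times r^\delta$ for all $0<r\le1$; (b) $f_G(t):=\#\{g\in G:d(o,g(o))\le t\}\asymp_\times b^{\delta t}$ for all $t>0$. If (b) holds then for each $K>0$ $$S_1(K)\asymp_{+,\times}\int_0^\infty\Delta_{\mu,\xi}(K^{-1}e^t\Phi(e^t))\,dt.$$ If (a) holds then for each $K>0$ $$S_1(K)\asymp_\times S_2(K)\asymp_\times\sum_{g\in G}\Phi^\delta(Kb^{d(o,g(o))}).$$ If both (a) and (b) hold then for each $K>0$ $$S_1(K)\asymp_\times S_2(K)\asymp_{+,\times}\int_0^\infty e^{\delta t}\Phi^\delta(e^t)\,dt,$$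 and so $$\mu(\mathrm{WA}_{\Phi,\xi})=0\iff\int_0^\infty e^{\delta t}\Phi^\delta(e^t)\,dt<\infty.$$
   Context: Asymptotic notation: $A\asymp_\times B$ means $C^{-1}B\le A\le CB$ for some constant $C\ge1$; $A\asymp_{+,\times}B$ means $A\le C_1B+C_2$ and $B\le C_1A+C_2$ for some constants $C_1,C_2>0$. In (a) the constant is independent of $r$ and in (b) independent of $t$; in the conclusions the constants may depend on the fixed data $X,d,o,b,D,G,\xi,\mu,\Phi$ and on $K$. Both sides may be $+\infty$. $\Phi^\delta(t)$ means $(\Phi(t))^\delta$. For a metric space $(X,d)$ let $\langle x|y\rangle_z=\frac12[d(x,z)+d(y,z)-d(x,y)]$. $(X,d)$ is (Gromov) hyperbolic if there is $C\ge 0$ with $\langle x|z\rangle_w\ge\min(\langle x|y\rangle_w,\langle y|z\rangle_w)-C$ for all $x,y,z,w\in X$ ($X$ need not be proper or geodesic). Fix a basepoint $o\in X$. A sequence $(x_n)$ in $X$ is a Gromov sequence if $\langle x_n|x_m\rangle_o\to\infty$ as $n,m\to\infty$; two Gromov sequences are equivalent if $\langle x_n|y_n\rangle_o\to\infty$; the Gromov boundary $\partial X$ is the set of equivalence classes, and isometries of $X$ act on it. For $\xi,\eta\in\partial X$ and $y,z\in X$: $\langle\xi|\eta\rangle_z=\inf\{\liminf_{n,m\to\infty}\langle x_n|y_m\rangle_z:(x_n)\in\xi,(y_m)\in\eta\}$, $\langle\xi|y\rangle_z=\langle y|\xi\rangle_z=\inf\{\liminf_{n\to\infty}\langle x_n|y\rangle_z:(x_n)\in\xi\}$,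 and the Busemann function is $\mathcal B_\xi(y,z)=\langle z|\xi\rangle_y-\langle y|\xi\rangle_z$. A sequence $(x_n)$ in $X\cup\partial X$ converges to $\xi\in\partial X$ iff $\langle x_n|\xi\rangle_o\to\infty$. The parameter $b>1$ is close enough to $1$ that there is a complete metric $D=D_{b,o}$ on $\partial X$ (a visual metric) with $C^{-1}b^{-\langle\xi|\eta\rangle_o}\le D(\xi,\eta)\le Cb^{-\langle\xi|\eta\rangle_o}$ for some constant $C\geq 1$; such a $D$ is fixed and $B(\xi,r)$ denotes the closed ball in $(\partial X,D)$. $G\le\mathrm{Isom}(X)$ is strongly discrete if $\{g\in G:d(o,g(o))\le r\}$ is finite for every $r>0$. An isometry $g$ is loxodromic if it has two fixed points $g_+,g_-\in\partial X$ such that for every neighborhood $U$ of $g_-$ the iterates $g^n$ converge to $g_+$ uniformly on $\partial X\setminus U$, and $g^{-1}$ has the same property (with $g_+$ and $g_-$ exchanged). $G$ is of general type if it contains two loxodromic isometries with disjoint fixed-point sets in $\partial X$. $\delta=\inf\{s\ge0:\sum_{g\in G}b^{-s\,d(o,g(o))}<\infty\}$ is the Poincaré exponent. The limit set is $\Lambda=\{\eta\in\partial X:g_n(o)\to\eta\text{ for some sequence }(g_n)\text{ in }G\}$. For $g\in\mathrm{Isom}(X)$ and $\eta\in\partial X$, $g'(\eta)=b^{\mathcal B_\eta(o,g^{-1}(o))}$. Measures are finite and Borel. A measure $\mu$ on $\partial X$ is $s$-quasiconformal if there is $C\ge1$ with $C^{-1}\int_A(g')^s\,d\mu\le\mu(g(A))\le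 C\int_A(g')^s\,d\mu$ for all $g\in G$ and Borel $A\subset\partial X$; it is ergodic if for every $G$-invariant $A\subset\partial X$, $\mu(A)=0$ or $\mu(\partial X\setminus A)=0$. $\mathrm{WA}_{\Phi,\xi}$ is the set of $\eta\in\Lambda$ such that for every $K>0$ there exists $g\in G$ with $D(g(\xi),\eta)\le\Phi(Kb^{d(o,g(o))})$. *)

theory Defs
  imports "HOL-Probability.Probability_Measure" "HOL-Algebra.Group"
begin

section \<open>Gromov hyperbolic spaces and their boundary\<close>

definition gromov_product :: "'a::metric_space \<Rightarrow> 'a \<Rightarrow> 'a \<Rightarrow> real" where
  "gromov_product x y z = (dist x z + dist y z - dist x y) / 2"

definition gromov_hyperbolic :: "'a::metric_space itself \<Rightarrow> bool" where
  "gromov_hyperbolic TYPE('a) \<longleftrightarrow>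
     (\<exists>C\<ge>0. \<forall>x y z w :: 'a.
        gromov_product x z w \<ge> min (gromov_product x y w) (gromov_product y z w) - C)"

definition gromov_sequence :: "'a::metric_space \<Rightarrow> (nat \<Rightarrow> 'a) \<Rightarrow> bool" where
  "gromov_sequence o\<^sub>X x \<longleftrightarrow>
     filterlim (\<lambda>(n, m). gromov_product (x n) (x m) o\<^sub>X) at_top (sequentially \<times>\<^sub>F sequentially)"

definition gromov_equiv :: "'a::metric_space \<Rightarrow> ((nat \<Rightarrow> 'a) \<times> (nat \<Rightarrow> 'a)) set" where
  "gromov_equiv o\<^sub>X = {(x, y). gromov_sequence o\<^sub>X x \<and> gromov_sequence o\<^sub>X y \<and>
     filterlim (\<lambda>n. gromov_product (x n) (y n) o\<^sub>X) at_top sequentially}"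

definition gromov_boundary :: "'a::metric_space \<Rightarrow> (nat \<Rightarrow> 'a) set set" where
  "gromov_boundary o\<^sub>X = Collect (gromov_sequence o\<^sub>X) // gromov_equiv o\<^sub>X"

definition boundary_product ::
    "(nat \<Rightarrow> 'a::metric_space) set \<Rightarrow> (nat \<Rightarrow> 'a) set \<Rightarrow> 'a \<Rightarrow> ereal" where
  "boundary_product \<xi> \<eta> z = (INF x\<in>\<xi>. INF y\<in>\<eta>.
     Liminf (sequentially \<times>\<^sub>F sequentially) (\<lambda>(n, m). ereal (gromov_product (x n) (y m) z)))"

definition boundary_point_product ::
    "(nat \<Rightarrow> 'a::metric_space) set \<Rightarrow> 'a \<Rightarrow> 'a \<Rightarrow> ereal" where
  "boundary_point_product \<xi> y z =
     (INF x\<in>\<xi>. liminf (\<lambda>n. ereal (gromov_product (x n) y z)))"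

text \<open>For a boundary point \<open>\<xi>\<close> the values \<open>boundary_point_product \<xi> y z\<close> lie between \<open>0\<close> and
  \<open>dist y z\<close>, so the conversions to \<open>real\<close> lose nothing.\<close>

definition busemann :: "(nat \<Rightarrow> 'a::metric_space) set \<Rightarrow> 'a \<Rightarrow> 'a \<Rightarrow> real" where
  "busemann \<xi> y z = real_of_ereal (boundary_point_product \<xi> z y)
                  - real_of_ereal (boundary_point_product \<xi> y z)"

text \<open>\<open>b\<close> to the power \<open>-s\<close>, for \<open>b > 1\<close> and \<open>0 \<le> s \<le> \<infinity>\<close>.\<close>

definition neg_power :: "real \<Rightarrow> ereal \<Rightarrow> real" where
  "neg_power b s = (if s = \<infinity> then 0 else b powr (- real_of_ereal s))"

definition visual_metric ::
    "'a::metric_space \<Rightarrow> real \<Rightarrow> ((nat \<Rightarrow> 'a) set \<Rightarrow> (nat \<Rightarrow> 'a) set \<Rightarrow> real) \<Rightarrow> bool" where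
  "visual_metric o\<^sub>X b D \<longleftrightarrow>
     Metric_space (gromov_boundary o\<^sub>X) D \<and>
     Metric_space.mcomplete (gromov_boundary o\<^sub>X) D \<and>
     (\<exists>C\<ge>1. \<forall>\<xi>\<in>gromov_boundary o\<^sub>X. \<forall>\<eta>\<in>gromov_boundary o\<^sub>X.
        inverse C * neg_power b (boundary_product \<xi> \<eta> o\<^sub>X) \<le> D \<xi> \<eta> \<and>
        D \<xi> \<eta> \<le> C * neg_power b (boundary_product \<xi> \<eta> o\<^sub>X))"

abbreviation boundary_topology ::
    "'a::metric_space \<Rightarrow> ((nat \<Rightarrow> 'a) set \<Rightarrow> (nat \<Rightarrow> 'a) set \<Rightarrow> real) \<Rightarrow> (nat \<Rightarrow> 'a) set topology" where
  "boundary_topology o\<^sub>X D \<equiv> Metric_space.mtopology (gromov_boundary o\<^sub>X) D"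

abbreviation boundary_cball ::
    "'a::metric_space \<Rightarrow> ((nat \<Rightarrow> 'a) set \<Rightarrow> (nat \<Rightarrow> 'a) set \<Rightarrow> real) \<Rightarrow>
     (nat \<Rightarrow> 'a) set \<Rightarrow> real \<Rightarrow> (nat \<Rightarrow> 'a) set set" where
  "boundary_cball o\<^sub>X D \<equiv> Metric_space.mcball (gromov_boundary o\<^sub>X) D"

definition boundary_borel ::
    "'a::metric_space \<Rightarrow> ((nat \<Rightarrow> 'a) set \<Rightarrow> (nat \<Rightarrow> 'a) set \<Rightarrow> real) \<Rightarrow> (nat \<Rightarrow> 'a) set measure" where
  "boundary_borel o\<^sub>X D = sigma (gromov_boundary o\<^sub>X) {U. openin (boundary_topology o\<^sub>X D) U}"


section \<open>Groups of isometries\<close>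

definition isom_group :: "('a::metric_space \<Rightarrow> 'a) monoid" where
  "isom_group = \<lparr>carrier = {g. bij g \<and> (\<forall>x y. dist (g x) (g y) = dist x y)},
                 mult = (\<circ>), one = id\<rparr>"

lemma group_isom_group: "group (isom_group :: ('a::metric_space \<Rightarrow> 'a) monoid)"
proof (rule groupI)
  fix g :: "'a \<Rightarrow> 'a"
  assume g: "g \<in> carrier isom_group"
  then have bij: "bij g" and iso: "\<And>x y. dist (g x) (g y) = dist x y"
    by (auto simp: isom_group_def)
  have "dist (inv_into UNIV g x) (inv_into UNIV g y) = dist x y" for x y
    using iso[of "inv_into UNIV g x" "inv_into UNIV g y"] bij
    by (simp add: bij_is_surj surj_f_inv_f)
  then show "\<exists>h\<in>carrier isom_group. h \<otimes>\<^bsub>isom_group\<^esub> g = \<one>\<^bsub>isom_group\<^esub>"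
    using bij by (intro bexI[of _ "inv_into UNIV g"])
      (auto simp: isom_group_def bij_imp_bij_inv bij_is_inj)
qed (auto simp: isom_group_def bij_comp comp_assoc)

text \<open>A boundary point is an equivalence class of sequences; an isometry maps it to the class
  consisting of the image sequences.\<close>

definition boundary_act ::
    "('a \<Rightarrow> 'a) \<Rightarrow> (nat \<Rightarrow> 'a) set \<Rightarrow> (nat \<Rightarrow> 'a) set" where
  "boundary_act g \<xi> = (\<lambda>x. g \<circ> x) ` \<xi>"

definition strongly_discrete :: "'a::metric_space \<Rightarrow> ('a \<Rightarrow> 'a) set \<Rightarrow> bool" where
  "strongly_discrete o\<^sub>X G \<longleftrightarrow> (\<forall>r>0. finite {g\<in>G. dist o\<^sub>X (g o\<^sub>X) \<le> r})"

definition boundary_fixed :: "'a::metric_space \<Rightarrow> ('a \<Rightarrow> 'a) \<Rightarrow> (nat \<Rightarrow> 'a) set set" where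
  "boundary_fixed o\<^sub>X g = {\<eta>\<in>gromov_boundary o\<^sub>X. boundary_act g \<eta> = \<eta>}"

text \<open>The iterates of \<open>g\<close> converge to \<open>p\<close>, uniformly off every neighbourhood of \<open>q\<close>.\<close>

definition attracts_off ::
    "'a::metric_space \<Rightarrow> ((nat \<Rightarrow> 'a) set \<Rightarrow> (nat \<Rightarrow> 'a) set \<Rightarrow> real) \<Rightarrow> ('a \<Rightarrow> 'a) \<Rightarrow>
     (nat \<Rightarrow> 'a) set \<Rightarrow> (nat \<Rightarrow> 'a) set \<Rightarrow> bool" where
  "attracts_off o\<^sub>X D g p q \<longleftrightarrow>
     (\<forall>U. openin (boundary_topology o\<^sub>X D) U \<and> q \<in> U \<longrightarrow>
        (\<forall>\<epsilon>>0. \<forall>\<^sub>F n in sequentially. \<forall>\<eta>\<in>gromov_boundary o\<^sub>X - U.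
           D (boundary_act (g ^^ n) \<eta>) p < \<epsilon>))"

definition loxodromic ::
    "'a::metric_space \<Rightarrow> ((nat \<Rightarrow> 'a) set \<Rightarrow> (nat \<Rightarrow> 'a) set \<Rightarrow> real) \<Rightarrow> ('a \<Rightarrow> 'a) \<Rightarrow> bool" where
  "loxodromic o\<^sub>X D g \<longleftrightarrow>
     (\<exists>p\<in>boundary_fixed o\<^sub>X g. \<exists>q\<in>boundary_fixed o\<^sub>X g. p \<noteq> q \<and>
        attracts_off o\<^sub>X D g p q \<and> attracts_off o\<^sub>X D (inv_into UNIV g) q p)"

definition general_type ::
    "'a::metric_space \<Rightarrow> ((nat \<Rightarrow> 'a) set \<Rightarrow> (nat \<Rightarrow> 'a) set \<Rightarrow> real) \<Rightarrow> ('a \<Rightarrow> 'a) set \<Rightarrow> bool" where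
  "general_type o\<^sub>X D G \<longleftrightarrow>
     (\<exists>g\<in>G. \<exists>h\<in>G. loxodromic o\<^sub>X D g \<and> loxodromic o\<^sub>X D h \<and>
        boundary_fixed o\<^sub>X g \<inter> boundary_fixed o\<^sub>X h = {})"

definition poincare_exponent :: "'a::metric_space \<Rightarrow> real \<Rightarrow> ('a \<Rightarrow> 'a) set \<Rightarrow> ereal" where
  "poincare_exponent o\<^sub>X b G =
     Inf {ereal s |s. 0 \<le> s \<and> (\<Sum>\<^sub>\<infinity>g\<in>G. ennreal (b powr (- s * dist o\<^sub>X (g o\<^sub>X)))) < \<infinity>}"

definition limit_set :: "'a::metric_space \<Rightarrow> ('a \<Rightarrow> 'a) set \<Rightarrow> (nat \<Rightarrow> 'a) set set" where
  "limit_set o\<^sub>X G = {\<eta>\<in>gromov_boundary o\<^sub>X. \<exists>g :: nat \<Rightarrow> 'a \<Rightarrow> 'a. range g \<subseteq> G \<and>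
     (\<lambda>n. boundary_point_product \<eta> (g n o\<^sub>X) o\<^sub>X) \<longlonglongrightarrow> \<infinity>}"

definition orbit_count :: "'a::metric_space \<Rightarrow> ('a \<Rightarrow> 'a) set \<Rightarrow> real \<Rightarrow> nat" where
  "orbit_count o\<^sub>X G t = card {g\<in>G. dist o\<^sub>X (g o\<^sub>X) \<le> t}"


section \<open>Quasiconformal measures\<close>

definition metric_deriv ::
    "'a::metric_space \<Rightarrow> real \<Rightarrow> ('a \<Rightarrow> 'a) \<Rightarrow> (nat \<Rightarrow> 'a) set \<Rightarrow> real" where
  "metric_deriv o\<^sub>X b g \<eta> = b powr busemann \<eta> o\<^sub>X (inv_into UNIV g o\<^sub>X)"

definition quasiconformal ::
    "'a::metric_space \<Rightarrow> real \<Rightarrow> ('a \<Rightarrow> 'a) set \<Rightarrow> real \<Rightarrow> (nat \<Rightarrow> 'a) set measure \<Rightarrow> bool" where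
  "quasiconformal o\<^sub>X b G s \<mu> \<longleftrightarrow>
     (\<exists>C\<ge>1. \<forall>g\<in>G. \<forall>A\<in>sets \<mu>.
        ennreal (inverse C) * (\<integral>\<^sup>+\<eta>\<in>A. ennreal (metric_deriv o\<^sub>X b g \<eta> powr s) \<partial>\<mu>)
          \<le> emeasure \<mu> (boundary_act g ` A) \<and>
        emeasure \<mu> (boundary_act g ` A)
          \<le> ennreal C * (\<integral>\<^sup>+\<eta>\<in>A. ennreal (metric_deriv o\<^sub>X b g \<eta> powr s) \<partial>\<mu>))"

definition ergodic_measure :: "('a \<Rightarrow> 'a) set \<Rightarrow> (nat \<Rightarrow> 'a) set measure \<Rightarrow> bool" where
  "ergodic_measure G \<mu> \<longleftrightarrow>
     (\<forall>A\<in>sets \<mu>. (\<forall>g\<in>G. boundary_act g ` A = A) \<longrightarrow>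
        emeasure \<mu> A = 0 \<or> emeasure \<mu> (space \<mu> - A) = 0)"


section \<open>Well approximable points and Khinchin series\<close>

definition WA ::
    "'a::metric_space \<Rightarrow> real \<Rightarrow> ((nat \<Rightarrow> 'a) set \<Rightarrow> (nat \<Rightarrow> 'a) set \<Rightarrow> real) \<Rightarrow> ('a \<Rightarrow> 'a) set \<Rightarrow>
     (real \<Rightarrow> real) \<Rightarrow> (nat \<Rightarrow> 'a) set \<Rightarrow> (nat \<Rightarrow> 'a) set set" where
  "WA o\<^sub>X b D G \<Phi> \<xi> = {\<eta>\<in>limit_set o\<^sub>X G. \<forall>K>0. \<exists>g\<in>G.
     D (boundary_act g \<xi>) \<eta> \<le> \<Phi> (K * b powr dist o\<^sub>X (g o\<^sub>X))}"

definition ball_mass ::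
    "'a::metric_space \<Rightarrow> ((nat \<Rightarrow> 'a) set \<Rightarrow> (nat \<Rightarrow> 'a) set \<Rightarrow> real) \<Rightarrow>
     (nat \<Rightarrow> 'a) set measure \<Rightarrow> (nat \<Rightarrow> 'a) set \<Rightarrow> real \<Rightarrow> ennreal" where
  "ball_mass o\<^sub>X D \<mu> \<xi> r = emeasure \<mu> (boundary_cball o\<^sub>X D \<xi> r)"

definition khinchin_series1 ::
    "'a::metric_space \<Rightarrow> real \<Rightarrow> ((nat \<Rightarrow> 'a) set \<Rightarrow> (nat \<Rightarrow> 'a) set \<Rightarrow> real) \<Rightarrow> ('a \<Rightarrow> 'a) set \<Rightarrow>
     real \<Rightarrow> (nat \<Rightarrow> 'a) set measure \<Rightarrow> (real \<Rightarrow> real) \<Rightarrow> (nat \<Rightarrow> 'a) set \<Rightarrow> real \<Rightarrow> ennreal" where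
  "khinchin_series1 o\<^sub>X b D G \<delta> \<mu> \<Phi> \<xi> K =
     (\<Sum>\<^sub>\<infinity>g\<in>G. ennreal (b powr (- \<delta> * dist o\<^sub>X (g o\<^sub>X))) *
        ball_mass o\<^sub>X D \<mu> \<xi> (b powr dist o\<^sub>X (g o\<^sub>X) * \<Phi> (K * b powr dist o\<^sub>X (g o\<^sub>X))))"

definition khinchin_series2 ::
    "'a::metric_space \<Rightarrow> real \<Rightarrow> ((nat \<Rightarrow> 'a) set \<Rightarrow> (nat \<Rightarrow> 'a) set \<Rightarrow> real) \<Rightarrow> ('a \<Rightarrow> 'a) set \<Rightarrow>
     real \<Rightarrow> (nat \<Rightarrow> 'a) set measure \<Rightarrow> (real \<Rightarrow> real) \<Rightarrow> (nat \<Rightarrow> 'a) set \<Rightarrow> real \<Rightarrow> ennreal" where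
  "khinchin_series2 o\<^sub>X b D G \<delta> \<mu> \<Phi> \<xi> K =
     (\<Sum>\<^sub>\<infinity>g\<in>G. ennreal (metric_deriv o\<^sub>X b g \<xi> powr \<delta>) *
        ball_mass o\<^sub>X D \<mu> \<xi> (\<Phi> (K * b powr dist o\<^sub>X (g o\<^sub>X)) / metric_deriv o\<^sub>X b g \<xi>))"


section \<open>Comparison up to constants\<close>

definition comparable_times :: "real \<Rightarrow> ennreal \<Rightarrow> ennreal \<Rightarrow> bool" where
  "comparable_times C A B \<longleftrightarrow> ennreal (inverse C) * B \<le> A \<and> A \<le> ennreal C * B"

definition asymp_times :: "ennreal \<Rightarrow> ennreal \<Rightarrow> bool" where
  "asymp_times A B \<longleftrightarrow> (\<exists>C\<ge>1. comparable_times C A B)"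

definition asymp_plus_times :: "ennreal \<Rightarrow> ennreal \<Rightarrow> bool" where
  "asymp_plus_times A B \<longleftrightarrow>
     (\<exists>C\<^sub>1>0. \<exists>C\<^sub>2>0. A \<le> ennreal C\<^sub>1 * B + ennreal C\<^sub>2 \<and> B \<le> ennreal C\<^sub>1 * A + ennreal C\<^sub>2)"

text \<open>Uniform version: one constant for all parameters in the set \<open>I\<close>.\<close>

definition asymp_times_on :: "real set \<Rightarrow> (real \<Rightarrow> ennreal) \<Rightarrow> (real \<Rightarrow> ennreal) \<Rightarrow> bool" where
  "asymp_times_on I f g \<longleftrightarrow> (\<exists>C\<ge>1. \<forall>t\<in>I. comparable_times C (f t) (g t))"

end

theory Submission
  imports Defs
begin

text \<open>
  Write \<open>len g\<close> for the distance from the base point \<open>o\<close> to \<open>g o\<close>, and \<open>(\<eta>|x)\<close> for the Gromov product at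
  \<open>o\<close> of a boundary point \<open>\<eta>\<close> with a point \<open>x\<close>.

  The comparisons between the series and the integrals are counting. Under (b) every sufficiently
  thick layer of the group, consisting of the elements of length between \<open>n L\<close> and \<open>(n + 1) L\<close>, has
  about \<open>b powr (\<delta> n L)\<close> elements (\<open>layer_growth\<close>), so a sum over the group of \<open>b powr (- \<delta> len g)\<close> times a
  nonincreasing function of the length is a Riemann sum for the integral of that function
  (\<open>asymp_plus_times_weighted_sum_integral\<close>). Here \<open>\<delta>\<close> is positive, because otherwise the group would be
  finite and its limit set empty. Under (a) the terms of both series are comparable one by one with
  \<open>\<Phi> (K * b powr len g) powr \<delta>\<close>: the arguments of the ball mass are bounded because the derivative
  \<open>g'(\<xi>)\<close> is at least \<open>b powr (- len g)\<close> and \<open>t * \<Phi> t\<close> is nonincreasing.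

  For Khinchin's theorem, hyperbolicity gives \<open>g'(\<eta>) \<asymp> b powr (2 (\<eta>|g\<inverse> o) - len g)\<close>, and this is nearly
  constant on balls around \<open>\<eta>\<close> that are small compared with \<open>b powr (- (\<eta>|g\<inverse> o))\<close>, on which \<open>g\<close> acts
  roughly like a similarity with ratio \<open>g'\<close> (\<open>ball_transport\<close>). Quasiconformality then turns (a) into
  the estimate that a ball of radius \<open>r\<close> around \<open>g \<xi>\<close> has measure comparable to \<open>r powr \<delta>\<close>, uniformly in
  \<open>g\<close>, as long as \<open>r\<close> is at most a small multiple of \<open>b powr (- len g)\<close> (\<open>orbit_ball_upper\<close>,
  \<open>orbit_ball_lower\<close>). If the integral converges, the Borel--Cantelli lemma shows that almost no point
  is well approximable; the orbit of \<open>\<xi>\<close>, whose points may be approximated by a single group element,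
  is a null set.

  If the integral diverges, a second moment argument applies. Different group elements may send
  \<open>\<xi>\<close> to nearly the same point, and to bound this multiplicity only those \<open>g\<close> are kept for which
  \<open>(\<xi>|g\<inverse> o)\<close> is bounded, so that \<open>g \<xi>\<close> lies in the shadow of \<open>g o\<close>. Since some \<open>f\<close> in the group moves \<open>\<xi>\<close>,
  one of \<open>g\<close> and \<open>g f\<inverse>\<close> always qualifies, hence these elements still satisfy a growth estimate
  as in (b) (\<open>shadowed_growth\<close>). Two of them of about the same length, with close images of \<open>\<xi>\<close>, differ
  by an element of bounded length (\<open>shadowed_separation\<close>). The measure estimates for balls
  then show that the balls of two different layers meet about as often as if they were independent,
  with an error that is geometric in the difference of the layers. The union of the approximating
  balls therefore has measure bounded below independently of the constant \<open>K\<close>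
  (\<open>orbit_balls_cover\<close>), and so does the intersection of these unions over \<open>K\<close>, which up to a null set
  is the set of well approximable points.
\<close>

section \<open>Sums of nonnegative terms up to constants\<close>

lemma infsum_ennreal_leI:
  fixes f :: "'x \<Rightarrow> ennreal"
  assumes "\<And>F. finite F \<Longrightarrow> F \<subseteq> A \<Longrightarrow> sum f F \<le> c"
  shows "infsum f A \<le> c"
  using assms by (subst nonneg_infsum_complete) (auto intro!: SUP_least)

lemma sum_le_infsum_ennreal:
  fixes f :: "'x \<Rightarrow> ennreal"
  assumes "finite F" "F \<subseteq> A"
  shows "sum f F \<le> infsum f A"
  using assms by (subst nonneg_infsum_complete) (auto intro!: SUP_upper)

lemma infsum_cmult_ennreal:
  fixes f :: "'x \<Rightarrow> ennreal"
  shows "infsum (\<lambda>x. c * f x) A = c * infsum f A"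
  by (subst (1 2) nonneg_infsum_complete)
    (auto simp: SUP_mult_left_ennreal sum_distrib_left)

lemma infsum_mono_ennreal:
  fixes f :: "'x \<Rightarrow> ennreal"
  assumes "\<And>x. x \<in> A \<Longrightarrow> f x \<le> g x"
  shows "infsum f A \<le> infsum g A"
  using assms by (intro infsum_mono nonneg_summable_on_complete) auto

lemma asymp_timesI:
  assumes "A \<le> ennreal c * B" "B \<le> ennreal c' * A"
  shows "asymp_times A B"
proof -
  define C where "C = max 1 (max c c')"
  have C: "C \<ge> 1" "c \<le> C" "c' \<le> C" by (auto simp: C_def)
  have "B \<le> ennreal C * A"
    using assms(2) C by (meson dual_order.trans ennreal_leI mult_right_mono zero_le)
  then have "ennreal (inverse C) * B \<le> ennreal (inverse C) * (ennreal C * A)"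
    by (intro mult_left_mono) auto
  also have "\<dots> = A"
    using C by (simp add: mult.assoc[symmetric] ennreal_mult'[symmetric])
  finally have "ennreal (inverse C) * B \<le> A" .
  moreover have "A \<le> ennreal C * B"
    using assms(1) C by (meson dual_order.trans ennreal_leI mult_right_mono zero_le)
  ultimately show ?thesis
    using C by (auto simp: asymp_times_def comparable_times_def)
qed

lemma comparable_timesD:
  assumes "comparable_times C A B" "C \<ge> 1"
  shows "A \<le> ennreal C * B" "B \<le> ennreal C * A"
proof -
  show "A \<le> ennreal C * B" using assms by (simp add: comparable_times_def)
  have "ennreal C * (ennreal (inverse C) * B) \<le> ennreal C * A"
    using assms by (intro mult_left_mono) (auto simp: comparable_times_def)
  moreover have "ennreal C * (ennreal (inverse C) * B) = B"
    using assms by (simp add: mult.assoc[symmetric] ennreal_mult'[symmetric])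
  ultimately show "B \<le> ennreal C * A" by simp
qed

lemma asymp_timesE:
  assumes "asymp_times A B"
  obtains C where "C \<ge> 1" "A \<le> ennreal C * B" "B \<le> ennreal C * A"
  using assms comparable_timesD unfolding asymp_times_def by metis

lemma asymp_times_sym: "asymp_times A B \<Longrightarrow> asymp_times B A"
  by (metis asymp_timesE asymp_timesI)

lemma asymp_times_trans:
  assumes "asymp_times A B" "asymp_times B C"
  shows "asymp_times A C"
proof -
  obtain c where c: "c \<ge> 1" "A \<le> ennreal c * B" "B \<le> ennreal c * A"
    using assms(1) by (rule asymp_timesE)
  obtain d where d: "d \<ge> 1" "B \<le> ennreal d * C" "C \<le> ennreal d * B"
    using assms(2) by (rule asymp_timesE)
  have "A \<le> ennreal c * (ennreal d * C)"
    using c d by (meson dual_order.trans mult_left_mono zero_le)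
  moreover have "C \<le> ennreal d * (ennreal c * A)"
    using c d by (meson dual_order.trans mult_left_mono zero_le)
  ultimately show ?thesis using c d
    by (intro asymp_timesI[of _ "c * d" _ "d * c"]) (auto simp: mult.assoc ennreal_mult)
qed

lemma asymp_times_infsumI:
  fixes f :: "'x \<Rightarrow> ennreal"
  assumes "\<And>x. x \<in> A \<Longrightarrow> f x \<le> ennreal c * g x" "\<And>x. x \<in> A \<Longrightarrow> g x \<le> ennreal c' * f x"
  shows "asymp_times (infsum f A) (infsum g A)"
  using assms by (intro asymp_timesI[of _ c _ c']) (auto simp: infsum_cmult_ennreal[symmetric] intro!: infsum_mono_ennreal)

lemma asymp_plus_timesI:
  assumes "A \<le> ennreal c * B + ennreal d" "B \<le> ennreal c' * A + ennreal d'"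
  shows "asymp_plus_times A B"
proof -
  define C where "C = max 1 (max c c')"
  define D where "D = max 1 (max d d')"
  have *: "C > 0" "c \<le> C" "c' \<le> C" "D > 0" "d \<le> D" "d' \<le> D" by (auto simp: C_def D_def)
  have "A \<le> ennreal C * B + ennreal D"
    using * by (intro order.trans[OF assms(1)] add_mono mult_right_mono ennreal_leI) auto
  moreover have "B \<le> ennreal C * A + ennreal D"
    using * by (intro order.trans[OF assms(2)] add_mono mult_right_mono ennreal_leI) auto
  ultimately show ?thesis using * by (auto simp: asymp_plus_times_def)
qed

lemma asymp_plus_times_trans:
  assumes "asymp_plus_times A B" "asymp_plus_times B C"
  shows "asymp_plus_times A C"
proof -
  obtain c1 c2 where c: "c1 > 0" "c2 > 0" "A \<le> ennreal c1 * B + ennreal c2" "B \<le> ennreal c1 * A + ennreal c2"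
    using assms(1) by (auto simp: asymp_plus_times_def)
  obtain d1 d2 where d: "d1 > 0" "d2 > 0" "B \<le> ennreal d1 * C + ennreal d2" "C \<le> ennreal d1 * B + ennreal d2"
    using assms(2) by (auto simp: asymp_plus_times_def)
  have "A \<le> ennreal c1 * (ennreal d1 * C + ennreal d2) + ennreal c2"
    using c d by (meson dual_order.trans mult_left_mono add_right_mono zero_le)
  also have "\<dots> = ennreal (c1 * d1) * C + ennreal (c1 * d2 + c2)"
    using c d by (simp add: distrib_left ennreal_mult mult.assoc add.assoc ennreal_plus)
  finally have 1: "A \<le> ennreal (c1 * d1) * C + ennreal (c1 * d2 + c2)" .
  have "C \<le> ennreal d1 * (ennreal c1 * A + ennreal c2) + ennreal d2"
    using c d by (meson dual_order.trans mult_left_mono add_right_mono zero_le)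
  also have "\<dots> = ennreal (d1 * c1) * A + ennreal (d1 * c2 + d2)"
    using c d by (simp add: distrib_left ennreal_mult mult.assoc add.assoc ennreal_plus)
  finally show ?thesis using 1 by (intro asymp_plus_timesI)
qed

lemma asymp_times_imp_plus:
  assumes "asymp_times A B"
  shows "asymp_plus_times A B"
proof -
  obtain c where "c \<ge> 1" "A \<le> ennreal c * B" "B \<le> ennreal c * A"
    using assms by (rule asymp_timesE)
  then show ?thesis by (intro asymp_plus_timesI[of _ c _ 0 c 0]) auto
qed

lemma asymp_plus_times_finite_iff:
  assumes "asymp_plus_times A B"
  shows "A < \<infinity> \<longleftrightarrow> B < \<infinity>"
proof -
  obtain c1 c2 where c: "A \<le> ennreal c1 * B + ennreal c2" "B \<le> ennreal c1 * A + ennreal c2"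
    using assms by (auto simp: asymp_plus_times_def)
  have fin: "ennreal c1 * X + ennreal c2 < \<infinity>" if "X < \<infinity>" for X
    using that by (simp add: ennreal_mult_less_top less_top)
  show ?thesis using fin c by (meson le_less_trans)
qed

lemma suminf_ennreal_leI:
  fixes f :: "nat \<Rightarrow> ennreal"
  assumes "\<And>n. (\<Sum>i<n. f i) \<le> c"
  shows "suminf f \<le> c"
  using assms by (subst suminf_eq_SUP) (auto intro!: SUP_least)

lemma sum_le_suminf_ennreal:
  fixes f :: "nat \<Rightarrow> ennreal"
  assumes "finite A"
  shows "sum f A \<le> suminf f"
  using assms by (intro sum_le_suminf) auto


section \<open>Comparing a monotone integral with its Riemann sums\<close>

lemma asymp_plus_times_sum_integral:
  fixes V :: "real \<Rightarrow> ennreal"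
  assumes anti: "antimono V" and fin: "\<And>t. V t < \<infinity>" and T: "T > 0"
  shows "asymp_plus_times (\<Sum>n. V (a + real n * T)) (\<integral>\<^sup>+t\<in>{0..}. V t \<partial>lborel)"
proof -
  define J where "J n = {a + real n * T ..< a + real (Suc n) * T}" for n
  have JI: "t \<in> J n \<longleftrightarrow> n = nat \<lfloor>(t - a) / T\<rfloor>" if "t \<ge> a" for t n
  proof -
    have "t \<in> J n \<longleftrightarrow> real n \<le> (t - a) / T \<and> (t - a) / T < real n + 1"
      using T by (auto simp: J_def field_simps)
    also have "\<dots> \<longleftrightarrow> int n = \<lfloor>(t - a) / T\<rfloor>"
      using floor_eq_iff[of "(t - a) / T" "int n"] by auto
    also have "\<dots> \<longleftrightarrow> n = nat \<lfloor>(t - a) / T\<rfloor>"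
      using divide_nonneg_pos[of "t - a" T] that T by linarith
    finally show ?thesis .
  qed
  have emJ: "emeasure lborel (J n) = ennreal T" for n
    using T by (simp add: J_def algebra_simps)
  have sumJ: "(\<integral>\<^sup>+t. (\<Sum>n. c n * indicator (J n) t) \<partial>lborel) = ennreal T * (\<Sum>n. c n)"
    for c :: "nat \<Rightarrow> ennreal"
  proof -
    have "(\<integral>\<^sup>+t. (\<Sum>n. c n * indicator (J n) t) \<partial>lborel) = (\<Sum>n. \<integral>\<^sup>+t. c n * indicator (J n) t \<partial>lborel)"
      by (intro nn_integral_suminf) (auto simp: J_def)
    also have "\<dots> = (\<Sum>n. ennreal T * c n)"
      by (intro suminf_cong, subst nn_integral_cmult_indicator) (auto simp: emJ mult.commute, simp add: J_def)
    finally show ?thesis by simp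
  qed
  have step: "(\<Sum>n. c n * indicator (J n) t) = (if t \<ge> a then c (nat \<lfloor>(t - a) / T\<rfloor>) else 0)"
    for c :: "nat \<Rightarrow> ennreal" and t
  proof (cases "t \<ge> a")
    case True
    have "(\<Sum>n. c n * indicator (J n) t) = (\<Sum>n\<in>{nat \<lfloor>(t - a) / T\<rfloor>}. c n * indicator (J n) t)"
      by (rule suminf_finite) (auto simp: indicator_def JI[OF True])
    then show ?thesis using True by (simp add: indicator_def JI[OF True])
  next
    case False
    have "t \<notin> J n" for n
    proof
      assume "t \<in> J n"
      then have "a + real n * T \<le> t" by (simp add: J_def)
      moreover have "real n * T \<ge> 0" using T by simp
      ultimately show False using False by linarith
    qed
    then show ?thesis using False by simp
  qed
  have near: "a + real (nat \<lfloor>(t - a) / T\<rfloor>) * T \<le> t \<and> t \<le> a + real (nat \<lfloor>(t - a) / T\<rfloor> + 1) * T"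
    if "t \<ge> a" for t
    using JI[OF that, of "nat \<lfloor>(t - a) / T\<rfloor>"] by (auto simp: J_def)
  let ?S = "\<Sum>n. V (a + real n * T)" and ?I = "\<integral>\<^sup>+t\<in>{0..}. V t \<partial>lborel"
  have upper: "?I \<le> ennreal T * ?S + ennreal (enn2real (V 0) * \<bar>a\<bar>)"
  proof -
    have "?I \<le> (\<integral>\<^sup>+t. (\<Sum>n. V (a + real n * T) * indicator (J n) t) + V 0 * indicator {0..\<bar>a\<bar>} t \<partial>lborel)"
    proof (intro nn_integral_mono)
      fix t :: real
      show "V t * indicator {0..} t \<le> (\<Sum>n. V (a + real n * T) * indicator (J n) t) + V 0 * indicator {0..\<bar>a\<bar>} t"
      proof (cases "t \<ge> a")
        case True
        then have "V t \<le> V (a + real (nat \<lfloor>(t - a) / T\<rfloor>) * T)"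
          using near[OF True] by (intro antimonoD[OF anti]) auto
        then have "V t \<le> V (a + real (nat \<lfloor>(t - a) / T\<rfloor>) * T) + V 0 * indicator {0..\<bar>a\<bar>} t"
          by (rule add_increasing2[OF zero_le])
        then show ?thesis using True unfolding step by (cases "t \<ge> 0") simp_all
      next
        case False
        show ?thesis
        proof (cases "t \<ge> 0")
          case True
          then have "t \<in> {0..\<bar>a\<bar>}" using False by auto
          then show ?thesis using False True antimonoD[OF anti True] unfolding step by simp
        qed simp
      qed
    qed
    also have "\<dots> = ennreal T * ?S + V 0 * ennreal \<bar>a\<bar>"
      by (subst nn_integral_add) (simp_all add: sumJ nn_integral_cmult_indicator, simp_all add: J_def)
    also have "V 0 * ennreal \<bar>a\<bar> = ennreal (enn2real (V 0) * \<bar>a\<bar>)"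
      using fin[of 0] by (simp add: ennreal_mult)
    finally show ?thesis .
  qed
  obtain k :: nat where k: "real k * T \<ge> \<bar>a\<bar>"
    using reals_Archimedean3[OF T] by (meson less_imp_le)
  have lower: "ennreal T * (\<Sum>n. V (a + real (n + Suc k) * T)) \<le> ?I"
  proof -
    have "ennreal T * (\<Sum>n. V (a + real (n + Suc k) * T)) =
      ennreal T * (\<Sum>n. if n < k then 0 else V (a + real (Suc n) * T))"
      by (subst suminf_offset[of _ k]) auto
    also have "\<dots> = (\<integral>\<^sup>+t. (\<Sum>n. (if n < k then 0 else V (a + real (Suc n) * T)) * indicator (J n) t) \<partial>lborel)"
      by (simp add: sumJ)
    also have "\<dots> \<le> ?I"
    proof (intro nn_integral_mono)
      fix t :: real
      show "(\<Sum>n. (if n < k then 0 else V (a + real (Suc n) * T)) * indicator (J n) t) \<le> V t * indicator {0..} t"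
      proof (cases "t \<ge> a \<and> nat \<lfloor>(t - a) / T\<rfloor> \<ge> k")
        case True
        have "0 \<le> a + real k * T" using k by auto
        also have "\<dots> \<le> a + real (nat \<lfloor>(t - a) / T\<rfloor>) * T"
          using True T by (intro add_left_mono mult_right_mono of_nat_mono) simp_all
        also have "\<dots> \<le> t" using near True by auto
        finally have "t \<ge> 0" .
        moreover have "V (a + real (Suc (nat \<lfloor>(t - a) / T\<rfloor>)) * T) \<le> V t"
          using near[of t] True by (intro antimonoD[OF anti]) auto
        ultimately show ?thesis using True unfolding step by simp
      qed (auto simp: step)
    qed
    finally show ?thesis .
  qed
  have "?S = (\<Sum>n. V (a + real (n + Suc k) * T)) + (\<Sum>n<Suc k. V (a + real n * T))"
    by (rule suminf_offset) auto
  also have "\<dots> \<le> ennreal (1 / T) * ?I + ennreal (\<Sum>n<Suc k. enn2real (V (a + real n * T)))"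
  proof (intro add_mono)
    have "(\<Sum>n. V (a + real (n + Suc k) * T)) = ennreal (1 / T) * (ennreal T * (\<Sum>n. V (a + real (n + Suc k) * T)))"
      using T by (simp add: mult.assoc[symmetric] ennreal_mult'[symmetric])
    also have "\<dots> \<le> ennreal (1 / T) * ?I" using lower by (intro mult_left_mono) auto
    finally show "(\<Sum>n. V (a + real (n + Suc k) * T)) \<le> ennreal (1 / T) * ?I" .
    show "(\<Sum>n<Suc k. V (a + real n * T)) \<le> ennreal (\<Sum>n<Suc k. enn2real (V (a + real n * T)))"
      using fin by (subst sum_ennreal[symmetric]) auto
  qed
  finally show ?thesis using upper by (intro asymp_plus_timesI)
qed

section \<open>Counting functions of exponential growth\<close>

text \<open>The elements of \<open>P\<close> whose length lies in the \<open>n\<close>-th interval of length \<open>L\<close>.\<close>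

definition layer :: "'g set \<Rightarrow> ('g \<Rightarrow> real) \<Rightarrow> real \<Rightarrow> nat \<Rightarrow> 'g set" where
  "layer P l L n = {g\<in>P. real n * L \<le> l g \<and> l g < real (Suc n) * L}"

lemma layer_iff:
  assumes "L > 0" "g \<in> P" "l g \<ge> 0"
  shows "g \<in> layer P l L n \<longleftrightarrow> n = nat \<lfloor>l g / L\<rfloor>"
proof -
  have "g \<in> layer P l L n \<longleftrightarrow> real n \<le> l g / L \<and> l g / L < real n + 1"
    using assms by (auto simp: layer_def field_simps)
  also have "\<dots> \<longleftrightarrow> int n = \<lfloor>l g / L\<rfloor>"
    using floor_eq_iff[of "l g / L" "int n"] by auto
  also have "\<dots> \<longleftrightarrow> n = nat \<lfloor>l g / L\<rfloor>"
    using divide_nonneg_pos[of "l g" L] assms by linarith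
  finally show ?thesis .
qed

text \<open>Two-sided exponential growth of the balls gives two-sided growth of sufficiently thick
  layers, because the lower bound on the larger ball dominates the upper bound on the smaller.\<close>

lemma layer_growth:
  fixes l :: "'g \<Rightarrow> real"
  assumes b: "b > 1" and \<delta>: "\<delta> > 0" and c: "c > 0"
    and fin: "\<And>t. finite {g\<in>P. l g \<le> t}"
    and count: "\<And>t. t > 0 \<Longrightarrow> c * b powr (\<delta> * t) \<le> card {g\<in>P. l g \<le> t}"
      "\<And>t. t > 0 \<Longrightarrow> card {g\<in>P. l g \<le> t} \<le> C * b powr (\<delta> * t)"
  obtains L C' where "L \<ge> 1" "C' \<ge> 1" "\<And>n. finite (layer P l L n)"
    "\<And>n. b powr (\<delta> * (real n * L)) \<le> card (layer P l L n)"
    "\<And>n. card (layer P l L n) \<le> C' * b powr (\<delta> * (real n * L))"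
proof -
  define A where "A = max 1 C * b powr \<delta>"
  have A: "A \<ge> 1" unfolding A_def
    using b \<delta> ge_one_powr_ge_zero[of b \<delta>] mult_mono[of 1 "max 1 C" 1 "b powr \<delta>"] by auto
  have up: "card {g\<in>P. l g \<le> t} \<le> A * b powr (\<delta> * t)" if "t \<ge> 0" for t
  proof -
    have "real (card {g\<in>P. l g \<le> t}) \<le> card {g\<in>P. l g \<le> t + 1}"
      using fin by (intro of_nat_mono card_mono) auto
    also have "\<dots> \<le> C * b powr (\<delta> * (t + 1))" using count(2) that by simp
    also have "\<dots> \<le> max 1 C * b powr (\<delta> * (t + 1))" by (intro mult_right_mono) auto
    also have "\<dots> = A * b powr (\<delta> * t)" by (simp add: A_def distrib_left powr_add)
    finally show ?thesis .
  qed
  \<comment> \<open>The thickness is chosen such that the lower bound for the ball of radius \<open>(n + 1) L - 1\<close>, which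
    avoids the half-open end of the layer, exceeds the upper bound for the radius \<open>n L\<close>.\<close>
  define L where "L = 1 + max 1 (ln ((A + 1) / c) / (\<delta> * ln b))"
  have L: "L \<ge> 2" by (simp add: L_def)
  have big: "c * b powr (\<delta> * (L - 1)) \<ge> A + 1"
  proof -
    have "(A + 1) / c = b powr (\<delta> * (ln ((A + 1) / c) / (\<delta> * ln b)))"
      using b \<delta> A c by (simp add: powr_def)
    also have "\<dots> \<le> b powr (\<delta> * (L - 1))"
      using b \<delta> by (intro powr_mono mult_left_mono) (auto simp: L_def)
    finally show ?thesis using c by (simp add: field_simps)
  qed
  have finl: "finite (layer P l L n)" for n
    by (rule finite_subset[OF _ fin[of "real (Suc n) * L"]]) (auto simp: layer_def)
  have "b powr (\<delta> * (real n * L)) \<le> card (layer P l L n)" for n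
  proof -
    have sub: "{g\<in>P. l g \<le> real (Suc n) * L - 1} \<subseteq> layer P l L n \<union> {g\<in>P. l g \<le> real n * L}"
      by (auto simp: layer_def)
    have "real (Suc n) * L \<ge> 1 * L" using L by (intro mult_right_mono) auto
    then have pos: "real (Suc n) * L - 1 > 0" using L by linarith
    have "(A + 1) * b powr (\<delta> * (real n * L)) \<le> c * b powr (\<delta> * (L - 1)) * b powr (\<delta> * (real n * L))"
      using big by (intro mult_right_mono) auto
    also have "\<dots> = c * b powr (\<delta> * (real (Suc n) * L - 1))"
      by (simp add: mult.assoc powr_add[symmetric] algebra_simps)
    also have "\<dots> \<le> card {g\<in>P. l g \<le> real (Suc n) * L - 1}"
      using count(1) pos by blast
    also have "\<dots> \<le> card (layer P l L n \<union> {g\<in>P. l g \<le> real n * L})"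
      using sub finl fin by (intro of_nat_mono card_mono) auto
    also have "\<dots> \<le> real (card (layer P l L n)) + card {g\<in>P. l g \<le> real n * L}"
      unfolding of_nat_add[symmetric] of_nat_le_iff by (rule card_Un_le)
    also have "real (card {g\<in>P. l g \<le> real n * L}) \<le> A * b powr (\<delta> * (real n * L))"
      using up[of "real n * L"] L by simp
    finally show ?thesis by (simp add: algebra_simps)
  qed
  moreover have "card (layer P l L n) \<le> (A * b powr (\<delta> * L)) * b powr (\<delta> * (real n * L))" for n
  proof -
    have "real (card (layer P l L n)) \<le> card {g\<in>P. l g \<le> real (Suc n) * L}"
      using fin by (intro of_nat_mono card_mono) (auto simp: layer_def)
    also have "\<dots> \<le> A * b powr (\<delta> * (real (Suc n) * L))"
      using L by (intro up) simp
    also have "\<dots> = (A * b powr (\<delta> * L)) * b powr (\<delta> * (real n * L))"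
      by (simp add: mult.assoc powr_add[symmetric] algebra_simps)
    finally show ?thesis .
  qed
  moreover have "A * b powr (\<delta> * L) \<ge> 1"
    using A L b \<delta> mult_mono[of 1 A 1 "b powr (\<delta> * L)"] by (simp add: ge_one_powr_ge_zero)
  ultimately show ?thesis using that[of L] L finl by auto
qed

text \<open>Exponential growth makes every layer contribute about one term of a Riemann sum.\<close>

lemma asymp_plus_times_weighted_sum_integral:
  fixes l :: "'g \<Rightarrow> real" and V :: "real \<Rightarrow> ennreal"
  assumes b: "b > 1" and \<delta>: "\<delta> > 0" and c: "c > 0" and l: "\<And>g. g \<in> P \<Longrightarrow> l g \<ge> 0"
    and fin: "\<And>t. finite {g\<in>P. l g \<le> t}"
    and count: "\<And>t. t > 0 \<Longrightarrow> c * b powr (\<delta> * t) \<le> card {g\<in>P. l g \<le> t}"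
      "\<And>t. t > 0 \<Longrightarrow> card {g\<in>P. l g \<le> t} \<le> C * b powr (\<delta> * t)"
    and V: "antimono V" "\<And>t. V t < \<infinity>"
  shows "asymp_plus_times (\<Sum>\<^sub>\<infinity>g\<in>P. ennreal (b powr (- \<delta> * l g)) * V (a + l g * ln b))
    (\<integral>\<^sup>+t\<in>{0..}. V t \<partial>lborel)"
proof -
  obtain L C' where L: "L \<ge> 1" "C' \<ge> 1" and finl: "\<And>n. finite (layer P l L n)"
    and lo: "\<And>n. b powr (\<delta> * (real n * L)) \<le> card (layer P l L n)"
    and up: "\<And>n. card (layer P l L n) \<le> C' * b powr (\<delta> * (real n * L))"
    using layer_growth[OF b \<delta> c fin count] by blast
  define T where "T = L * ln b"
  have T: "T > 0" using L b by (simp add: T_def)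
  define F where "F g = ennreal (b powr (- \<delta> * l g)) * V (a + l g * ln b)" for g
  let ?I = "\<integral>\<^sup>+t\<in>{0..}. V t \<partial>lborel"
  have cmul: "(\<Sum>g\<in>X. ennreal r * v) = ennreal (real (card X) * r) * v" if "r \<ge> 0" for X :: "'g set" and r v
    using that by (simp add: ennreal_mult ennreal_of_nat_eq_real_of_nat mult.assoc)
  have layer_le: "sum F (layer P l L n) \<le> ennreal C' * V (a + real n * T)" for n
  proof -
    have "b powr (- \<delta> * l g) \<le> b powr (- \<delta> * (real n * L)) \<and> real n * T \<le> l g * ln b"
      if "g \<in> layer P l L n" for g
    proof -
      have "real n * L \<le> l g" using that by (simp add: layer_def)
      then show ?thesis
        using b \<delta> mult_right_mono[of "real n * L" "l g" "ln b"] by (simp add: T_def mult.assoc)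
    qed
    then have "sum F (layer P l L n) \<le> (\<Sum>g\<in>layer P l L n. ennreal (b powr (- \<delta> * (real n * L))) * V (a + real n * T))"
      unfolding F_def by (intro sum_mono mult_mono ennreal_leI antimonoD[OF V(1)]) auto
    also have "\<dots> = ennreal (real (card (layer P l L n)) * b powr (- \<delta> * (real n * L))) * V (a + real n * T)"
      by (rule cmul) auto
    also have "\<dots> \<le> ennreal C' * V (a + real n * T)"
    proof (intro mult_right_mono ennreal_leI)
      have "real (card (layer P l L n)) * b powr (- \<delta> * (real n * L)) \<le>
        C' * b powr (\<delta> * (real n * L)) * b powr (- \<delta> * (real n * L))"
        using up by (intro mult_right_mono) auto
      also have "\<dots> = C'" using b by (simp add: mult.assoc powr_add[symmetric])
      finally show "real (card (layer P l L n)) * b powr (- \<delta> * (real n * L)) \<le> C'" .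
    qed auto
    finally show ?thesis .
  qed
  have layer_ge: "ennreal (b powr (- \<delta> * L)) * V ((a + T) + real n * T) \<le> sum F (layer P l L n)" for n
  proof -
    have "ennreal (b powr (- \<delta> * L)) * V ((a + T) + real n * T) \<le>
      ennreal (real (card (layer P l L n)) * b powr (- \<delta> * (real (Suc n) * L))) * V ((a + T) + real n * T)"
    proof (intro mult_right_mono ennreal_leI)
      have "b powr (- \<delta> * L) = b powr (\<delta> * (real n * L)) * b powr (- \<delta> * (real (Suc n) * L))"
        by (simp add: powr_add[symmetric] algebra_simps)
      also have "\<dots> \<le> real (card (layer P l L n)) * b powr (- \<delta> * (real (Suc n) * L))"
        using lo by (intro mult_right_mono) auto
      finally show "b powr (- \<delta> * L) \<le> real (card (layer P l L n)) * b powr (- \<delta> * (real (Suc n) * L))" .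
    qed auto
    also have "\<dots> = (\<Sum>g\<in>layer P l L n. ennreal (b powr (- \<delta> * (real (Suc n) * L))) * V ((a + T) + real n * T))"
      by (rule cmul[symmetric]) auto
    also have "\<dots> \<le> sum F (layer P l L n)"
    proof -
      have "b powr (- \<delta> * (real (Suc n) * L)) \<le> b powr (- \<delta> * l g) \<and> l g * ln b \<le> T + real n * T"
        if "g \<in> layer P l L n" for g
      proof -
        have le: "l g \<le> real (Suc n) * L" using that by (simp add: layer_def)
        have "l g * ln b \<le> real (Suc n) * L * ln b" using le b by (intro mult_right_mono) auto
        moreover have "b powr (- \<delta> * (real (Suc n) * L)) \<le> b powr (- \<delta> * l g)"
          using le b \<delta> by (intro powr_mono mult_left_mono_neg) auto
        ultimately show ?thesis by (simp add: T_def algebra_simps)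
      qed
      then show ?thesis unfolding F_def
        by (intro sum_mono mult_mono ennreal_leI antimonoD[OF V(1)]) auto
    qed
    finally show ?thesis .
  qed
  have disj: "disjoint_family_on (layer P l L) UNIV"
  proof -
    have "m = n" if "g \<in> layer P l L m" "g \<in> layer P l L n" for g m n
    proof -
      have "g \<in> P" using that(1) by (simp add: layer_def)
      then show ?thesis using that layer_iff[of L g P l] l L by simp
    qed
    then show ?thesis by (auto simp: disjoint_family_on_def)
  qed
  have "infsum F P \<le> ennreal C' * (\<Sum>n. V (a + real n * T))"
  proof (rule infsum_ennreal_leI)
    fix E assume E: "finite E" "E \<subseteq> P"
    define K where "K = (\<lambda>g. nat \<lfloor>l g / L\<rfloor>) ` E"
    have "E \<subseteq> (\<Union>n\<in>K. layer P l L n)"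
    proof
      fix g assume g: "g \<in> E"
      then have "g \<in> layer P l L (nat \<lfloor>l g / L\<rfloor>)"
        using E L l by (subst layer_iff) auto
      then show "g \<in> (\<Union>n\<in>K. layer P l L n)" using g by (auto simp: K_def)
    qed
    then have "sum F E \<le> sum F (\<Union>n\<in>K. layer P l L n)"
      using E finl by (intro sum_mono2) (auto simp: K_def)
    also have "\<dots> = (\<Sum>n\<in>K. sum F (layer P l L n))"
      using E finl disj by (intro sum.UNION_disjoint) (auto simp: K_def disjoint_family_on_def)
    also have "\<dots> \<le> (\<Sum>n\<in>K. ennreal C' * V (a + real n * T))"
      by (intro sum_mono layer_le)
    also have "\<dots> \<le> (\<Sum>n. ennreal C' * V (a + real n * T))"
      using E by (intro sum_le_suminf_ennreal) (auto simp: K_def)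
    finally show "sum F E \<le> ennreal C' * (\<Sum>n. V (a + real n * T))" by simp
  qed
  moreover have "(\<Sum>n. V ((a + T) + real n * T)) \<le> ennreal (b powr (\<delta> * L)) * infsum F P"
  proof (rule suminf_ennreal_leI)
    fix N
    have "(\<Sum>n<N. V ((a + T) + real n * T)) = ennreal (b powr (\<delta> * L)) *
      (\<Sum>n<N. ennreal (b powr (- \<delta> * L)) * V ((a + T) + real n * T))"
      using b by (simp add: sum_distrib_left mult.assoc[symmetric] ennreal_mult'[symmetric] powr_add[symmetric])
    also have "(\<Sum>n<N. ennreal (b powr (- \<delta> * L)) * V ((a + T) + real n * T)) \<le> (\<Sum>n<N. sum F (layer P l L n))"
      by (intro sum_mono layer_ge)
    also have "\<dots> = sum F (\<Union>n\<in>{..<N}. layer P l L n)"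
      using finl disj by (intro sum.UNION_disjoint[symmetric]) (auto simp: disjoint_family_on_def)
    also have "\<dots> \<le> infsum F P"
      using finl by (intro sum_le_infsum_ennreal) (auto simp: layer_def)
    finally show "(\<Sum>n<N. V ((a + T) + real n * T)) \<le> ennreal (b powr (\<delta> * L)) * infsum F P"
      using mult_left_mono[OF _ zero_le] by (metis (no_types, lifting))
  qed
  moreover note asymp_plus_times_sum_integral[OF V T, of a] asymp_plus_times_sum_integral[OF V T, of "a + T"]
  ultimately have *: "infsum F P \<le> ennreal C' * (\<Sum>n. V (a + real n * T))"
    "(\<Sum>n. V ((a + T) + real n * T)) \<le> ennreal (b powr (\<delta> * L)) * infsum F P"
    "asymp_plus_times (\<Sum>n. V (a + real n * T)) ?I"
    "asymp_plus_times (\<Sum>n. V ((a + T) + real n * T)) ?I" by auto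
  obtain c1 c2 where c12: "c1 > 0" "c2 > 0" "(\<Sum>n. V (a + real n * T)) \<le> ennreal c1 * ?I + ennreal c2"
    using *(3) by (auto simp: asymp_plus_times_def)
  obtain d1 d2 where d12: "d1 > 0" "d2 > 0" "?I \<le> ennreal d1 * (\<Sum>n. V ((a + T) + real n * T)) + ennreal d2"
    using *(4) by (auto simp: asymp_plus_times_def)
  have "infsum F P \<le> ennreal C' * (ennreal c1 * ?I + ennreal c2)"
    using *(1) c12(3) by (meson order.trans mult_left_mono zero_le)
  also have "\<dots> = ennreal (C' * c1) * ?I + ennreal (C' * c2)"
    using L c12 by (simp add: distrib_left ennreal_mult mult.assoc)
  finally have 1: "infsum F P \<le> ennreal (C' * c1) * ?I + ennreal (C' * c2)" .
  have "?I \<le> ennreal d1 * (ennreal (b powr (\<delta> * L)) * infsum F P) + ennreal d2"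
    using *(2) d12(3) by (meson order.trans mult_left_mono add_right_mono zero_le)
  then have "?I \<le> ennreal (d1 * b powr (\<delta> * L)) * infsum F P + ennreal d2"
    using d12 by (simp add: ennreal_mult mult.assoc)
  with 1 show ?thesis unfolding F_def by (intro asymp_plus_timesI)
qed

section \<open>Gromov products with boundary points\<close>

lemma gromov_product_commute: "gromov_product x y z = gromov_product y x z"
  by (simp add: gromov_product_def dist_commute)

lemma gromov_product_nonneg: "gromov_product x y z \<ge> 0"
  using dist_triangle[of x y z] by (simp add: gromov_product_def dist_commute)

lemma gromov_product_le_dist: "gromov_product x y z \<le> dist y z"
  using dist_triangle[of x z y] by (simp add: gromov_product_def)

lemma gromov_product_change_base: "gromov_product x y w - dist z w \<le> gromov_product x y z"
  using dist_triangle[of x w z] dist_triangle[of y w z] by (simp add: gromov_product_def field_simps)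

lemma gromov_product_change_base_eq:
  "gromov_product x y z = gromov_product x y w - gromov_product x z w - gromov_product y z w + dist w z"
  by (simp add: gromov_product_def dist_commute field_simps)

lemma gromov_product_swap_base: "gromov_product x w z + gromov_product x z w = dist w z"
  by (simp add: gromov_product_def dist_commute field_simps)

lemma gromov_sequence_iff:
  "gromov_sequence w x \<longleftrightarrow> (\<forall>r. \<exists>N. \<forall>n\<ge>N. \<forall>m\<ge>N. r \<le> gromov_product (x n) (x m) w)"
  unfolding gromov_sequence_def filterlim_at_top eventually_prod_sequentially by (auto; blast)

lemma gromov_equivD:
  assumes "(x, y) \<in> gromov_equiv w"
  shows "gromov_sequence w x" "gromov_sequence w y"
    "\<forall>\<^sub>F n in sequentially. r \<le> gromov_product (x n) (y n) w"
  using assms by (simp_all add: gromov_equiv_def filterlim_at_top)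

lemma boundary_product_commute:
  fixes w :: "'a::metric_space"
  shows "boundary_product \<xi> \<eta> w = boundary_product \<eta> \<xi> w"
proof -
  have le: "boundary_product \<xi> \<eta> w \<le> boundary_product \<eta> \<xi> w" for \<xi> \<eta> :: "(nat \<Rightarrow> 'a) set"
    unfolding boundary_product_def
  proof (intro INF_greatest)
    fix y x assume yx: "y \<in> \<eta>" "x \<in> \<xi>"
    have "(INF x\<in>\<xi>. INF y\<in>\<eta>. Liminf (sequentially \<times>\<^sub>F sequentially)
        (\<lambda>(n, m). ereal (gromov_product (x n) (y m) w))) \<le>
      Liminf (sequentially \<times>\<^sub>F sequentially) (\<lambda>(n, m). ereal (gromov_product (x n) (y m) w))"
      using yx by (meson INF_lower INF_lower2)
    also have "\<dots> \<le> Liminf (sequentially \<times>\<^sub>F sequentially) (\<lambda>(n, m). ereal (gromov_product (y n) (x m) w))"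
    proof -
      have "\<forall>\<^sub>F (n, m) in sequentially \<times>\<^sub>F sequentially. c < ereal (gromov_product (y n) (x m) w)"
        if c: "c < Liminf (sequentially \<times>\<^sub>F sequentially) (\<lambda>(n, m). ereal (gromov_product (x n) (y m) w))" for c
      proof -
        obtain N where "\<forall>n\<ge>N. \<forall>m\<ge>N. c < ereal (gromov_product (x n) (y m) w)"
          using less_LiminfD[OF c] unfolding eventually_prod_sequentially by auto
        then have "\<forall>n\<ge>N. \<forall>m\<ge>N. c < ereal (gromov_product (y n) (x m) w)"
          by (simp add: gromov_product_commute)
        then show ?thesis unfolding eventually_prod_sequentially by auto
      qed
      then show ?thesis
        unfolding le_Liminf_iff by (auto simp: case_prod_unfold)
    qed
    finally show "(INF x\<in>\<xi>. INF y\<in>\<eta>. Liminf (sequentially \<times>\<^sub>F sequentially)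
        (\<lambda>(n, m). ereal (gromov_product (x n) (y m) w))) \<le>
      Liminf (sequentially \<times>\<^sub>F sequentially) (\<lambda>(n, m). ereal (gromov_product (y n) (x m) w))" .
  qed
  show ?thesis by (intro antisym le)
qed

lemma less_boundary_productD:
  assumes "ereal r < boundary_product \<xi> \<eta> w" "s \<in> \<xi>" "t \<in> \<eta>"
  obtains N where "\<And>n m. n \<ge> N \<Longrightarrow> m \<ge> N \<Longrightarrow> r < gromov_product (s n) (t m) w"
proof -
  have "ereal r < Liminf (sequentially \<times>\<^sub>F sequentially) (\<lambda>(n, m). ereal (gromov_product (s n) (t m) w))"
    using assms unfolding boundary_product_def by (meson INF_lower INF_lower2 order.strict_trans2)
  from less_LiminfD[OF this] show ?thesis
    using that unfolding eventually_prod_sequentially by auto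
qed

lemma le_boundary_productI:
  assumes "\<And>s t. s \<in> \<xi> \<Longrightarrow> t \<in> \<eta> \<Longrightarrow> \<exists>N. \<forall>n\<ge>N. \<forall>m\<ge>N. r \<le> gromov_product (s n) (t m) w"
  shows "ereal r \<le> boundary_product \<xi> \<eta> w"
  unfolding boundary_product_def
proof (intro INF_greatest Liminf_bounded)
  fix s t assume "s \<in> \<xi>" "t \<in> \<eta>"
  from assms[OF this] show "\<forall>\<^sub>F p in sequentially \<times>\<^sub>F sequentially.
      ereal r \<le> (case p of (n, m) \<Rightarrow> ereal (gromov_product (s n) (t m) w))"
    unfolding eventually_prod_sequentially by auto
qed

text \<open>The product of a boundary point with a point of the space, as a real number.\<close>

definition point_product :: "(nat \<Rightarrow> 'a::metric_space) set \<Rightarrow> 'a \<Rightarrow> 'a \<Rightarrow> real" where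
  "point_product \<xi> x z = real_of_ereal (boundary_point_product \<xi> x z)"

lemma boundary_point_product_eq:
  assumes "\<xi> \<noteq> {}"
  shows "boundary_point_product \<xi> x z = ereal (point_product \<xi> x z)"
    and "0 \<le> point_product \<xi> x z" "point_product \<xi> x z \<le> dist x z"
proof -
  obtain s where s: "s \<in> \<xi>" using assms by auto
  have 1: "0 \<le> boundary_point_product \<xi> x z"
    unfolding boundary_point_product_def
    by (intro INF_greatest Liminf_bounded) (auto simp: gromov_product_nonneg)
  have "boundary_point_product \<xi> x z \<le> liminf (\<lambda>n. ereal (gromov_product (s n) x z))"
    unfolding boundary_point_product_def using s by (rule INF_lower)
  also have "\<dots> \<le> limsup (\<lambda>n. ereal (gromov_product (s n) x z))"
    by (rule Liminf_le_Limsup) auto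
  also have "\<dots> \<le> ereal (dist x z)"
    by (intro Limsup_bounded) (auto simp: gromov_product_le_dist)
  finally have 2: "boundary_point_product \<xi> x z \<le> ereal (dist x z)" .
  show "boundary_point_product \<xi> x z = ereal (point_product \<xi> x z)"
    "0 \<le> point_product \<xi> x z" "point_product \<xi> x z \<le> dist x z"
    unfolding point_product_def using 1 2
    by (cases "boundary_point_product \<xi> x z"; simp)+
qed

lemma less_point_productD:
  assumes "s \<in> \<xi>" "r < point_product \<xi> x z"
  shows "\<forall>\<^sub>F n in sequentially. r < gromov_product (s n) x z"
proof -
  have "\<xi> \<noteq> {}" using assms(1) by auto
  then have "ereal r < boundary_point_product \<xi> x z"
    using assms(2) by (simp add: boundary_point_product_eq(1))
  also have "\<dots> \<le> liminf (\<lambda>n. ereal (gromov_product (s n) x z))"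
    unfolding boundary_point_product_def using assms(1) by (rule INF_lower)
  finally show ?thesis by (auto dest!: less_LiminfD)
qed

lemma le_point_productI:
  assumes "\<xi> \<noteq> {}" "\<And>s. s \<in> \<xi> \<Longrightarrow> \<forall>\<^sub>F n in sequentially. r \<le> gromov_product (s n) x z"
  shows "r \<le> point_product \<xi> x z"
proof -
  have "ereal r \<le> boundary_point_product \<xi> x z"
    unfolding boundary_point_product_def using assms(2) by (intro INF_greatest Liminf_bounded) auto
  then show ?thesis using boundary_point_product_eq(1)[OF assms(1), of x z] by simp
qed

lemma point_product_change_base:
  assumes "\<xi> \<noteq> {}"
  shows "point_product \<xi> x w - dist z w \<le> point_product \<xi> x z"
proof (rule field_le_epsilon)
  fix e :: real assume "e > 0"
  have "point_product \<xi> x w - e - dist z w \<le> point_product \<xi> x z"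
  proof (rule le_point_productI[OF assms])
    fix s assume "s \<in> \<xi>"
    then have "\<forall>\<^sub>F n in sequentially. point_product \<xi> x w - e < gromov_product (s n) x w"
      using \<open>e > 0\<close> by (intro less_point_productD) auto
    then show "\<forall>\<^sub>F n in sequentially. point_product \<xi> x w - e - dist z w \<le> gromov_product (s n) x z"
    proof eventually_elim
      case (elim n)
      then show ?case using gromov_product_change_base[of "s n" x w z] by linarith
    qed
  qed
  then show "point_product \<xi> x w - dist z w \<le> point_product \<xi> x z + e" by simp
qed

lemma point_product_swap_base_le:
  assumes "\<xi> \<noteq> {}"
  shows "point_product \<xi> w z + point_product \<xi> z w \<le> dist w z"
proof (rule field_le_epsilon)
  fix e :: real assume "e > 0"
  obtain s where "s \<in> \<xi>" using assms by auto
  then have "\<forall>\<^sub>F n in sequentially. point_product \<xi> w z - e/2 < gromov_product (s n) w z"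
    "\<forall>\<^sub>F n in sequentially. point_product \<xi> z w - e/2 < gromov_product (s n) z w"
    using \<open>e > 0\<close> by (auto intro!: less_point_productD)
  then have "\<forall>\<^sub>F n in sequentially. point_product \<xi> w z + point_product \<xi> z w \<le> dist w z + e"
  proof eventually_elim
    case (elim n)
    then show ?case using gromov_product_swap_base[of "s n" w z] by (simp add: field_simps)
  qed
  then show "point_product \<xi> w z + point_product \<xi> z w \<le> dist w z + e" by simp
qed

text \<open>A metric space with a base point and a hyperbolicity constant.\<close>

locale hyperbolic_space =
  fixes o\<^sub>X :: "'a::metric_space" and C :: real
  assumes C_nonneg: "C \<ge> 0"
    and hyperbolic: "\<And>x y z w :: 'a. min (gromov_product x y w) (gromov_product y z w) - C \<le> gromov_product x z w"
begin

abbreviation boundary :: "(nat \<Rightarrow> 'a) set set" where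
  "boundary \<equiv> gromov_boundary o\<^sub>X"

lemma gromov_equiv_joint:
  assumes "(x, y) \<in> gromov_equiv o\<^sub>X"
  obtains N where "\<And>n m. n \<ge> N \<Longrightarrow> m \<ge> N \<Longrightarrow> r \<le> gromov_product (x n) (y m) o\<^sub>X"
proof -
  obtain N1 where N1: "\<And>n m. n \<ge> N1 \<Longrightarrow> m \<ge> N1 \<Longrightarrow> r + C \<le> gromov_product (x n) (x m) o\<^sub>X"
    using gromov_equivD(1)[OF assms] unfolding gromov_sequence_iff by blast
  obtain N2 where N2: "\<And>n. n \<ge> N2 \<Longrightarrow> r + C \<le> gromov_product (x n) (y n) o\<^sub>X"
    using gromov_equivD(3)[OF assms] unfolding eventually_sequentially by blast
  show ?thesis
  proof (rule that[of "max N1 N2"])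
    fix n m assume "n \<ge> max N1 N2" "m \<ge> max N1 N2"
    then show "r \<le> gromov_product (x n) (y m) o\<^sub>X"
      using hyperbolic[of "x n" "x m" o\<^sub>X "y m"] N1[of n m] N2[of m] by simp
  qed
qed

lemma equiv_gromov_equiv: "equiv (Collect (gromov_sequence o\<^sub>X)) (gromov_equiv o\<^sub>X)"
proof (rule equivI)
  show "gromov_equiv o\<^sub>X \<subseteq> Collect (gromov_sequence o\<^sub>X) \<times> Collect (gromov_sequence o\<^sub>X)"
    by (auto simp: gromov_equiv_def)
  show "refl_on (Collect (gromov_sequence o\<^sub>X)) (gromov_equiv o\<^sub>X)"
  proof (rule refl_onI)
    fix x assume x: "x \<in> Collect (gromov_sequence o\<^sub>X)"
    then have "\<forall>\<^sub>F n in sequentially. r \<le> gromov_product (x n) (x n) o\<^sub>X" for r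
      unfolding eventually_sequentially gromov_sequence_iff by blast
    then show "(x, x) \<in> gromov_equiv o\<^sub>X"
      using x by (auto simp: gromov_equiv_def filterlim_at_top)
  qed
  show "sym (gromov_equiv o\<^sub>X)"
    by (rule symI) (simp add: gromov_equiv_def gromov_product_commute)
  show "trans (gromov_equiv o\<^sub>X)"
  proof (rule transI)
    fix x y z assume xy: "(x, y) \<in> gromov_equiv o\<^sub>X" and yz: "(y, z) \<in> gromov_equiv o\<^sub>X"
    have "\<forall>\<^sub>F n in sequentially. r \<le> gromov_product (x n) (z n) o\<^sub>X" for r
    proof -
      have "\<forall>\<^sub>F n in sequentially. r + C \<le> gromov_product (x n) (y n) o\<^sub>X"
        "\<forall>\<^sub>F n in sequentially. r + C \<le> gromov_product (y n) (z n) o\<^sub>X"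
        using gromov_equivD(3) xy yz by blast+
      then show ?thesis
      proof eventually_elim
        case (elim n)
        then show ?case using hyperbolic[of "x n" "y n" o\<^sub>X "z n"] by simp
      qed
    qed
    then show "(x, z) \<in> gromov_equiv o\<^sub>X"
      using xy yz by (auto simp: gromov_equiv_def filterlim_at_top)
  qed
qed

lemma boundaryE:
  assumes "\<xi> \<in> boundary"
  obtains x where "gromov_sequence o\<^sub>X x" "x \<in> \<xi>" "\<xi> = gromov_equiv o\<^sub>X `` {x}"
  using assms equiv_class_self[OF equiv_gromov_equiv]
  unfolding gromov_boundary_def by (auto elim!: quotientE)

lemma boundary_nonempty: "\<xi> \<in> boundary \<Longrightarrow> \<xi> \<noteq> {}"
  by (auto elim!: boundaryE)

lemma boundary_equiv: "\<xi> \<in> boundary \<Longrightarrow> x \<in> \<xi> \<Longrightarrow> y \<in> \<xi> \<Longrightarrow> (x, y) \<in> gromov_equiv o\<^sub>X"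
  using quotient_eqI quotient_eq_iff[OF equiv_gromov_equiv] unfolding gromov_boundary_def by metis

lemma boundary_product_nonneg: "0 \<le> boundary_product \<xi> \<eta> o\<^sub>X"
  using le_boundary_productI[of \<xi> \<eta> 0 o\<^sub>X] gromov_product_nonneg by (auto simp: zero_ereal_def)

text \<open>Along any sequence representing a boundary point, the products with a fixed point eventually
  exceed the infimum over all representing sequences by at most the hyperbolicity constant plus one.\<close>

lemma gromov_product_le_point_product:
  assumes "\<xi> \<in> boundary" "s \<in> \<xi>"
  shows "\<forall>\<^sub>F n in sequentially. gromov_product (s n) x o\<^sub>X \<le> point_product \<xi> x o\<^sub>X + C + 1"
proof -
  have "\<not> (\<forall>t\<in>\<xi>. \<forall>\<^sub>F n in sequentially. point_product \<xi> x o\<^sub>X + 1 \<le> gromov_product (t n) x o\<^sub>X)"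
    using le_point_productI[of \<xi> "point_product \<xi> x o\<^sub>X + 1" x o\<^sub>X] boundary_nonempty[OF assms(1)] by auto
  then obtain t where t: "t \<in> \<xi>"
    and fr: "\<exists>\<^sub>F n in sequentially. gromov_product (t n) x o\<^sub>X < point_product \<xi> x o\<^sub>X + 1"
    by (auto simp: frequently_def not_less)
  have "(t, s) \<in> gromov_equiv o\<^sub>X" using boundary_equiv assms t by blast
  then obtain N where N: "\<And>n m. n \<ge> N \<Longrightarrow> m \<ge> N \<Longrightarrow> dist x o\<^sub>X + C + 1 \<le> gromov_product (t n) (s m) o\<^sub>X"
    using gromov_equiv_joint by blast
  obtain n where n: "n \<ge> N" "gromov_product (t n) x o\<^sub>X < point_product \<xi> x o\<^sub>X + 1"
    using fr unfolding frequently_sequentially by blast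
  have "gromov_product (s m) x o\<^sub>X \<le> point_product \<xi> x o\<^sub>X + C + 1" if "m \<ge> N" for m
    using hyperbolic[of "t n" "s m" o\<^sub>X x] N[OF n(1) that] n(2)
      gromov_product_le_dist[of "t n" x o\<^sub>X] gromov_product_le_dist[of "s m" x o\<^sub>X] C_nonneg by simp
  then show ?thesis unfolding eventually_sequentially by blast
qed

lemma point_product_swap_base_ge:
  assumes "\<xi> \<in> boundary"
  shows "dist o\<^sub>X z - C - 1 \<le> point_product \<xi> o\<^sub>X z + point_product \<xi> z o\<^sub>X"
proof -
  have "dist o\<^sub>X z - point_product \<xi> z o\<^sub>X - C - 1 \<le> point_product \<xi> o\<^sub>X z"
  proof (rule le_point_productI)
    show "\<xi> \<noteq> {}" using assms by (rule boundary_nonempty)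
    fix s assume "s \<in> \<xi>"
    from gromov_product_le_point_product[OF assms this, of z]
    show "\<forall>\<^sub>F n in sequentially. dist o\<^sub>X z - point_product \<xi> z o\<^sub>X - C - 1 \<le> gromov_product (s n) o\<^sub>X z"
    proof eventually_elim
      case (elim n)
      then show ?case using gromov_product_swap_base[of "s n" o\<^sub>X z] by simp
    qed
  qed
  then show ?thesis by simp
qed

text \<open>The hyperbolic inequality for one or two boundary points among the three.\<close>

lemma point_product_hyperbolic:
  assumes \<xi>: "\<xi> \<in> boundary" and \<eta>: "\<eta> \<in> boundary"
    and "ereal r \<le> boundary_product \<xi> \<eta> o\<^sub>X" "r \<le> point_product \<xi> x o\<^sub>X"
  shows "r - C \<le> point_product \<eta> x o\<^sub>X"
proof (rule field_le_epsilon)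
  fix e :: real assume e: "e > 0"
  obtain s where s: "s \<in> \<xi>" using boundary_nonempty[OF \<xi>] by auto
  have "ereal (r - e) < ereal r" using e by simp
  also have "\<dots> \<le> boundary_product \<xi> \<eta> o\<^sub>X" by fact
  finally have re: "ereal (r - e) < boundary_product \<xi> \<eta> o\<^sub>X" .
  have "r - e - C \<le> point_product \<eta> x o\<^sub>X"
  proof (rule le_point_productI)
    show "\<eta> \<noteq> {}" using \<eta> by (rule boundary_nonempty)
    fix t assume t: "t \<in> \<eta>"
    obtain N where N: "\<And>n m. n \<ge> N \<Longrightarrow> m \<ge> N \<Longrightarrow> r - e < gromov_product (s n) (t m) o\<^sub>X"
      using less_boundary_productD[OF re s t] by blast
    have "\<forall>\<^sub>F n in sequentially. r - e < gromov_product (s n) x o\<^sub>X"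
      using assms(4) e s by (intro less_point_productD) auto
    then obtain N' where N': "\<And>n. n \<ge> N' \<Longrightarrow> r - e < gromov_product (s n) x o\<^sub>X"
      unfolding eventually_sequentially by blast
    have "r - e - C \<le> gromov_product (t m) x o\<^sub>X" if "m \<ge> N" for m
      using hyperbolic[of "t m" "s (max N N')" o\<^sub>X x] N[of "max N N'" m] N'[of "max N N'"] that
      by (simp add: gromov_product_commute)
    then show "\<forall>\<^sub>F n in sequentially. r - e - C \<le> gromov_product (t n) x o\<^sub>X"
      unfolding eventually_sequentially by blast
  qed
  then show "r - C \<le> point_product \<eta> x o\<^sub>X + e" by simp
qed

lemma boundary_product_hyperbolic:
  assumes \<xi>: "\<xi> \<in> boundary" and \<eta>: "\<eta> \<in> boundary"
    and "r < point_product \<xi> x o\<^sub>X" "r < point_product \<eta> x o\<^sub>X"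
  shows "ereal (r - C) \<le> boundary_product \<xi> \<eta> o\<^sub>X"
proof (rule le_boundary_productI)
  fix s t assume "s \<in> \<xi>" "t \<in> \<eta>"
  then have "\<forall>\<^sub>F n in sequentially. r < gromov_product (s n) x o\<^sub>X" "\<forall>\<^sub>F n in sequentially. r < gromov_product (t n) x o\<^sub>X"
    using assms by (auto intro!: less_point_productD)
  then obtain N N' where N: "\<And>n. n \<ge> N \<Longrightarrow> r < gromov_product (s n) x o\<^sub>X"
    "\<And>n. n \<ge> N' \<Longrightarrow> r < gromov_product (t n) x o\<^sub>X"
    unfolding eventually_sequentially by blast
  have "r - C \<le> gromov_product (s n) (t m) o\<^sub>X" if "n \<ge> max N N'" "m \<ge> max N N'" for n m
    using hyperbolic[of "s n" x o\<^sub>X "t m"] N(1)[of n] N(2)[of m] that gromov_product_commute[of x "t m" o\<^sub>X] by simp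
  then show "\<exists>N. \<forall>n\<ge>N. \<forall>m\<ge>N. r - C \<le> gromov_product (s n) (t m) o\<^sub>X" by blast
qed

lemma gromov_product_hyperbolic_boundary:
  assumes \<xi>: "\<xi> \<in> boundary" and "r < point_product \<xi> x o\<^sub>X" "r < point_product \<xi> y o\<^sub>X"
  shows "r - C \<le> gromov_product x y o\<^sub>X"
proof -
  obtain s where "s \<in> \<xi>" using boundary_nonempty[OF \<xi>] by auto
  then have "\<forall>\<^sub>F n in sequentially. r < gromov_product (s n) x o\<^sub>X" "\<forall>\<^sub>F n in sequentially. r < gromov_product (s n) y o\<^sub>X"
    using assms by (auto intro!: less_point_productD)
  then have "\<forall>\<^sub>F n in sequentially. r - C \<le> gromov_product x y o\<^sub>X"
  proof eventually_elim
    case (elim n)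
    then show ?case using hyperbolic[of x "s n" o\<^sub>X y] gromov_product_commute[of x "s n" o\<^sub>X] by simp
  qed
  then show ?thesis by simp
qed

end

section \<open>Isometries acting on the boundary\<close>

abbreviation isometries :: "('a::metric_space \<Rightarrow> 'a) set" where
  "isometries \<equiv> carrier isom_group"

lemma isometries_iff: "g \<in> isometries \<longleftrightarrow> bij g \<and> (\<forall>x y. dist (g x) (g y) = dist x y)"
  by (simp add: isom_group_def)

lemma isometry_dist: "g \<in> isometries \<Longrightarrow> dist (g x) (g y) = dist x y"
  by (simp add: isometries_iff)

lemma isometry_inv_apply:
  assumes "g \<in> isometries"
  shows "g (inv_into UNIV g x) = x" "inv_into UNIV g (g x) = x"
  using assms by (auto simp: isometries_iff bij_is_surj bij_is_inj surj_f_inv_f inv_f_f)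

lemma isometry_inv:
  assumes "g \<in> isometries"
  shows "inv_into UNIV g \<in> isometries"
proof -
  have "dist (inv_into UNIV g x) (inv_into UNIV g y) = dist x y" for x y
    using isometry_dist[OF assms, of "inv_into UNIV g x" "inv_into UNIV g y"]
    by (simp add: isometry_inv_apply[OF assms])
  then show ?thesis using assms by (simp add: isometries_iff bij_imp_bij_inv)
qed

lemma isometry_gromov_product:
  "g \<in> isometries \<Longrightarrow> gromov_product (g x) (g y) (g z) = gromov_product x y z"
  by (simp add: gromov_product_def isometry_dist)

lemma boundary_act_comp: "boundary_act (g \<circ> h) \<xi> = boundary_act g (boundary_act h \<xi>)"
  by (simp add: boundary_act_def image_image comp_assoc)

lemma boundary_act_id: "boundary_act (\<lambda>x. x) \<xi> = \<xi>" "boundary_act id \<xi> = \<xi>"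
  by (simp_all add: boundary_act_def comp_def id_def)

lemma boundary_act_inv:
  assumes "g \<in> isometries"
  shows "boundary_act (inv_into UNIV g) (boundary_act g \<xi>) = \<xi>"
    "boundary_act g (boundary_act (inv_into UNIV g) \<xi>) = \<xi>"
proof -
  have "inv_into UNIV g \<circ> g = (\<lambda>x. x)" "g \<circ> inv_into UNIV g = (\<lambda>x. x)"
    using isometry_inv_apply[OF assms] by auto
  then show "boundary_act (inv_into UNIV g) (boundary_act g \<xi>) = \<xi>"
    "boundary_act g (boundary_act (inv_into UNIV g) \<xi>) = \<xi>"
    by (simp_all add: boundary_act_comp[symmetric] boundary_act_id)
qed

lemma point_product_act:
  assumes "g \<in> isometries"
  shows "point_product (boundary_act g \<xi>) (g x) (g z) = point_product \<xi> x z"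
  using assms by (simp add: point_product_def boundary_point_product_def boundary_act_def
      image_image isometry_gromov_product)

lemma point_product_act':
  assumes "g \<in> isometries"
  shows "point_product (boundary_act g \<xi>) x z = point_product \<xi> (inv_into UNIV g x) (inv_into UNIV g z)"
  using point_product_act[OF assms, of \<xi> "inv_into UNIV g x" "inv_into UNIV g z"]
  by (simp add: isometry_inv_apply[OF assms])

context hyperbolic_space
begin

lemma gromov_equiv_act:
  assumes g: "g \<in> isometries" and xy: "(x, y) \<in> gromov_equiv o\<^sub>X"
  shows "(g \<circ> x, g \<circ> y) \<in> gromov_equiv o\<^sub>X"
proof -
  have base: "gromov_product u v o\<^sub>X - dist (g o\<^sub>X) o\<^sub>X \<le> gromov_product (g u) (g v) o\<^sub>X" for u v
    using gromov_product_change_base[of "g u" "g v" "g o\<^sub>X" o\<^sub>X] isometry_gromov_product[OF g, of u v o\<^sub>X]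
    by (simp add: dist_commute)
  have seq: "gromov_sequence o\<^sub>X (g \<circ> x)" if x: "gromov_sequence o\<^sub>X x" for x
    unfolding gromov_sequence_iff
  proof
    fix r
    obtain N where "\<forall>n\<ge>N. \<forall>m\<ge>N. r + dist (g o\<^sub>X) o\<^sub>X \<le> gromov_product (x n) (x m) o\<^sub>X"
      using x unfolding gromov_sequence_iff by blast
    then have "\<forall>n\<ge>N. \<forall>m\<ge>N. r \<le> gromov_product ((g \<circ> x) n) ((g \<circ> x) m) o\<^sub>X"
      unfolding comp_def by (intro allI impI order.trans[OF _ base]) (simp add: le_diff_eq)
    then show "\<exists>N. \<forall>n\<ge>N. \<forall>m\<ge>N. r \<le> gromov_product ((g \<circ> x) n) ((g \<circ> x) m) o\<^sub>X" by blast
  qed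
  have "\<forall>\<^sub>F n in sequentially. r \<le> gromov_product ((g \<circ> x) n) ((g \<circ> y) n) o\<^sub>X" for r
  proof -
    have "\<forall>\<^sub>F n in sequentially. r + dist (g o\<^sub>X) o\<^sub>X \<le> gromov_product (x n) (y n) o\<^sub>X"
      using gromov_equivD(3) xy by blast
    then show ?thesis
    proof eventually_elim
      case (elim n)
      then show ?case using base[of "x n" "y n"] by simp
    qed
  qed
  then show ?thesis using xy seq by (auto simp: gromov_equiv_def filterlim_at_top)
qed

lemma boundary_act_in_boundary:
  assumes g: "g \<in> isometries" and \<xi>: "\<xi> \<in> boundary"
  shows "boundary_act g \<xi> \<in> boundary"
proof -
  obtain x where x: "gromov_sequence o\<^sub>X x" "x \<in> \<xi>" "\<xi> = gromov_equiv o\<^sub>X `` {x}"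
    using \<xi> by (rule boundaryE)
  let ?h = "inv_into UNIV g"
  have "boundary_act g \<xi> = gromov_equiv o\<^sub>X `` {g \<circ> x}"
  proof
    show "boundary_act g \<xi> \<subseteq> gromov_equiv o\<^sub>X `` {g \<circ> x}"
      using gromov_equiv_act[OF g] by (auto simp: boundary_act_def x(3))
    show "gromov_equiv o\<^sub>X `` {g \<circ> x} \<subseteq> boundary_act g \<xi>"
    proof
      fix y assume "y \<in> gromov_equiv o\<^sub>X `` {g \<circ> x}"
      then have "(?h \<circ> (g \<circ> x), ?h \<circ> y) \<in> gromov_equiv o\<^sub>X"
        using gromov_equiv_act[OF isometry_inv[OF g], of "g \<circ> x" y] by auto
      moreover have "?h \<circ> (g \<circ> x) = x" "y = g \<circ> (?h \<circ> y)"
        using isometry_inv_apply[OF g] by auto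
      ultimately show "y \<in> boundary_act g \<xi>"
        unfolding boundary_act_def x(3) by (metis ImageI image_eqI singletonI)
    qed
  qed
  moreover have "(x, x) \<in> gromov_equiv o\<^sub>X" using boundary_equiv[OF \<xi> x(2) x(2)] .
  then have "gromov_sequence o\<^sub>X (g \<circ> x)"
    using gromov_equiv_act[OF g] by (auto simp: gromov_equiv_def)
  ultimately show ?thesis unfolding gromov_boundary_def by (auto intro: quotientI)
qed

lemma dist_inv_base: "g \<in> isometries \<Longrightarrow> dist o\<^sub>X (inv_into UNIV g o\<^sub>X) = dist o\<^sub>X (g o\<^sub>X)"
  using isometry_dist[of g "inv_into UNIV g o\<^sub>X" o\<^sub>X]
  by (simp add: isometry_inv_apply dist_commute)

text \<open>How an isometry changes the product of two boundary points. For a visual metric this is the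
  upper bound in the geometric mean value theorem, which compares the distance of two image points
  with their distance times the geometric mean of the two derivatives.\<close>

lemma boundary_product_act_ge:
  assumes g: "g \<in> isometries" and \<xi>: "\<xi> \<in> boundary" and \<eta>: "\<eta> \<in> boundary"
    and r: "ereal r \<le> boundary_product \<xi> \<eta> o\<^sub>X"
  defines "z \<equiv> inv_into UNIV g o\<^sub>X"
  shows "ereal (r - point_product \<xi> z o\<^sub>X - point_product \<eta> z o\<^sub>X + dist o\<^sub>X (g o\<^sub>X) - (2 * C + 3))
    \<le> boundary_product (boundary_act g \<xi>) (boundary_act g \<eta>) o\<^sub>X"
proof (rule le_boundary_productI)
  fix s' t' assume "s' \<in> boundary_act g \<xi>" "t' \<in> boundary_act g \<eta>"
  then obtain s t where st: "s \<in> \<xi>" "t \<in> \<eta>" "s' = g \<circ> s" "t' = g \<circ> t"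
    by (auto simp: boundary_act_def)
  have "ereal (r - 1) < ereal r" by simp
  also note r
  finally have r1: "ereal (r - 1) < boundary_product \<xi> \<eta> o\<^sub>X" .
  obtain N where N: "\<And>n m. n \<ge> N \<Longrightarrow> m \<ge> N \<Longrightarrow> r - 1 < gromov_product (s n) (t m) o\<^sub>X"
    using less_boundary_productD[OF r1 st(1,2)] by blast
  obtain N1 where N1: "\<And>n. n \<ge> N1 \<Longrightarrow> gromov_product (s n) z o\<^sub>X \<le> point_product \<xi> z o\<^sub>X + C + 1"
    using gromov_product_le_point_product[OF \<xi> st(1), of z] unfolding eventually_sequentially by blast
  obtain N2 where N2: "\<And>n. n \<ge> N2 \<Longrightarrow> gromov_product (t n) z o\<^sub>X \<le> point_product \<eta> z o\<^sub>X + C + 1"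
    using gromov_product_le_point_product[OF \<eta> st(2), of z] unfolding eventually_sequentially by blast
  have "r - point_product \<xi> z o\<^sub>X - point_product \<eta> z o\<^sub>X + dist o\<^sub>X (g o\<^sub>X) - (2 * C + 3)
      \<le> gromov_product (s' n) (t' m) o\<^sub>X" if "n \<ge> max N (max N1 N2)" "m \<ge> max N (max N1 N2)" for n m
  proof -
    have "gromov_product (s' n) (t' m) o\<^sub>X = gromov_product (s n) (t m) z"
      using isometry_gromov_product[OF g, of "s n" "t m" z]
      by (simp add: st z_def isometry_inv_apply[OF g])
    also have "\<dots> = gromov_product (s n) (t m) o\<^sub>X - gromov_product (s n) z o\<^sub>X - gromov_product (t m) z o\<^sub>X
        + dist o\<^sub>X (g o\<^sub>X)"
      using gromov_product_change_base_eq[of "s n" "t m" z o\<^sub>X] dist_inv_base[OF g] by (simp add: z_def)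
    finally show ?thesis using N[of n m] N1[of n] N2[of m] that by simp
  qed
  then show "\<exists>N. \<forall>n\<ge>N. \<forall>m\<ge>N. r - point_product \<xi> z o\<^sub>X - point_product \<eta> z o\<^sub>X + dist o\<^sub>X (g o\<^sub>X) - (2 * C + 3)
      \<le> gromov_product (s' n) (t' m) o\<^sub>X" by blast
qed

lemma busemann_bounds:
  assumes "\<xi> \<in> boundary"
  shows "2 * point_product \<xi> z o\<^sub>X - dist o\<^sub>X z \<le> busemann \<xi> o\<^sub>X z"
    "busemann \<xi> o\<^sub>X z \<le> 2 * point_product \<xi> z o\<^sub>X - dist o\<^sub>X z + (C + 1)"
proof -
  have "busemann \<xi> o\<^sub>X z = point_product \<xi> z o\<^sub>X - point_product \<xi> o\<^sub>X z"
    by (simp add: busemann_def point_product_def)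
  then show "2 * point_product \<xi> z o\<^sub>X - dist o\<^sub>X z \<le> busemann \<xi> o\<^sub>X z"
    "busemann \<xi> o\<^sub>X z \<le> 2 * point_product \<xi> z o\<^sub>X - dist o\<^sub>X z + (C + 1)"
    using point_product_swap_base_le[OF boundary_nonempty[OF assms], of o\<^sub>X z]
      point_product_swap_base_ge[OF assms, of z] by linarith+
qed

end

section \<open>Second moments of counting functions\<close>

lemma (in finite_measure) second_moment_Union:
  assumes fin: "finite J" and A: "\<And>j. j \<in> J \<Longrightarrow> A j \<in> sets M" and Q: "Q > 0"
    and S: "(\<Sum>j\<in>J. measure M (A j)) > 0"
    and corr: "(\<Sum>i\<in>J. \<Sum>j\<in>J. measure M (A i \<inter> A j)) \<le> Q * (\<Sum>j\<in>J. measure M (A j))\<^sup>2"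
  shows "1 / Q \<le> measure M (\<Union>j\<in>J. A j)"
proof -
  define S where "S = (\<Sum>j\<in>J. measure M (A j))"
  \<comment> \<open>Integrating \<open>(c f - 1)\<^sup>2 \<ge> 0\<close> over the union, with the optimal \<open>c\<close>, gives the bound.\<close>
  define c where "c = 1 / (Q * S)"
  define f :: "'a \<Rightarrow> real" where "f x = (\<Sum>j\<in>J. indicator (A j) x)" for x
  let ?E = "\<Union>j\<in>J. A j"
  have S0: "S > 0" using S by (simp add: S_def)
  have E: "?E \<in> sets M" using fin A by auto
  have sq: "(f x)\<^sup>2 = (\<Sum>i\<in>J. \<Sum>j\<in>J. indicator (A i \<inter> A j) x)" for x
    by (simp add: f_def power2_eq_square sum_product indicator_inter_arith)
  have pointwise: "2 * c * f x \<le> c\<^sup>2 * (\<Sum>i\<in>J. \<Sum>j\<in>J. indicator (A i \<inter> A j) x) + indicator ?E x" for x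
  proof (cases "x \<in> ?E")
    case True
    have "0 \<le> (c * f x - 1)\<^sup>2" by simp
    then show ?thesis using True unfolding sq[symmetric]
      by (simp add: power2_eq_square algebra_simps)
  next
    case False
    then have "f x = 0" by (auto simp: f_def intro!: sum.neutral)
    then show ?thesis using False unfolding sq[symmetric] by simp
  qed
  have int: "integrable M (indicator (A i) :: 'a \<Rightarrow> real)" if "i \<in> J" for i
    using A[OF that] by (intro integrable_real_indicator) (simp_all add: less_top[symmetric])
  have int2: "integrable M (indicator (A i \<inter> A j) :: 'a \<Rightarrow> real)" if "i \<in> J" "j \<in> J" for i j
    using A that by (intro integrable_real_indicator) (simp_all add: less_top[symmetric])
  have intE: "integrable M (indicator ?E :: 'a \<Rightarrow> real)"
    using E by (intro integrable_real_indicator) (simp_all add: less_top[symmetric])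
  have meas: "integral\<^sup>L M (indicator X :: 'a \<Rightarrow> real) = measure M X" if "X \<in> sets M" for X
    using sets.sets_into_space[OF that] by (simp add: Int_absorb2)
  have "2 * c * S = (\<integral>x. 2 * c * f x \<partial>M)"
    unfolding f_def S_def using int A by (simp add: meas)
  also have "\<dots> \<le> (\<integral>x. c\<^sup>2 * (\<Sum>i\<in>J. \<Sum>j\<in>J. indicator (A i \<inter> A j) x) + indicator ?E x \<partial>M)"
    unfolding f_def using int int2 intE pointwise[unfolded f_def]
    by (intro integral_mono Bochner_Integration.integrable_add integrable_mult_right
        Bochner_Integration.integrable_sum) auto
  also have "\<dots> = c\<^sup>2 * (\<Sum>i\<in>J. \<Sum>j\<in>J. measure M (A i \<inter> A j)) + measure M ?E"
  proof -
    have "(\<integral>x. c\<^sup>2 * (\<Sum>i\<in>J. \<Sum>j\<in>J. indicator (A i \<inter> A j) x) + indicator ?E x \<partial>M) =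
      (\<integral>x. c\<^sup>2 * (\<Sum>i\<in>J. \<Sum>j\<in>J. indicator (A i \<inter> A j) x) \<partial>M) + (\<integral>x. indicator ?E x \<partial>M)"
      using int2 intE
      by (intro Bochner_Integration.integral_add integrable_mult_right Bochner_Integration.integrable_sum)
    also have "(\<integral>x. c\<^sup>2 * (\<Sum>i\<in>J. \<Sum>j\<in>J. indicator (A i \<inter> A j) x) \<partial>M) =
        c\<^sup>2 * (\<Sum>i\<in>J. \<Sum>j\<in>J. \<integral>x. indicator (A i \<inter> A j) x \<partial>M)"
      using int2 by (simp add: Bochner_Integration.integral_sum)
    finally show ?thesis using A E by (simp add: meas del: UN_iff cong: sum.cong)
  qed
  also have "\<dots> \<le> c\<^sup>2 * (Q * S\<^sup>2) + measure M ?E"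
    using corr by (simp add: S_def mult_left_mono)
  finally show ?thesis
    using S0 Q by (simp add: c_def power2_eq_square field_simps)
qed

lemma (in finite_measure) sum_measure_le_multiplicity:
  assumes fin: "finite E" and B: "\<And>h. h \<in> E \<Longrightarrow> B h \<in> sets M" "\<And>h. h \<in> E \<Longrightarrow> B h \<subseteq> Y" "Y \<in> sets M"
    and mult: "\<And>x. card {h\<in>E. x \<in> B h} \<le> m"
  shows "(\<Sum>h\<in>E. measure M (B h)) \<le> real m * measure M Y"
proof -
  have int: "integrable M (indicator X :: 'a \<Rightarrow> real)" if "X \<in> sets M" for X
    using that by (intro integrable_real_indicator) (simp_all add: less_top[symmetric])
  have meas: "integral\<^sup>L M (indicator X :: 'a \<Rightarrow> real) = measure M X" if "X \<in> sets M" for X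
    using sets.sets_into_space[OF that] by (simp add: Int_absorb2)
  have "(\<Sum>h\<in>E. measure M (B h)) = (\<integral>x. (\<Sum>h\<in>E. indicator (B h) x) \<partial>M)"
    using B int by (simp add: meas)
  also have "\<dots> \<le> (\<integral>x. real m * indicator Y x \<partial>M)"
  proof (rule integral_mono)
    show "integrable M (\<lambda>x. \<Sum>h\<in>E. indicator (B h) x :: real)" using B int by auto
    show "integrable M (\<lambda>x. real m * indicator Y x)" using B int by auto
    fix x
    have "(\<Sum>h\<in>E. indicator (B h) x :: real) = card {h\<in>E. x \<in> B h}"
      using fin by (simp add: indicator_def of_bool_def sum.If_cases Int_def)
    also have "\<dots> \<le> real m * indicator Y x"
    proof (cases "x \<in> Y")
      case True then show ?thesis using mult by simp
    next
      case False
      then have "{h\<in>E. x \<in> B h} = {}" using B(2) by auto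
      then show ?thesis by (simp only: card.empty) simp
    qed
    finally show "(\<Sum>h\<in>E. indicator (B h) x :: real) \<le> real m * indicator Y x" .
  qed
  also have "\<dots> = real m * measure M Y" using B by (simp add: meas)
  finally show ?thesis .
qed

text \<open>Sets arranged in generations that are independent up to a constant and up to an error
  decaying geometrically with the distance of the generations cover a definite proportion of
  the space as soon as their total measure is not small.\<close>

lemma (in finite_measure) quasi_independent_generations:
  fixes x :: "nat \<Rightarrow> real"
  assumes fin: "\<And>n. finite (H n)" and B: "\<And>n h. h \<in> H n \<Longrightarrow> B n h \<in> sets M"
    and a: "a > 0" and A: "A > 0" and q: "0 \<le> q" "q < 1" and x: "\<And>n. x n \<ge> 0"
    and lower: "\<And>n. a * x n \<le> (\<Sum>h\<in>H n. measure M (B n h))"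
    and corr: "\<And>m n. m \<le> n \<Longrightarrow> (\<Sum>g\<in>H m. \<Sum>h\<in>H n. measure M (B m g \<inter> B n h)) \<le> A * (x m * x n + q ^ (n - m) * x n)"
    and N: "(\<Sum>n<N. x n) \<ge> 1"
  shows "a\<^sup>2 / (2 * A * (1 + 1 / (1 - q))) \<le> measure M (\<Union>n<N. \<Union>h\<in>H n. B n h)"
proof -
  define J where "J = Sigma {..<N} H"
  define s where "s = (\<Sum>n<N. x n)"
  define S where "S = (\<Sum>(n, h)\<in>J. measure M (B n h))"
  define T where "T m n = (\<Sum>g\<in>H m. \<Sum>h\<in>H n. measure M (B m g \<inter> B n h))" for m n
  define Q where "Q = 2 * A * (1 + 1 / (1 - q)) / a\<^sup>2"
  have Q: "Q > 0" using A q a by (simp add: Q_def add_pos_nonneg)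
  have finJ: "finite J" using fin by (simp add: J_def)
  have sumJ: "(\<Sum>j\<in>J. F j) = (\<Sum>n<N. \<Sum>h\<in>H n. F (n, h))" for F :: "nat \<times> 'b \<Rightarrow> real"
    unfolding J_def using fin by (subst sum.Sigma) auto
  have S_eq: "S = (\<Sum>n<N. \<Sum>h\<in>H n. measure M (B n h))"
    unfolding S_def by (simp add: sumJ)
  have as: "a * s \<le> S"
    unfolding S_eq s_def sum_distrib_left by (intro sum_mono lower)
  have s1: "s \<ge> 1" using N by (simp add: s_def)
  have geo: "(\<Sum>m<Suc n. q ^ (n - m)) \<le> 1 / (1 - q)" for n
  proof -
    have "(\<Sum>m<Suc n. q ^ (n - m)) = (\<Sum>m<Suc n. q ^ m)"
      using sum.nat_diff_reindex[of "\<lambda>m. q ^ m" "Suc n"] by simp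
    also have "\<dots> \<le> (\<Sum>m. q ^ m)" using q by (intro sum_le_suminf summable_geometric) auto
    also have "\<dots> = 1 / (1 - q)" using q by (intro suminf_geometric) auto
    finally show ?thesis .
  qed
  have T_sym: "T m n = T n m" for m n
    unfolding T_def by (subst sum.swap) (simp add: Int_commute)
  have T0: "T m n \<ge> 0" for m n unfolding T_def by (intro sum_nonneg) auto
  have "(\<Sum>i\<in>J. \<Sum>j\<in>J. measure M (case_prod B i \<inter> case_prod B j)) = (\<Sum>m<N. \<Sum>g\<in>H m. \<Sum>n<N. \<Sum>h\<in>H n. measure M (B m g \<inter> B n h))"
    by (simp add: sumJ)
  also have "\<dots> = (\<Sum>m<N. \<Sum>n<N. T m n)"
    unfolding T_def by (intro sum.cong refl sum.swap)
  also have "\<dots> \<le> (\<Sum>m<N. \<Sum>n<N. (if m \<le> n then T m n else 0) + (if n \<le> m then T n m else 0))"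
    by (intro sum_mono) (auto simp: T_sym T0)
  also have "\<dots> = (\<Sum>m<N. \<Sum>n<N. if m \<le> n then T m n else 0) + (\<Sum>m<N. \<Sum>n<N. if n \<le> m then T n m else 0)"
    by (simp only: sum.distrib)
  also have "(\<Sum>m<N. \<Sum>n<N. if n \<le> m then T n m else 0) = (\<Sum>n<N. \<Sum>m<N. if n \<le> m then T n m else 0)"
    by (rule sum.swap)
  also have "(\<Sum>m<N. \<Sum>n<N. if m \<le> n then T m n else 0) + (\<Sum>n<N. \<Sum>m<N. if n \<le> m then T n m else 0)
      = 2 * (\<Sum>m<N. \<Sum>n<N. if m \<le> n then T m n else 0)"
    by simp
  also have "(\<Sum>m<N. \<Sum>n<N. if m \<le> n then T m n else 0) \<le>
      (\<Sum>m<N. \<Sum>n<N. A * (x m * x n + (if m \<le> n then q ^ (n - m) else 0) * x n))"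
    using corr x A by (intro sum_mono) (auto simp: T_def)
  also have "\<dots> = A * (s * s + (\<Sum>m<N. \<Sum>n<N. (if m \<le> n then q ^ (n - m) else 0) * x n))"
    unfolding s_def sum_product by (simp only: sum.distrib[symmetric] sum_distrib_left)
  also have "(\<Sum>m<N. \<Sum>n<N. (if m \<le> n then q ^ (n - m) else 0) * x n)
      = (\<Sum>n<N. (\<Sum>m<N. if m \<le> n then q ^ (n - m) else 0) * x n)"
    by (subst sum.swap) (simp add: sum_distrib_right)
  also have "\<dots> \<le> (\<Sum>n<N. (1 / (1 - q)) * x n)"
  proof (intro sum_mono mult_right_mono x)
    fix n assume "n \<in> {..<N}"
    then have "(\<Sum>m<N. if m \<le> n then q ^ (n - m) else 0) = (\<Sum>m<Suc n. q ^ (n - m))"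
      by (intro sum.mono_neutral_cong_right) auto
    then show "(\<Sum>m<N. if m \<le> n then q ^ (n - m) else 0) \<le> 1 / (1 - q)" using geo by simp
  qed
  also have "\<dots> = 1 / (1 - q) * s" by (simp add: s_def sum_distrib_left)
  finally have "(\<Sum>i\<in>J. \<Sum>j\<in>J. measure M (case_prod B i \<inter> case_prod B j)) \<le> 2 * (A * (s * s + 1 / (1 - q) * s))"
    using A by simp
  also have "\<dots> \<le> 2 * (A * (s * s + 1 / (1 - q) * (s * s)))"
    using s1 A q by (intro mult_left_mono add_left_mono) auto
  also have "\<dots> = Q * (a * s)\<^sup>2"
  proof -
    have "Q * (a * s)\<^sup>2 = 2 * A * (1 + 1 / (1 - q)) * s\<^sup>2"
      using a by (simp add: Q_def power_mult_distrib)
    then show ?thesis by (simp add: power2_eq_square algebra_simps)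
  qed
  also have "\<dots> \<le> Q * S\<^sup>2"
    using as a s1 Q by (intro mult_left_mono power_mono) auto
  finally have corr_le: "(\<Sum>i\<in>J. \<Sum>j\<in>J. measure M (case_prod B i \<inter> case_prod B j)) \<le> Q * S\<^sup>2" .
  have "S > 0" using as a s1 mult_pos_pos[of a s] by linarith
  then have "1 / Q \<le> measure M (\<Union>j\<in>J. case_prod B j)"
    using finJ Q B corr_le unfolding S_def
    by (intro second_moment_Union) (auto simp: J_def case_prod_unfold)
  moreover have "(\<Union>j\<in>J. case_prod B j) = (\<Union>n<N. \<Union>h\<in>H n. B n h)" by (auto simp: J_def)
  ultimately show ?thesis using a by (simp add: Q_def)
qed

section \<open>Small balls around orbit points\<close>

text \<open>A metric \<open>D\<close> on the boundary that is visual with base \<open>b\<close> and comparison constant \<open>V\<close>.\<close>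

locale visual_boundary = hyperbolic_space o\<^sub>X C
  for o\<^sub>X :: "'a::metric_space" and C :: real +
  fixes b V :: real and D :: "(nat \<Rightarrow> 'a) set \<Rightarrow> (nat \<Rightarrow> 'a) set \<Rightarrow> real"
  assumes b_gt_1: "b > 1" and V_ge_1: "V \<ge> 1"
    and metric: "Metric_space (gromov_boundary o\<^sub>X) D"
    and visual_lower: "\<And>\<xi> \<eta>. \<xi> \<in> gromov_boundary o\<^sub>X \<Longrightarrow> \<eta> \<in> gromov_boundary o\<^sub>X \<Longrightarrow>
      inverse V * neg_power b (boundary_product \<xi> \<eta> o\<^sub>X) \<le> D \<xi> \<eta>"
    and visual_upper: "\<And>\<xi> \<eta>. \<xi> \<in> gromov_boundary o\<^sub>X \<Longrightarrow> \<eta> \<in> gromov_boundary o\<^sub>X \<Longrightarrow>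
      D \<xi> \<eta> \<le> V * neg_power b (boundary_product \<xi> \<eta> o\<^sub>X)"
begin

abbreviation cball :: "(nat \<Rightarrow> 'a) set \<Rightarrow> real \<Rightarrow> (nat \<Rightarrow> 'a) set set" where
  "cball \<equiv> boundary_cball o\<^sub>X D"

abbreviation len :: "('a \<Rightarrow> 'a) \<Rightarrow> real" where
  "len g \<equiv> dist o\<^sub>X (g o\<^sub>X)"

lemma mem_cball: "\<eta> \<in> cball \<xi> r \<longleftrightarrow> \<xi> \<in> boundary \<and> \<eta> \<in> boundary \<and> D \<xi> \<eta> \<le> r"
  by (simp add: Metric_space.in_mcball[OF metric])

lemma le_boundary_product_if_close:
  assumes "\<xi> \<in> boundary" "\<eta> \<in> boundary" "D \<xi> \<eta> \<le> b powr (- r) / V"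
  shows "ereal r \<le> boundary_product \<xi> \<eta> o\<^sub>X"
proof (cases "boundary_product \<xi> \<eta> o\<^sub>X")
  case (real q)
  have "inverse V * b powr (- q) \<le> b powr (- r) / V"
    using visual_lower[OF assms(1,2)] assms(3) by (simp add: real neg_power_def)
  then have "b powr (- q) \<le> b powr (- r)" using V_ge_1 by (simp add: field_simps)
  then show ?thesis using b_gt_1 by (simp add: real)
next
  case MInf
  then show ?thesis using boundary_product_nonneg[of \<xi> \<eta>] by simp
qed simp

lemma dist_le_if_le_boundary_product:
  assumes "\<xi> \<in> boundary" "\<eta> \<in> boundary" "ereal r \<le> boundary_product \<xi> \<eta> o\<^sub>X"
  shows "D \<xi> \<eta> \<le> V * b powr (- r)"
proof (cases "boundary_product \<xi> \<eta> o\<^sub>X")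
  case (real q)
  have "D \<xi> \<eta> \<le> V * b powr (- q)"
    using visual_upper[OF assms(1,2)] by (simp add: real neg_power_def)
  also have "\<dots> \<le> V * b powr (- r)"
    using assms(3) V_ge_1 b_gt_1 by (intro mult_left_mono) (auto simp: real)
  finally show ?thesis .
next
  case PInf
  have "D \<xi> \<eta> \<le> 0" using visual_upper[OF assms(1,2)] by (simp add: PInf neg_power_def)
  also have "\<dots> \<le> V * b powr (- r)" using V_ge_1 by simp
  finally show ?thesis .
qed (use assms in simp)

lemma boundary_product_real:
  assumes "\<xi> \<in> boundary" "\<eta> \<in> boundary" "\<xi> \<noteq> \<eta>"
  obtains q where "boundary_product \<xi> \<eta> o\<^sub>X = ereal q"
proof (cases "boundary_product \<xi> \<eta> o\<^sub>X")
  case PInf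
  have "D \<xi> \<eta> \<le> 0" using visual_upper[OF assms(1,2)] by (simp add: PInf neg_power_def)
  then have "\<xi> = \<eta>"
    using Metric_space.zero[OF metric assms(1,2)] Metric_space.nonneg[OF metric, of \<xi> \<eta>] by auto
  then show ?thesis using assms by simp
next
  case MInf
  then show ?thesis using boundary_product_nonneg[of \<xi> \<eta>] by simp
qed (rule that)

text \<open>Within a small multiple of \<open>b powr (- (\<xi>|x))\<close> of \<open>\<xi>\<close> the product with \<open>x\<close> is nearly constant.\<close>

lemma point_product_near:
  assumes \<xi>: "\<xi> \<in> boundary" and \<eta>: "\<eta> \<in> boundary"
    and close: "D \<xi> \<eta> \<le> b powr (- (point_product \<xi> x o\<^sub>X + C + 1)) / V"
  shows "\<bar>point_product \<eta> x o\<^sub>X - point_product \<xi> x o\<^sub>X\<bar> \<le> C"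
proof -
  define s where "s = point_product \<xi> x o\<^sub>X + C + 1"
  have s: "ereal s \<le> boundary_product \<xi> \<eta> o\<^sub>X"
    using le_boundary_product_if_close[OF \<xi> \<eta>] close by (simp add: s_def)
  have "ereal (point_product \<xi> x o\<^sub>X) \<le> boundary_product \<xi> \<eta> o\<^sub>X"
    using s C_nonneg by (simp add: s_def order_trans[OF _ s])
  from point_product_hyperbolic[OF \<xi> \<eta> this order_refl]
  have 1: "point_product \<xi> x o\<^sub>X - C \<le> point_product \<eta> x o\<^sub>X" .
  define r where "r = min s (point_product \<eta> x o\<^sub>X)"
  have "ereal r \<le> boundary_product \<eta> \<xi> o\<^sub>X"
    using order_trans[OF _ s, of "ereal r"] by (simp add: r_def boundary_product_commute)
  from point_product_hyperbolic[OF \<eta> \<xi> this, of x]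
  have "r - C \<le> point_product \<xi> x o\<^sub>X" by (simp add: r_def)
  then have "point_product \<eta> x o\<^sub>X - C \<le> point_product \<xi> x o\<^sub>X"
    by (simp add: r_def s_def min_def split: if_splits)
  with 1 show ?thesis by simp
qed

lemma dist_act_le:
  assumes g: "g \<in> isometries" and \<xi>: "\<xi> \<in> boundary" and \<eta>: "\<eta> \<in> boundary"
  defines "z \<equiv> inv_into UNIV g o\<^sub>X"
  shows "D (boundary_act g \<xi>) (boundary_act g \<eta>) \<le>
    V\<^sup>2 * b powr (2 * C + 3) * b powr (point_product \<xi> z o\<^sub>X + point_product \<eta> z o\<^sub>X - len g) * D \<xi> \<eta>"
proof (cases "\<xi> = \<eta>")
  case True
  then show ?thesis
    using Metric_space.mdist_zero[OF metric] boundary_act_in_boundary[OF g \<eta>] \<eta> by simp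
next
  case False
  then obtain r where r: "boundary_product \<xi> \<eta> o\<^sub>X = ereal r"
    using boundary_product_real \<xi> \<eta> by blast
  let ?p = "point_product \<xi> z o\<^sub>X + point_product \<eta> z o\<^sub>X"
  have "D (boundary_act g \<xi>) (boundary_act g \<eta>) \<le> V * b powr (- (r - ?p + len g - (2 * C + 3)))"
    using boundary_product_act_ge[OF g \<xi> \<eta>, of r] r
    by (intro dist_le_if_le_boundary_product boundary_act_in_boundary g \<xi> \<eta>) (simp add: z_def algebra_simps)
  also have "\<dots> = V * b powr (2 * C + 3) * b powr (?p - len g) * b powr (- r)"
    by (simp add: mult.assoc powr_add[symmetric] algebra_simps)
  also have "b powr (- r) \<le> V * D \<xi> \<eta>"
    using visual_lower[OF \<xi> \<eta>] V_ge_1 by (simp add: r neg_power_def field_simps)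
  finally show ?thesis
    using V_ge_1 b_gt_1 by (simp add: power2_eq_square mult.assoc mult.left_commute mult_left_mono)
qed

lemma metric_deriv_ge:
  assumes "g \<in> isometries" "\<eta> \<in> boundary"
  shows "b powr (2 * point_product \<eta> (inv_into UNIV g o\<^sub>X) o\<^sub>X - len g) \<le> metric_deriv o\<^sub>X b g \<eta>"
  using busemann_bounds(1)[OF assms(2), of "inv_into UNIV g o\<^sub>X"] dist_inv_base[OF assms(1)] b_gt_1
  by (simp add: metric_deriv_def)

end

text \<open>A strongly discrete group of isometries and a probability measure on the boundary that is
  \<open>\<delta>\<close>-quasiconformal with constant \<open>Q\<close>. At this level \<open>\<delta>\<close> is any nonnegative exponent.\<close>

locale quasiconformal_action = visual_boundary o\<^sub>X C b V D
  for o\<^sub>X :: "'a::metric_space" and C b V D +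
  fixes G :: "('a \<Rightarrow> 'a) set" and \<mu> :: "(nat \<Rightarrow> 'a) set measure" and \<delta> Q :: real
  assumes G_isometries: "G \<subseteq> isometries" and G_id: "id \<in> G"
    and G_comp: "\<And>g h. g \<in> G \<Longrightarrow> h \<in> G \<Longrightarrow> g \<circ> h \<in> G"
    and G_inv: "\<And>g. g \<in> G \<Longrightarrow> inv_into UNIV g \<in> G"
    and G_discrete: "\<And>t. finite {g\<in>G. len g \<le> t}"
    and \<delta>_nonneg: "\<delta> \<ge> 0"
    and sets_\<mu>: "sets \<mu> = sets (boundary_borel o\<^sub>X D)"
    and prob_\<mu>: "prob_space \<mu>"
    and Q_ge_1: "Q \<ge> 1"
    and qc_lower: "\<And>g A. g \<in> G \<Longrightarrow> A \<in> sets \<mu> \<Longrightarrow>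
      ennreal (inverse Q) * (\<integral>\<^sup>+\<eta>\<in>A. ennreal (metric_deriv o\<^sub>X b g \<eta> powr \<delta>) \<partial>\<mu>)
        \<le> emeasure \<mu> (boundary_act g ` A)"
    and qc_upper: "\<And>g A. g \<in> G \<Longrightarrow> A \<in> sets \<mu> \<Longrightarrow>
      emeasure \<mu> (boundary_act g ` A)
        \<le> ennreal Q * (\<integral>\<^sup>+\<eta>\<in>A. ennreal (metric_deriv o\<^sub>X b g \<eta> powr \<delta>) \<partial>\<mu>)"

sublocale quasiconformal_action \<subseteq> prob_space \<mu>
  by (rule prob_\<mu>)

context quasiconformal_action
begin

lemma G_isometry: "g \<in> G \<Longrightarrow> g \<in> isometries"
  using G_isometries by auto

lemma len_inv: "g \<in> G \<Longrightarrow> len (inv_into UNIV g) = len g"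
  by (simp add: G_isometry dist_inv_base)

lemma closedin_measurable:
  assumes "closedin (boundary_topology o\<^sub>X D) A"
  shows "A \<in> sets \<mu>"
proof -
  have top: "topspace (boundary_topology o\<^sub>X D) = boundary"
    by (simp add: Metric_space.topspace_mtopology[OF metric])
  have sub: "{U. openin (boundary_topology o\<^sub>X D) U} \<subseteq> Pow boundary"
    using openin_subset[of "boundary_topology o\<^sub>X D"] by (auto simp: top)
  have "boundary - A \<in> sets (boundary_borel o\<^sub>X D)"
    using assms sub by (auto simp: boundary_borel_def sets_measure_of closedin_def top)
  then have "space (boundary_borel o\<^sub>X D) - (boundary - A) \<in> sets (boundary_borel o\<^sub>X D)"
    by (rule sets.compl_sets)
  moreover have "space (boundary_borel o\<^sub>X D) - (boundary - A) = A"
    using closedin_subset[OF assms] sub by (auto simp: boundary_borel_def space_measure_of top)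
  ultimately show ?thesis by (simp add: sets_\<mu>)
qed

lemma cball_measurable [simp]: "cball \<eta> r \<in> sets \<mu>"
  by (intro closedin_measurable Metric_space.closedin_mcball[OF metric])

lemma singleton_measurable:
  assumes "\<eta> \<in> boundary"
  shows "{\<eta>} \<in> sets \<mu>"
proof -
  have "\<zeta> \<in> cball \<eta> 0 \<longleftrightarrow> \<zeta> = \<eta>" for \<zeta>
    using assms Metric_space.zero[OF metric, of \<eta> \<zeta>] Metric_space.nonneg[OF metric, of \<eta> \<zeta>]
      Metric_space.mdist_zero[OF metric assms] by (auto simp: mem_cball)
  then have "cball \<eta> 0 = {\<eta>}" by blast
  then show ?thesis using cball_measurable[of \<eta> 0] by simp
qed

text \<open>Neither the measurability of the derivative nor that of images of Borel sets is needed to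
  estimate the measure of a set from that of a set containing its image.\<close>

lemma measure_image_bound:
  assumes g: "g \<in> G" and A: "A \<in> sets \<mu>" and Y: "Y \<in> sets \<mu>" "boundary_act g ` A \<subseteq> Y"
    and deriv: "\<And>\<eta>. \<eta> \<in> A \<Longrightarrow> b powr t \<le> metric_deriv o\<^sub>X b g \<eta>"
  shows "b powr (\<delta> * t) * measure \<mu> A \<le> Q * measure \<mu> Y"
proof -
  have "ennreal (b powr (\<delta> * t)) * emeasure \<mu> A = (\<integral>\<^sup>+\<eta>\<in>A. ennreal (b powr (\<delta> * t)) \<partial>\<mu>)"
    using A by (simp add: nn_integral_cmult_indicator)
  also have "\<dots> \<le> (\<integral>\<^sup>+\<eta>\<in>A. ennreal (metric_deriv o\<^sub>X b g \<eta> powr \<delta>) \<partial>\<mu>)"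
  proof (intro nn_integral_mono)
    fix \<eta>
    have "b powr (\<delta> * t) \<le> metric_deriv o\<^sub>X b g \<eta> powr \<delta>" if "\<eta> \<in> A"
      using powr_mono2[OF \<delta>_nonneg _ deriv[OF that]] by (simp add: powr_powr mult.commute)
    then show "ennreal (b powr (\<delta> * t)) * indicator A \<eta> \<le> ennreal (metric_deriv o\<^sub>X b g \<eta> powr \<delta>) * indicator A \<eta>"
      by (auto simp: indicator_def intro: ennreal_leI)
  qed
  also have "\<dots> = ennreal Q * (ennreal (inverse Q) * \<dots>)"
    using Q_ge_1 by (simp add: mult.assoc[symmetric] ennreal_mult'[symmetric])
  also have "\<dots> \<le> ennreal Q * emeasure \<mu> (boundary_act g ` A)"
    by (intro mult_left_mono qc_lower g A) auto
  also have "\<dots> \<le> ennreal Q * emeasure \<mu> Y"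
    using Y by (intro mult_left_mono emeasure_mono) auto
  finally have "ennreal (b powr (\<delta> * t) * measure \<mu> A) \<le> ennreal (Q * measure \<mu> Y)"
    using Q_ge_1 by (simp add: emeasure_eq_measure ennreal_mult)
  then show ?thesis using Q_ge_1 by (subst (asm) ennreal_le_iff) auto
qed

lemma emeasure_act_singleton:
  assumes "g \<in> G" "\<eta> \<in> boundary" "emeasure \<mu> {\<eta>} = 0"
  shows "emeasure \<mu> {boundary_act g \<eta>} = 0"
proof -
  have "{\<eta>} \<in> null_sets \<mu>" using assms singleton_measurable by auto
  then show ?thesis
    using qc_upper[OF assms(1) singleton_measurable[OF assms(2)]] by (simp add: nn_integral_null_set)
qed

text \<open>A ball around \<open>\<zeta>\<close> of radius at most \<open>radius_const * b powr (- (\<zeta>|g\<inverse> o))\<close> is small enough for the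
  derivative of \<open>g\<close> to be nearly constant on it.\<close>

definition radius_const :: real where
  "radius_const = b powr (- (C + 1)) / V"

text \<open>On such a ball \<open>g\<close> expands distances from the centre by at most this factor more than
  \<open>b powr (2 (\<zeta>|g\<inverse> o) - len g)\<close>, which is comparable to its derivative.\<close>

definition distortion :: real where
  "distortion = V\<^sup>2 * b powr (2 * C + 3) * b powr C"

lemma radius_const: "0 < radius_const" "radius_const \<le> 1"
proof -
  show "0 < radius_const" using b_gt_1 V_ge_1 by (simp add: radius_const_def)
  have "b powr (- (C + 1)) \<le> b powr 0" using b_gt_1 C_nonneg by (subst powr_le_cancel_iff) auto
  then show "radius_const \<le> 1" using V_ge_1 b_gt_1 by (simp add: radius_const_def)
qed

lemma distortion: "distortion \<ge> 1"
proof -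
  have "1 \<le> V\<^sup>2" "1 \<le> b powr (2 * C + 3)" "1 \<le> b powr C"
    using b_gt_1 V_ge_1 C_nonneg by (auto simp: ge_one_powr_ge_zero)
  then have "1 * 1 * 1 \<le> distortion" unfolding distortion_def by (intro mult_mono) auto
  then show ?thesis by simp
qed

text \<open>The factor \<open>- 2 * C\<close> in the exponent on the left accounts for the variation of the derivative
  over the ball.\<close>

lemma ball_transport:
  assumes g: "g \<in> G" and \<zeta>: "\<zeta> \<in> boundary"
  defines "p \<equiv> point_product \<zeta> (inv_into UNIV g o\<^sub>X) o\<^sub>X"
  assumes r: "r \<le> radius_const * b powr (- p)"
  shows "b powr (\<delta> * (2 * p - len g - 2 * C)) * measure \<mu> (cball \<zeta> r) \<le>
    Q * measure \<mu> (cball (boundary_act g \<zeta>) (distortion * b powr (2 * p - len g) * r))"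
proof (rule measure_image_bound[OF g])
  let ?z = "inv_into UNIV g o\<^sub>X"
  have near: "\<bar>point_product \<eta> ?z o\<^sub>X - p\<bar> \<le> C" if "\<eta> \<in> cball \<zeta> r" for \<eta>
  proof -
    have "D \<zeta> \<eta> \<le> radius_const * b powr (- p)" using that r by (auto simp: mem_cball)
    also have "\<dots> = b powr (- (p + C + 1)) / V"
      by (simp add: radius_const_def powr_add[symmetric] algebra_simps)
    finally show ?thesis
      using point_product_near[OF \<zeta>, of \<eta> ?z] that by (simp add: p_def mem_cball)
  qed
  show "b powr (2 * p - len g - 2 * C) \<le> metric_deriv o\<^sub>X b g \<eta>" if "\<eta> \<in> cball \<zeta> r" for \<eta>
  proof -
    have "b powr (2 * p - len g - 2 * C) \<le> b powr (2 * point_product \<eta> ?z o\<^sub>X - len g)"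
      using near[OF that] b_gt_1 by auto
    also have "\<dots> \<le> metric_deriv o\<^sub>X b g \<eta>"
      using metric_deriv_ge[of g \<eta>] g that by (auto simp: G_isometry mem_cball)
    finally show ?thesis .
  qed
  show "boundary_act g ` cball \<zeta> r \<subseteq> cball (boundary_act g \<zeta>) (distortion * b powr (2 * p - len g) * r)"
  proof safe
    fix \<eta> assume \<eta>: "\<eta> \<in> cball \<zeta> r"
    then have \<eta>': "\<eta> \<in> boundary" "D \<zeta> \<eta> \<le> r" by (auto simp: mem_cball)
    have "D (boundary_act g \<zeta>) (boundary_act g \<eta>) \<le>
      V\<^sup>2 * b powr (2 * C + 3) * b powr (p + point_product \<eta> ?z o\<^sub>X - len g) * D \<zeta> \<eta>"
      using dist_act_le[OF G_isometry[OF g] \<zeta> \<eta>'(1)] by (simp add: p_def)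
    also have "\<dots> \<le> V\<^sup>2 * b powr (2 * C + 3) * b powr (C + (2 * p - len g)) * r"
      using near[OF \<eta>] \<eta>'(2) b_gt_1 V_ge_1 Metric_space.nonneg[OF metric]
      by (intro mult_mono mult_left_mono) auto
    also have "\<dots> = distortion * b powr (2 * p - len g) * r"
      unfolding distortion_def powr_add by (simp add: mult_ac)
    finally show "boundary_act g \<eta> \<in> cball (boundary_act g \<zeta>) (distortion * b powr (2 * p - len g) * r)"
      using G_isometry[OF g] \<zeta> \<eta>' by (auto simp: mem_cball boundary_act_in_boundary)
  qed
qed auto

end

text \<open>A boundary point around which the measure of balls is comparable to a power of the radius.\<close>

locale regular_point = quasiconformal_action o\<^sub>X C b V D G \<mu> \<delta> Q
  for o\<^sub>X :: "'a::metric_space" and C b V D G \<mu> \<delta> Q +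
  fixes \<xi> :: "(nat \<Rightarrow> 'a) set" and R :: real
  assumes \<xi>: "\<xi> \<in> gromov_boundary o\<^sub>X" and R_ge_1: "R \<ge> 1"
    and ball_lower: "\<And>r. 0 < r \<Longrightarrow> r \<le> 1 \<Longrightarrow> r powr \<delta> \<le> R * measure \<mu> (cball \<xi> r)"
    and ball_upper: "\<And>r. 0 < r \<Longrightarrow> r \<le> 1 \<Longrightarrow> measure \<mu> (cball \<xi> r) \<le> R * r powr \<delta>"
begin

lemma ball_upper': "r > 0 \<Longrightarrow> measure \<mu> (cball \<xi> r) \<le> R * r powr \<delta>"
proof (cases "r \<le> 1")
  case False
  have "measure \<mu> (cball \<xi> r) \<le> 1" by (rule prob_le_1)
  also have "1 \<le> R * r powr \<delta>"
    using mult_mono[of 1 R 1 "r powr \<delta>"] R_ge_1 False \<delta>_nonneg by (simp add: ge_one_powr_ge_zero)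
  finally show ?thesis .
qed (use ball_upper in auto)

abbreviation orbit_point :: "('a \<Rightarrow> 'a) \<Rightarrow> (nat \<Rightarrow> 'a) set" where
  "orbit_point g \<equiv> boundary_act g \<xi>"

lemma orbit_point_in_boundary: "g \<in> G \<Longrightarrow> orbit_point g \<in> boundary"
  using \<xi> by (intro boundary_act_in_boundary G_isometry)

text \<open>Transporting the ball to \<open>\<xi>\<close> by the inverse of \<open>g\<close>, and from \<open>\<xi>\<close> by \<open>g\<close>, shows that
  small balls around \<open>g \<xi>\<close> have the same measure, up to constants, as those around \<open>\<xi>\<close>.\<close>

lemma orbit_ball_upper:
  obtains A where "A > 0" "\<And>g r. g \<in> G \<Longrightarrow> 0 < r \<Longrightarrow> r \<le> radius_const * b powr (- len g) \<Longrightarrow>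
    measure \<mu> (cball (orbit_point g) r) \<le> A * r powr \<delta>"
proof
  define A where "A = Q * R * distortion powr \<delta> * b powr (\<delta> * (2 * C))"
  show "A > 0" using Q_ge_1 R_ge_1 distortion b_gt_1 by (simp add: A_def)
  fix g r assume g: "g \<in> G" and r: "0 < r" "r \<le> radius_const * b powr (- len g)"
  let ?h = "inv_into UNIV g"
  define p where "p = point_product (orbit_point g) (inv_into UNIV ?h o\<^sub>X) o\<^sub>X"
  have hh: "inv_into UNIV ?h = g"
    using G_isometry[OF g] by (intro inv_inv_eq) (simp add: isometries_iff)
  have p: "p \<le> len g"
    using boundary_point_product_eq(3)[OF boundary_nonempty[OF orbit_point_in_boundary[OF g]], of "g o\<^sub>X" o\<^sub>X]
    by (simp add: p_def hh dist_commute)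
  have "radius_const * b powr (- len g) \<le> radius_const * b powr (- p)"
    using p radius_const b_gt_1 by (intro mult_left_mono) auto
  then have rp: "r \<le> radius_const * b powr (- p)" using r by simp
  define e where "e = 2 * p - len g"
  have "b powr (\<delta> * (e - 2 * C)) * measure \<mu> (cball (orbit_point g) r) \<le>
    Q * measure \<mu> (cball (boundary_act ?h (orbit_point g)) (distortion * b powr e * r))"
    using ball_transport[OF G_inv[OF g] orbit_point_in_boundary[OF g], of r] rp
    by (simp add: p_def len_inv[OF g] e_def)
  also have "boundary_act ?h (orbit_point g) = \<xi>"
    using boundary_act_inv(1)[OF G_isometry[OF g]] .
  also have "Q * measure \<mu> (cball \<xi> (distortion * b powr e * r)) \<le> Q * (R * (distortion * b powr e * r) powr \<delta>)"
    using Q_ge_1 r distortion b_gt_1 by (intro mult_left_mono ball_upper') auto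
  also have "\<dots> = b powr (\<delta> * (e - 2 * C)) * (A * r powr \<delta>)"
    using r distortion b_gt_1
    by (simp add: A_def powr_mult powr_powr mult_ac powr_add[symmetric] algebra_simps)
  finally show "measure \<mu> (cball (orbit_point g) r) \<le> A * r powr \<delta>"
    using b_gt_1 by (simp add: mult_le_cancel_left_pos)
qed

lemma orbit_ball_lower:
  obtains a where "a > 0" "\<And>g r. g \<in> G \<Longrightarrow> 0 < r \<Longrightarrow> r \<le> b powr (- len g) \<Longrightarrow>
    a * r powr \<delta> \<le> measure \<mu> (cball (orbit_point g) r)"
proof
  define k where "k = radius_const / distortion"
  have k: "0 < k" "k \<le> radius_const" "distortion * k \<le> 1" "k \<le> 1"
    using radius_const distortion by (auto simp: k_def field_simps mult_le_cancel_left1 intro: order_trans)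
  define a where "a = k powr \<delta> * b powr (- \<delta> * (2 * C)) / (R * Q)"
  show "a > 0" using Q_ge_1 R_ge_1 k b_gt_1 by (simp add: a_def)
  fix g r assume g: "g \<in> G" and r: "0 < r" "r \<le> b powr (- len g)"
  define p where "p = point_product \<xi> (inv_into UNIV g o\<^sub>X) o\<^sub>X"
  define e where "e = 2 * p - len g"
  define s where "s = k * (b powr (- e) * r)"
  have p: "p \<ge> 0" unfolding p_def by (intro boundary_point_product_eq(2) boundary_nonempty \<xi>)
  have "b powr (- e) * r \<le> b powr (- e) * b powr (- len g)" using r by (intro mult_left_mono) auto
  also have "\<dots> = b powr (- 2 * p)" by (simp add: e_def powr_add[symmetric])
  finally have er: "b powr (- e) * r \<le> b powr (- 2 * p)" .
  have "s \<le> radius_const * b powr (- 2 * p)"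
    unfolding s_def using er k r radius_const by (intro mult_mono) (simp_all add: less_imp_le)
  also have "\<dots> \<le> radius_const * b powr (- p)"
    using p radius_const b_gt_1 by (intro mult_left_mono) auto
  finally have s1: "s \<le> radius_const * b powr (- p)" .
  have "b powr (- p) \<le> b powr 0" using p b_gt_1 by (subst powr_le_cancel_iff) auto
  then have "radius_const * b powr (- p) \<le> 1 * 1" using radius_const b_gt_1 by (intro mult_mono) auto
  then have s2: "0 < s" "s \<le> 1" using s1 k r b_gt_1 by (auto simp: s_def)
  have "distortion * b powr e * s = (distortion * k) * (b powr e * b powr (- e)) * r"
    by (simp add: s_def mult_ac)
  also have "\<dots> \<le> 1 * 1 * r"
    using k r b_gt_1 by (intro mult_right_mono) (simp_all add: powr_add[symmetric])
  finally have s3: "distortion * b powr e * s \<le> r" by simp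
  have "s powr \<delta> = k powr \<delta> * b powr (- \<delta> * e) * r powr \<delta>"
    using k r b_gt_1 by (simp add: s_def powr_mult powr_powr mult_ac)
  then have "b powr (\<delta> * (e - 2 * C)) * s powr \<delta> =
      k powr \<delta> * (b powr (\<delta> * (e - 2 * C)) * b powr (- \<delta> * e)) * r powr \<delta>"
    by (simp add: mult_ac)
  also have "\<dots> = R * Q * (a * r powr \<delta>)"
    using R_ge_1 Q_ge_1 by (simp add: a_def powr_add[symmetric] algebra_simps)
  finally have "R * Q * (a * r powr \<delta>) = b powr (\<delta> * (e - 2 * C)) * s powr \<delta>" ..
  also have "\<dots> \<le> b powr (\<delta> * (e - 2 * C)) * (R * measure \<mu> (cball \<xi> s))"
    using s2 by (intro mult_left_mono ball_lower) auto
  also have "\<dots> = R * (b powr (\<delta> * (e - 2 * C)) * measure \<mu> (cball \<xi> s))" by simp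
  also have "\<dots> \<le> R * (Q * measure \<mu> (cball (orbit_point g) (distortion * b powr e * s)))"
    using ball_transport[OF g \<xi>, of s] s1 R_ge_1 by (intro mult_left_mono) (auto simp: p_def e_def)
  also have "\<dots> \<le> R * (Q * measure \<mu> (cball (orbit_point g) r))"
    using s3 R_ge_1 Q_ge_1 by (intro mult_left_mono finite_measure_mono) (auto simp: mem_cball)
  finally show "a * r powr \<delta> \<le> measure \<mu> (cball (orbit_point g) r)"
    using R_ge_1 Q_ge_1 by (simp add: mult.assoc mult_le_cancel_left_pos)
qed

end

section \<open>Translates of a boundary point in the shadows of the orbit\<close>

context regular_point
begin

text \<open>The elements \<open>g\<close> for which \<open>(\<xi>|g\<inverse> o)\<close> is at most \<open>\<sigma>\<close>. Equivalently, up to a constant,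
  \<open>(g \<xi>|g o)\<close> is at least \<open>len g - \<sigma>\<close>, which says that \<open>g \<xi>\<close> lies in the shadow of \<open>g o\<close> seen from \<open>o\<close>.\<close>

definition shadowed :: "real \<Rightarrow> ('a \<Rightarrow> 'a) set" where
  "shadowed \<sigma> = {g\<in>G. point_product \<xi> (inv_into UNIV g o\<^sub>X) o\<^sub>X \<le> \<sigma>}"

text \<open>If \<open>f\<close> moves \<open>\<xi>\<close>, then \<open>x\<close> and \<open>f x\<close> cannot both be far out in the direction of \<open>\<xi>\<close>, since
  \<open>x\<close> would then be far out in the two different directions \<open>\<xi>\<close> and \<open>f\<inverse> \<xi>\<close>.\<close>

lemma direction_dichotomy:
  assumes f: "f \<in> G" "orbit_point f \<noteq> \<xi>"
  obtains \<sigma> where "\<sigma> \<ge> 0" "\<And>x. point_product \<xi> x o\<^sub>X \<le> \<sigma> \<or> point_product \<xi> (f x) o\<^sub>X \<le> \<sigma>"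
proof -
  let ?h = "inv_into UNIV f"
  define \<eta> where "\<eta> = boundary_act ?h \<xi>"
  have \<eta>: "\<eta> \<in> boundary" using f \<xi> G_inv by (auto simp: \<eta>_def orbit_point_in_boundary)
  have f\<eta>: "boundary_act f \<eta> = \<xi>" using boundary_act_inv(2)[OF G_isometry[OF f(1)]] by (simp add: \<eta>_def)
  then have "\<xi> \<noteq> \<eta>" using f(2) by metis
  then obtain q where q: "boundary_product \<xi> \<eta> o\<^sub>X = ereal q"
    using boundary_product_real[OF \<xi> \<eta>] by blast
  define \<sigma> where "\<sigma> = max 0 (q + C + 1 + len f)"
  have "point_product \<xi> x o\<^sub>X \<le> \<sigma> \<or> point_product \<xi> (f x) o\<^sub>X \<le> \<sigma>" for x
  proof (rule ccontr)
    assume "\<not> ?thesis"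
    then have far: "q + C + 1 + len f < point_product \<xi> x o\<^sub>X" "q + C + 1 + len f < point_product \<xi> (f x) o\<^sub>X"
      by (auto simp: \<sigma>_def)
    have "point_product \<eta> x o\<^sub>X = point_product \<xi> (f x) (f o\<^sub>X)"
      using point_product_act[OF G_isometry[OF f(1)], of \<eta> x o\<^sub>X] by (simp add: f\<eta>)
    also have "\<dots> \<ge> point_product \<xi> (f x) o\<^sub>X - len f"
      using point_product_change_base[OF boundary_nonempty[OF \<xi>], of "f x" o\<^sub>X "f o\<^sub>X"] by (simp add: dist_commute)
    finally have "q + C + 1 < point_product \<eta> x o\<^sub>X" using far by simp
    moreover have "q + C + 1 < point_product \<xi> x o\<^sub>X" using far zero_le_dist[of o\<^sub>X "f o\<^sub>X"] by linarith
    ultimately have "ereal (q + C + 1 - C) \<le> boundary_product \<xi> \<eta> o\<^sub>X"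
      by (intro boundary_product_hyperbolic[OF \<xi> \<eta>])
    then show False by (simp add: q)
  qed
  then show ?thesis using that[of \<sigma>] by (simp add: \<sigma>_def)
qed

text \<open>Hence either \<open>g\<close> or \<open>g f\<inverse>\<close> is shadowed, so that shadowed elements are a positive
  proportion of the group.\<close>

lemma shadowed_growth:
  assumes f: "f \<in> G" "orbit_point f \<noteq> \<xi>" and c: "c > 0"
    and count: "\<And>t. t > 0 \<Longrightarrow> c * b powr (\<delta> * t) \<le> card {g\<in>G. len g \<le> t}"
  obtains \<sigma> c' where "\<sigma> \<ge> 0" "c' > 0"
    "\<And>t. t > 0 \<Longrightarrow> c' * b powr (\<delta> * t) \<le> card {g\<in>shadowed \<sigma>. len g \<le> t}"
proof -
  obtain \<sigma> where \<sigma>: "\<sigma> \<ge> 0" "\<And>x. point_product \<xi> x o\<^sub>X \<le> \<sigma> \<or> point_product \<xi> (f x) o\<^sub>X \<le> \<sigma>"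
    using direction_dichotomy[OF f] by blast
  let ?h = "inv_into UNIV f"
  let ?P = "\<lambda>t. {g\<in>shadowed \<sigma>. len g \<le> t}"
  have finP: "finite (?P t)" for t
    by (rule finite_subset[OF _ G_discrete[of t]]) (auto simp: shadowed_def)
  have fh: "?h \<circ> f = id" "f \<circ> ?h = id" using isometry_inv_apply[OF G_isometry[OF f(1)]] by auto
  have half: "card {g\<in>G. len g \<le> t} \<le> 2 * card (?P (t + len f))" for t
  proof -
    have "{g\<in>G. len g \<le> t} \<subseteq> ?P (t + len f) \<union> (\<lambda>g. g \<circ> f) ` ?P (t + len f)"
    proof
      fix g assume g: "g \<in> {g\<in>G. len g \<le> t}"
      show "g \<in> ?P (t + len f) \<union> (\<lambda>g. g \<circ> f) ` ?P (t + len f)"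
      proof (cases "point_product \<xi> (inv_into UNIV g o\<^sub>X) o\<^sub>X \<le> \<sigma>")
        case True
        then show ?thesis using g by (auto simp: shadowed_def intro: add_increasing2)
      next
        case False
        have gi: "bij g" "bij ?h" "bij f"
          using g f G_isometry G_inv by (auto simp: isometries_iff)
        have "inv_into UNIV (g \<circ> ?h) = f \<circ> inv_into UNIV g"
          using o_inv_distrib[OF gi(1,2)] inv_inv_eq[OF gi(3)] by simp
        then have "g \<circ> ?h \<in> shadowed \<sigma>"
          using False \<sigma>(2)[of "inv_into UNIV g o\<^sub>X"] g f G_comp G_inv by (auto simp: shadowed_def)
        moreover have "len (g \<circ> ?h) \<le> t + len f"
          using g isometry_dist[of g o\<^sub>X "?h o\<^sub>X"] dist_triangle[of o\<^sub>X "g (?h o\<^sub>X)" "g o\<^sub>X"] len_inv[OF f(1)] G_isometry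
          by (auto simp: )
        moreover have "g = (g \<circ> ?h) \<circ> f" by (simp add: comp_assoc fh)
        ultimately show ?thesis by blast
      qed
    qed
    then have "card {g\<in>G. len g \<le> t} \<le> card (?P (t + len f) \<union> (\<lambda>g. g \<circ> f) ` ?P (t + len f))"
      using finP by (intro card_mono) auto
    also have "\<dots> \<le> card (?P (t + len f)) + card ((\<lambda>g. g \<circ> f) ` ?P (t + len f))"
      by (rule card_Un_le)
    also have "\<dots> \<le> card (?P (t + len f)) + card (?P (t + len f))"
      using finP by (intro add_left_mono card_image_le)
    finally show ?thesis by simp
  qed
  define c' where "c' = min (c / 2) 1 * b powr (- \<delta> * len f)"
  have "c' > 0" using c b_gt_1 by (simp add: c'_def)
  moreover have "c' * b powr (\<delta> * t) \<le> card (?P t)" if t: "t > 0" for t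
  proof (cases "t > len f")
    case True
    have "c' * b powr (\<delta> * t) = min (c / 2) 1 * b powr (\<delta> * (t - len f))"
      by (simp add: c'_def mult.assoc powr_add[symmetric] algebra_simps)
    also have "\<dots> \<le> c / 2 * b powr (\<delta> * (t - len f))" by (intro mult_right_mono) auto
    also have "\<dots> \<le> card (?P t)" using count[of "t - len f"] half[of "t - len f"] True by simp
    finally show ?thesis .
  next
    case False
    have "id \<in> ?P t"
      using boundary_point_product_eq(3)[OF boundary_nonempty[OF \<xi>], of o\<^sub>X o\<^sub>X] \<sigma>(1) t G_id
      by (auto simp: shadowed_def inv_id)
    then have "?P t \<noteq> {}" by blast
    then have "0 < card (?P t)" unfolding card_gt_0_iff using finP by blast
    then have "1 \<le> card (?P t)" by simp
    have "c' * b powr (\<delta> * t) = min (c / 2) 1 * b powr (\<delta> * (t - len f))"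
      by (simp add: c'_def mult.assoc powr_add[symmetric] algebra_simps)
    also have "\<dots> \<le> 1 * b powr 0"
      using False b_gt_1 \<delta>_nonneg c by (intro mult_mono powr_mono) (auto simp: mult_le_0_iff)
    finally show ?thesis using \<open>1 \<le> card (?P t)\<close> b_gt_1 by simp
  qed
  ultimately show ?thesis using that \<sigma>(1) by blast
qed

text \<open>Shadowed elements of about the same length whose orbit points on the boundary are close
  have nearby orbit points in the space.\<close>

lemma shadowed_separation:
  assumes gh: "g \<in> shadowed \<sigma>" "h \<in> shadowed \<sigma>" and \<sigma>: "\<sigma> \<ge> 0" and L: "L \<ge> 0"
    and len: "l \<le> len g" "len g \<le> l + L" "l \<le> len h" "len h \<le> l + L"
    and close: "D (orbit_point h) (orbit_point g) \<le> b powr (- (l + L)) / V"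
  shows "len (inv_into UNIV g \<circ> h) \<le> 2 * L + 2 * \<sigma> + 6 * C + 4"
proof -
  have G: "g \<in> G" "h \<in> G" using gh by (auto simp: shadowed_def)
  have end_ge: "l - \<sigma> - C - 1 \<le> point_product (orbit_point k) (k o\<^sub>X) o\<^sub>X"
    if "k \<in> shadowed \<sigma>" "l \<le> len k" for k
  proof -
    have k: "k \<in> G" "point_product \<xi> (inv_into UNIV k o\<^sub>X) o\<^sub>X \<le> \<sigma>" using that by (auto simp: shadowed_def)
    have "point_product (orbit_point k) (k o\<^sub>X) o\<^sub>X = point_product \<xi> o\<^sub>X (inv_into UNIV k o\<^sub>X)"
      using point_product_act'[OF G_isometry[OF k(1)], of \<xi> "k o\<^sub>X" o\<^sub>X]
      by (simp add: isometry_inv_apply[OF G_isometry[OF k(1)]])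
    then show ?thesis
      using point_product_swap_base_ge[OF \<xi>, of "inv_into UNIV k o\<^sub>X"] k(2) that(2) len_inv[OF k(1)] by simp
  qed
  define r where "r = l - \<sigma> - C - 1"
  have "ereal (l + L) \<le> boundary_product (orbit_point h) (orbit_point g) o\<^sub>X"
    by (rule le_boundary_product_if_close[OF _ _ close]) (use G in \<open>auto simp: orbit_point_in_boundary\<close>)
  then have "ereal r \<le> boundary_product (orbit_point h) (orbit_point g) o\<^sub>X"
    using \<sigma> C_nonneg L by (elim order_trans[rotated]) (simp add: r_def)
  then have "r - C \<le> point_product (orbit_point g) (h o\<^sub>X) o\<^sub>X"
    using point_product_hyperbolic[OF _ _ _ end_ge[OF gh(2) len(3), folded r_def]] G
    by (simp add: orbit_point_in_boundary)
  moreover have "r \<le> point_product (orbit_point g) (g o\<^sub>X) o\<^sub>X"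
    using end_ge[OF gh(1) len(1)] by (simp add: r_def)
  ultimately have "r - C - 1 - C \<le> gromov_product (g o\<^sub>X) (h o\<^sub>X) o\<^sub>X"
    using C_nonneg G by (intro gromov_product_hyperbolic_boundary[of "orbit_point g"]) (auto simp: orbit_point_in_boundary)
  moreover have "dist (g o\<^sub>X) (h o\<^sub>X) = len (inv_into UNIV g \<circ> h)"
    using isometry_dist[OF isometry_inv[OF G_isometry[OF G(1)]], of "g o\<^sub>X" "h o\<^sub>X"]
    by (simp add: isometry_inv_apply[OF G_isometry[OF G(1)]])
  ultimately show ?thesis
    using len by (simp add: gromov_product_def r_def dist_commute)
qed

text \<open>Thus the balls of radius a small multiple of \<open>b powr (- len g)\<close> around the points \<open>g \<xi>\<close>, where \<open>g\<close>
  runs through a layer of shadowed elements, overlap with bounded multiplicity: the elements whose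
  ball contains a given point all lie within a bounded distance of one of them.\<close>

lemma shadowed_multiplicity:
  assumes \<sigma>: "\<sigma> \<ge> 0" and L: "L \<ge> 0" and \<rho>: "2 * \<rho> \<le> b powr (- (real (Suc n) * L)) / V"
  shows "card {h\<in>layer (shadowed \<sigma>) len L n. \<eta> \<in> cball (orbit_point h) \<rho>}
    \<le> card {k\<in>G. len k \<le> 2 * L + 2 * \<sigma> + 6 * C + 4}"
proof (cases "{h\<in>layer (shadowed \<sigma>) len L n. \<eta> \<in> cball (orbit_point h) \<rho>} = {}")
  case False
  let ?E = "{h\<in>layer (shadowed \<sigma>) len L n. \<eta> \<in> cball (orbit_point h) \<rho>}"
  obtain g where g: "g \<in> ?E" using False by blast
  have gG: "g \<in> G" using g by (auto simp: layer_def shadowed_def)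
  let ?i = "\<lambda>h. inv_into UNIV g \<circ> h"
  have "inj_on ?i ?E"
  proof (rule inj_onI)
    fix h h' assume "?i h = ?i h'"
    then have "g \<circ> (?i h) = g \<circ> (?i h')" by simp
    then show "h = h'" using isometry_inv_apply(1)[OF G_isometry[OF gG]] by (simp add: fun_eq_iff)
  qed
  moreover have "?i ` ?E \<subseteq> {k\<in>G. len k \<le> 2 * L + 2 * \<sigma> + 6 * C + 4}"
  proof safe
    fix h assume h: "h \<in> layer (shadowed \<sigma>) len L n" "\<eta> \<in> cball (orbit_point h) \<rho>"
    then have hG: "h \<in> G" by (auto simp: layer_def shadowed_def)
    show "?i h \<in> G" using hG gG G_comp G_inv by blast
    have "D (orbit_point h) (orbit_point g) \<le> D (orbit_point h) \<eta> + D \<eta> (orbit_point g)"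
      using h(2) g by (intro Metric_space.triangle[OF metric]) (auto simp: mem_cball)
    also have "\<dots> \<le> 2 * \<rho>"
      using h(2) g Metric_space.commute[OF metric, of \<eta> "orbit_point g"] by (auto simp: mem_cball)
    finally have "D (orbit_point h) (orbit_point g) \<le> b powr (- (real n * L + L)) / V"
      using \<rho> by (simp add: algebra_simps)
    then show "len (?i h) \<le> 2 * L + 2 * \<sigma> + 6 * C + 4"
      using h(1) g \<sigma> L by (intro shadowed_separation[of g \<sigma> h L "real n * L"]) (auto simp: layer_def algebra_simps)
  qed
  ultimately show ?thesis using G_discrete by (intro card_inj_on_le)
qed (simp only: card.empty le0)

end

section \<open>Quasi-independence of the orbit balls\<close>

context regular_point
begin

text \<open>Balls around the points of the first \<open>N\<close> layers of the orbit, of radius depending only on the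
  layer, cover a fixed proportion of the space once the sum of the measures of the balls is at least of
  order one, no matter how the radii are chosen below the natural scale of the layers.\<close>

lemma orbit_balls_cover:
  assumes \<delta>: "\<delta> > 0" and f: "f \<in> G" "orbit_point f \<noteq> \<xi>" and c: "c > 0"
    and count: "\<And>t. t > 0 \<Longrightarrow> c * b powr (\<delta> * t) \<le> card {g\<in>G. len g \<le> t}"
      "\<And>t. t > 0 \<Longrightarrow> card {g\<in>G. len g \<le> t} \<le> c' * b powr (\<delta> * t)"
  obtains L \<theta> \<kappa> where "L \<ge> 1" "\<theta> > 0" "\<kappa> > 0"
    "\<And>r N. (\<And>n. 0 < r n) \<Longrightarrow> (\<And>n. r n \<le> \<theta> * b powr (- (real (Suc n) * L))) \<Longrightarrow>
      (\<Sum>n<N. b powr (\<delta> * (real n * L)) * r n powr \<delta>) \<ge> 1 \<Longrightarrow>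
      \<kappa> \<le> measure \<mu> (\<Union>n<N. \<Union>g\<in>layer G len L n. cball (orbit_point g) (r n))"
proof -
  obtain \<sigma> c1 where \<sigma>: "\<sigma> \<ge> 0" and c1: "c1 > 0"
    and count1: "\<And>t. t > 0 \<Longrightarrow> c1 * b powr (\<delta> * t) \<le> card {g\<in>shadowed \<sigma>. len g \<le> t}"
    using shadowed_growth[OF f c count(1)] by blast
  have finP: "finite {g\<in>shadowed \<sigma>. len g \<le> t}" for t
    by (rule finite_subset[OF _ G_discrete[of t]]) (auto simp: shadowed_def)
  have "card {g\<in>shadowed \<sigma>. len g \<le> t} \<le> c' * b powr (\<delta> * t)" if "t > 0" for t
  proof -
    have "card {g\<in>shadowed \<sigma>. len g \<le> t} \<le> card {g\<in>G. len g \<le> t}"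
      using G_discrete by (intro card_mono) (auto simp: shadowed_def)
    then show ?thesis using count(2)[OF that] by linarith
  qed
  then obtain L M where L: "L \<ge> 1" and M: "M \<ge> 1" and fin: "\<And>n. finite (layer (shadowed \<sigma>) len L n)"
    and card_ge: "\<And>n. b powr (\<delta> * (real n * L)) \<le> card (layer (shadowed \<sigma>) len L n)"
    and card_le: "\<And>n. card (layer (shadowed \<sigma>) len L n) \<le> M * b powr (\<delta> * (real n * L))"
    using layer_growth[OF b_gt_1 \<delta> c1 finP count1, of c'] by blast
  obtain A where A: "A > 0" and upper: "\<And>g r. g \<in> G \<Longrightarrow> 0 < r \<Longrightarrow> r \<le> radius_const * b powr (- len g) \<Longrightarrow>
    measure \<mu> (cball (orbit_point g) r) \<le> A * r powr \<delta>"
    using orbit_ball_upper by blast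
  obtain a where a: "a > 0" and lower: "\<And>g r. g \<in> G \<Longrightarrow> 0 < r \<Longrightarrow> r \<le> b powr (- len g) \<Longrightarrow>
    a * r powr \<delta> \<le> measure \<mu> (cball (orbit_point g) r)"
    using orbit_ball_lower by blast
  \<comment> \<open>Balls of radius \<open>\<rho> n\<close> around orbit points of the layer \<open>n\<close> overlap with multiplicity at most \<open>m\<close>,
    and the measure estimates apply to balls of three times this radius.\<close>
  define H where "H n = layer (shadowed \<sigma>) len L n" for n
  define m where "m = card {k\<in>G. len k \<le> 2 * L + 2 * \<sigma> + 6 * C + 4}"
  define \<theta> where "\<theta> = min (1 / (2 * V)) (radius_const / 3)"
  define \<rho> where "\<rho> n = \<theta> * b powr (- (real (Suc n) * L))" for n
  define \<beta> where "\<beta> n = b powr (\<delta> * (real n * L))" for n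
  define q where "q = b powr (- \<delta> * L)"
  have \<theta>: "0 < \<theta>" "2 * \<theta> \<le> 1 / V" "3 * \<theta> \<le> radius_const" "\<theta> \<le> 1"
    using V_ge_1 radius_const by (auto simp: \<theta>_def min_def field_simps)
  have \<rho>0: "\<rho> n > 0" for n using \<theta> b_gt_1 by (simp add: \<rho>_def)
  have q: "0 \<le> q" "q < 1"
  proof -
    have "b powr (- \<delta> * L) < b powr 0"
      using b_gt_1 \<delta> L by (subst powr_less_cancel_iff) auto
    then show "0 \<le> q" "q < 1" using b_gt_1 by (auto simp: q_def)
  qed
  have HG: "g \<in> G" if "g \<in> H n" for g n using that by (auto simp: H_def layer_def shadowed_def)
  have \<rho>_mono: "\<rho> n \<le> \<rho> k" if "k \<le> n" for k n
  proof -
    have "real (Suc k) * L \<le> real (Suc n) * L" using that L by (intro mult_right_mono) auto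
    then show ?thesis unfolding \<rho>_def using \<theta> b_gt_1 by (intro mult_left_mono) auto
  qed
  have \<rho>_len: "\<rho> n \<le> \<theta> * b powr (- len g)" if "g \<in> H n" for g n
    using that b_gt_1 \<theta> by (auto simp: H_def layer_def \<rho>_def intro!: mult_left_mono)
  have \<rho>_le: "\<rho> n \<le> b powr (- len g)" "3 * \<rho> n \<le> radius_const * b powr (- len g)" if "g \<in> H n" for g n
  proof -
    have "\<theta> * b powr (- len g) \<le> 1 * b powr (- len g)" using \<theta> by (intro mult_right_mono) auto
    then show "\<rho> n \<le> b powr (- len g)" using \<rho>_len[OF that] by simp
    have "3 * \<theta> * b powr (- len g) \<le> radius_const * b powr (- len g)" using \<theta> by (intro mult_right_mono) auto
    then show "3 * \<rho> n \<le> radius_const * b powr (- len g)" using \<rho>_len[OF that] by simp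
  qed
  have \<rho>_\<beta>: "\<rho> n powr \<delta> * \<beta> n = \<theta> powr \<delta> * q" for n
  proof -
    have "\<rho> n powr \<delta> * \<beta> n = \<theta> powr \<delta> * (b powr (- (real (Suc n) * L) * \<delta>) * b powr (\<delta> * (real n * L)))"
      using \<theta> by (simp add: \<rho>_def \<beta>_def powr_mult powr_powr)
    also have "b powr (- (real (Suc n) * L) * \<delta>) * b powr (\<delta> * (real n * L)) = q"
      by (simp add: q_def powr_add[symmetric] algebra_simps)
    finally show ?thesis .
  qed
  have \<beta>_ratio: "\<beta> k = q ^ (n - k) * \<beta> n" if "k \<le> n" for k n
  proof -
    have "q ^ (n - k) = b powr (- \<delta> * L * real (n - k))"
      using b_gt_1 by (simp add: q_def powr_realpow[symmetric] powr_powr)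
    then show ?thesis using that by (simp add: \<beta>_def powr_add[symmetric] of_nat_diff algebra_simps)
  qed
  have \<beta>0: "\<beta> n > 0" for n using b_gt_1 by (simp add: \<beta>_def)
  define A1 where "A1 = real m * A * 3 powr \<delta> / a"
  define A2 where "A2 = A1 * (1 + 1 / (\<theta> powr \<delta> * q))"
  define A3 where "A3 = M * A2 * A"
  have q0: "q > 0" using b_gt_1 by (simp add: q_def)
  have m: "m > 0"
  proof -
    have "id \<in> {k\<in>G. len k \<le> 2 * L + 2 * \<sigma> + 6 * C + 4}" using G_id L \<sigma> C_nonneg by auto
    then have "{k\<in>G. len k \<le> 2 * L + 2 * \<sigma> + 6 * C + 4} \<noteq> {}" by blast
    then show ?thesis unfolding m_def card_gt_0_iff using G_discrete by blast
  qed
  have pos: "A1 > 0" "A2 > 0" "A3 > 0"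
    using m A a M \<theta> q0 by (auto simp: A1_def A2_def A3_def intro!: mult_pos_pos add_pos_pos divide_pos_pos)
  define \<kappa> where "\<kappa> = a\<^sup>2 / (2 * A3 * (1 + 1 / (1 - q)))"
  have "\<kappa> > 0" using a pos q by (auto simp: \<kappa>_def intro!: divide_pos_pos mult_pos_pos add_pos_pos)
  moreover have "\<kappa> \<le> measure \<mu> (\<Union>n<N. \<Union>g\<in>layer G len L n. cball (orbit_point g) (r n))"
    if r0: "\<And>n. 0 < r n" and r: "\<And>n. r n \<le> \<theta> * b powr (- (real (Suc n) * L))"
      and N: "(\<Sum>n<N. b powr (\<delta> * (real n * L)) * r n powr \<delta>) \<ge> 1" for r N
  proof -
    have r\<rho>: "r n \<le> \<rho> n" for n using r by (simp add: \<rho>_def)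
    define B where "B n g = cball (orbit_point g) (r n)" for n g
    have B_upper: "measure \<mu> (B n h) \<le> A * r n powr \<delta>" if "h \<in> H n" for n h
      unfolding B_def using \<rho>_le[OF that] r\<rho>[of n] \<rho>0[of n] r0[of n] HG[OF that] by (intro upper) auto
    have B_lower: "a * r n powr \<delta> \<le> measure \<mu> (B n h)" if "h \<in> H n" for n h
      unfolding B_def using \<rho>_le[OF that] r\<rho>[of n] r0[of n] HG[OF that] by (intro lower) auto
    \<comment> \<open>The disjointness up to multiplicity of the balls of radius \<open>\<rho> n\<close> bounds the number of small
      balls of the later layer that meet a given ball of an earlier layer by a volume comparison.\<close>
    have neighbours: "card {h\<in>H n. B k g \<inter> B n h \<noteq> {}} \<le> A2 * (\<beta> n * r k powr \<delta> + 1)"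
      if kn: "k \<le> n" and g: "g \<in> H k" for k n g
    proof -
      define E where "E = {h\<in>H n. B k g \<inter> B n h \<noteq> {}}"
      let ?Y = "cball (orbit_point g) (r k + 2 * \<rho> n)"
      have finE: "finite E" using fin by (simp add: E_def H_def)
      have "cball (orbit_point h) (\<rho> n) \<subseteq> ?Y" if h: "h \<in> E" for h
      proof
        fix \<eta> assume \<eta>: "\<eta> \<in> cball (orbit_point h) (\<rho> n)"
        obtain \<zeta> where \<zeta>: "\<zeta> \<in> B k g" "\<zeta> \<in> B n h" using h by (auto simp: E_def)
        have bd: "orbit_point g \<in> boundary" "orbit_point h \<in> boundary" "\<zeta> \<in> boundary" "\<eta> \<in> boundary"
          using \<zeta> \<eta> by (auto simp: B_def mem_cball)
        have "D (orbit_point g) \<eta> \<le> D (orbit_point g) \<zeta> + D \<zeta> (orbit_point h) + D (orbit_point h) \<eta>"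
          using Metric_space.triangle[OF metric bd(1,3,4)] Metric_space.triangle[OF metric bd(3,2,4)] by linarith
        also have "\<dots> \<le> r k + r n + \<rho> n"
          using \<zeta> \<eta> Metric_space.commute[OF metric, of \<zeta> "orbit_point h"] by (auto simp: B_def mem_cball)
        finally show "\<eta> \<in> ?Y" using r\<rho>[of n] bd by (simp add: mem_cball)
      qed
      then have "(\<Sum>h\<in>E. measure \<mu> (cball (orbit_point h) (\<rho> n))) \<le> real m * measure \<mu> ?Y"
      proof (intro sum_measure_le_multiplicity finE)
        fix \<eta>
        have "card {h\<in>E. \<eta> \<in> cball (orbit_point h) (\<rho> n)} \<le> card {h\<in>H n. \<eta> \<in> cball (orbit_point h) (\<rho> n)}"
          using fin by (intro card_mono) (auto simp: E_def H_def)
        also have "\<dots> \<le> m"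
          unfolding H_def m_def
        proof (rule shadowed_multiplicity[OF \<sigma>])
          show "0 \<le> L" using L by simp
          have "2 * \<theta> * b powr (- (real (Suc n) * L)) \<le> 1 / V * b powr (- (real (Suc n) * L))"
            using \<theta> by (intro mult_right_mono) auto
          then show "2 * \<rho> n \<le> b powr (- (real (Suc n) * L)) / V" by (simp add: \<rho>_def)
        qed
        finally show "card {h\<in>E. \<eta> \<in> cball (orbit_point h) (\<rho> n)} \<le> m" .
      qed auto
      moreover have "a * \<rho> n powr \<delta> * card E \<le> (\<Sum>h\<in>E. measure \<mu> (cball (orbit_point h) (\<rho> n)))"
      proof -
        have "(\<Sum>h\<in>E. a * \<rho> n powr \<delta>) \<le> (\<Sum>h\<in>E. measure \<mu> (cball (orbit_point h) (\<rho> n)))"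
          using \<rho>_le \<rho>0 HG by (intro sum_mono lower) (auto simp: E_def)
        then show ?thesis by (simp add: mult_ac)
      qed
      moreover have "measure \<mu> ?Y \<le> A * (3 powr \<delta> * (r k powr \<delta> + \<rho> n powr \<delta>))"
      proof -
        have "measure \<mu> ?Y \<le> A * (r k + 2 * \<rho> n) powr \<delta>"
          using \<rho>_le(2)[OF g] \<rho>_mono[OF kn] r\<rho>[of k] r0[of k] \<rho>0[of n] HG[OF g] by (intro upper) auto
        also have "(r k + 2 * \<rho> n) powr \<delta> \<le> (3 * max (r k) (\<rho> n)) powr \<delta>"
          using r0[of k] \<rho>0[of n] \<delta> by (intro powr_mono2) auto
        also have "\<dots> = 3 powr \<delta> * max (r k) (\<rho> n) powr \<delta>"
          using r0[of k] by (intro powr_mult) 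
        also have "max (r k) (\<rho> n) powr \<delta> \<le> r k powr \<delta> + \<rho> n powr \<delta>"
          by (auto simp: max_def)
        finally show ?thesis using A by (simp add: mult_left_mono)
      qed
      ultimately have "a * \<rho> n powr \<delta> * card E \<le> real m * (A * (3 powr \<delta> * (r k powr \<delta> + \<rho> n powr \<delta>)))"
        by (meson mult_left_mono of_nat_0_le_iff order_trans)
      then have "\<rho> n powr \<delta> * card E \<le> A1 * (r k powr \<delta> + \<rho> n powr \<delta>)"
        using a by (simp add: A1_def field_simps)
      then have "(\<rho> n powr \<delta> * card E) * \<beta> n \<le> A1 * (r k powr \<delta> + \<rho> n powr \<delta>) * \<beta> n"
        using \<beta>0[of n] by (intro mult_right_mono) auto
      then have "(\<rho> n powr \<delta> * \<beta> n) * card E \<le> A1 * (\<beta> n * r k powr \<delta> + \<rho> n powr \<delta> * \<beta> n)"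
        by (simp add: algebra_simps)
      then have "\<theta> powr \<delta> * q * card E \<le> A1 * (\<beta> n * r k powr \<delta> + \<theta> powr \<delta> * q)"
        by (simp only: \<rho>_\<beta>)
      then have "card E \<le> A1 * (\<beta> n * r k powr \<delta> * (1 / (\<theta> powr \<delta> * q)) + 1)"
        using \<theta> q0 by (simp add: field_simps)
      also have "\<dots> \<le> A1 * ((1 + 1 / (\<theta> powr \<delta> * q)) * (\<beta> n * r k powr \<delta> + 1))"
        using pos \<theta> q0 \<beta>0[of n] by (intro mult_left_mono) (auto simp: algebra_simps)
      finally show ?thesis by (simp add: A2_def E_def mult.assoc)
    qed
    have "a\<^sup>2 / (2 * A3 * (1 + 1 / (1 - q))) \<le> measure \<mu> (\<Union>n<N. \<Union>h\<in>H n. B n h)"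
    proof (rule quasi_independent_generations[where x = "\<lambda>n. \<beta> n * r n powr \<delta>"])
      show "a * (\<beta> n * r n powr \<delta>) \<le> (\<Sum>h\<in>H n. measure \<mu> (B n h))" for n
      proof -
        have "\<beta> n * (a * r n powr \<delta>) \<le> card (H n) * (a * r n powr \<delta>)"
          using card_ge a by (intro mult_right_mono) (auto simp: H_def \<beta>_def)
        also have "\<dots> = (\<Sum>h\<in>H n. a * r n powr \<delta>)" by simp
        also have "\<dots> \<le> (\<Sum>h\<in>H n. measure \<mu> (B n h))" by (intro sum_mono B_lower)
        finally show ?thesis by (simp add: mult_ac)
      qed
      show "(\<Sum>g\<in>H k. \<Sum>h\<in>H n. measure \<mu> (B k g \<inter> B n h)) \<le>
          A3 * (\<beta> k * r k powr \<delta> * (\<beta> n * r n powr \<delta>) + q ^ (n - k) * (\<beta> n * r n powr \<delta>))" if kn: "k \<le> n" for k n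
      proof -
        have "(\<Sum>h\<in>H n. measure \<mu> (B k g \<inter> B n h)) \<le> A2 * (\<beta> n * r k powr \<delta> + 1) * (A * r n powr \<delta>)"
          if g: "g \<in> H k" for g
        proof -
          have "(\<Sum>h\<in>H n. measure \<mu> (B k g \<inter> B n h)) = (\<Sum>h\<in>{h\<in>H n. B k g \<inter> B n h \<noteq> {}}. measure \<mu> (B k g \<inter> B n h))"
            using fin by (intro sum.mono_neutral_right) (auto simp: H_def)
          also have "\<dots> \<le> (\<Sum>h\<in>{h\<in>H n. B k g \<inter> B n h \<noteq> {}}. A * r n powr \<delta>)"
          proof (rule sum_mono)
            fix h assume h: "h \<in> {h\<in>H n. B k g \<inter> B n h \<noteq> {}}"
            have "measure \<mu> (B k g \<inter> B n h) \<le> measure \<mu> (B n h)"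
              by (intro finite_measure_mono) (auto simp: B_def)
            also have "\<dots> \<le> A * r n powr \<delta>" using h by (intro B_upper) auto
            finally show "measure \<mu> (B k g \<inter> B n h) \<le> A * r n powr \<delta>" .
          qed
          also have "\<dots> = card {h\<in>H n. B k g \<inter> B n h \<noteq> {}} * (A * r n powr \<delta>)" by simp
          also have "\<dots> \<le> A2 * (\<beta> n * r k powr \<delta> + 1) * (A * r n powr \<delta>)"
            using neighbours[OF kn g] A by (intro mult_right_mono) auto
          finally show ?thesis .
        qed
        then have "(\<Sum>g\<in>H k. \<Sum>h\<in>H n. measure \<mu> (B k g \<inter> B n h)) \<le>
            card (H k) * (A2 * (\<beta> n * r k powr \<delta> + 1) * (A * r n powr \<delta>))"
          by (rule sum_bounded_above)
        also have "\<dots> \<le> (M * \<beta> k) * (A2 * (\<beta> n * r k powr \<delta> + 1) * (A * r n powr \<delta>))"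
          using card_le[of k] pos A \<beta>0[of n] by (intro mult_right_mono) (auto simp: H_def \<beta>_def)
        also have "\<dots> = A3 * (\<beta> k * r k powr \<delta> * (\<beta> n * r n powr \<delta>) + \<beta> k * r n powr \<delta>)"
          by (simp add: A3_def algebra_simps)
        also have "\<beta> k * r n powr \<delta> = q ^ (n - k) * (\<beta> n * r n powr \<delta>)"
          using \<beta>_ratio[OF kn] by simp
        finally show ?thesis .
      qed
      show "1 \<le> (\<Sum>n<N. \<beta> n * r n powr \<delta>)" using N by (simp add: \<beta>_def)
    qed (use fin a pos q \<beta>0 in \<open>auto simp: H_def B_def less_imp_le\<close>)
    also have "\<dots> \<le> measure \<mu> (\<Union>n<N. \<Union>g\<in>layer G len L n. cball (orbit_point g) (r n))"
    proof (rule finite_measure_mono)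
      show "(\<Union>n<N. \<Union>h\<in>H n. B n h) \<subseteq> (\<Union>n<N. \<Union>g\<in>layer G len L n. cball (orbit_point g) (r n))"
        unfolding H_def B_def by (fastforce simp: layer_def shadowed_def)
      have "finite (layer G len L n)" for n
        by (rule finite_subset[OF _ G_discrete[of "real (Suc n) * L"]]) (auto simp: layer_def)
      then show "(\<Union>n<N. \<Union>g\<in>layer G len L n. cball (orbit_point g) (r n)) \<in> sets \<mu>"
        by (intro sets.finite_UN) simp_all
    qed
    finally show ?thesis by (simp add: \<kappa>_def)
  qed
  ultimately show ?thesis using that[of L \<theta> \<kappa>] L \<theta>(1) by blast
qed

end

section \<open>Well approximable points\<close>

text \<open>An approximation function: positive, with \<open>t \<mapsto> t * \<Phi> t\<close> nonincreasing.\<close>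

locale approximation_function =
  fixes \<Phi> :: "real \<Rightarrow> real"
  assumes \<Phi>_pos: "\<And>t. t \<ge> 0 \<Longrightarrow> \<Phi> t > 0"
    and \<Phi>_anti: "antimono_on {0<..} (\<lambda>t. t * \<Phi> t)"
begin

lemma mult_\<Phi>_antimono: "0 < s \<Longrightarrow> s \<le> t \<Longrightarrow> t * \<Phi> t \<le> s * \<Phi> s"
  using monotone_onD[OF \<Phi>_anti, of s t] by simp

lemma \<Phi>_antimono:
  assumes "0 < s" "s \<le> t"
  shows "\<Phi> t \<le> \<Phi> s"
proof -
  have "t * \<Phi> t \<le> s * \<Phi> s" using assms by (rule mult_\<Phi>_antimono)
  also have "\<dots> \<le> t * \<Phi> s" using assms \<Phi>_pos[of s] by (intro mult_right_mono) auto
  finally show ?thesis using assms by simp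
qed

lemma \<Phi>_scaled_le:
  assumes "K \<ge> 1" "\<Phi> 1 / K \<le> \<epsilon>" "t \<ge> 1"
  shows "\<Phi> (K * t) \<le> \<epsilon> / t"
proof -
  have "1 \<le> K * t" using assms mult_mono[of 1 K 1 t] by simp
  then have "(K * t) * \<Phi> (K * t) \<le> \<Phi> 1" using mult_\<Phi>_antimono[of 1 "K * t"] by simp
  also have "\<Phi> 1 \<le> \<epsilon> * K" using assms by (simp add: field_simps)
  finally show ?thesis using assms by (simp add: field_simps)
qed

end

text \<open>A quasiconformal action together with an approximation function and a boundary point that is not
  an atom, for a measure carried by the limit set.\<close>

locale khinchin_action = quasiconformal_action o\<^sub>X C b V D G \<mu> \<delta> Q + approximation_function \<Phi>
  for o\<^sub>X :: "'a::metric_space" and C b V D G \<mu> \<delta> Q \<Phi> +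
  fixes \<xi> :: "(nat \<Rightarrow> 'a) set"
  assumes base_point: "\<xi> \<in> gromov_boundary o\<^sub>X"
    and limit_set_full: "emeasure \<mu> (limit_set o\<^sub>X G) = 1"
    and no_atom: "emeasure \<mu> {\<xi>} = 0"
begin

abbreviation approx_radius :: "real \<Rightarrow> ('a \<Rightarrow> 'a) \<Rightarrow> real" where
  "approx_radius K g \<equiv> \<Phi> (K * b powr len g)"

lemma b_powr_len: "b powr len g \<ge> 1"
  using b_gt_1 by (simp add: ge_one_powr_ge_zero)

lemma approx_radius_pos: "K > 0 \<Longrightarrow> approx_radius K g > 0"
  using b_powr_len[of g] by (intro \<Phi>_pos) auto

lemma approx_radius_antimono: "0 < K \<Longrightarrow> K \<le> K' \<Longrightarrow> approx_radius K' g \<le> approx_radius K g"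
  using b_gt_1 by (intro \<Phi>_antimono mult_right_mono) auto

lemma approx_radius_small:
  assumes "K \<ge> 1" "\<Phi> 1 / K \<le> \<epsilon>"
  shows "approx_radius K g \<le> \<epsilon> * b powr (- len g)"
  using \<Phi>_scaled_le[OF assms b_powr_len[of g]] by (simp add: powr_minus divide_inverse)

lemma G_finite_layer: "finite (layer G len L n)"
  by (rule finite_subset[OF _ G_discrete[of "real (Suc n) * L"]]) (auto simp: layer_def)

lemma countable_G: "countable G"
proof -
  have "G \<subseteq> (\<Union>n::nat. {g\<in>G. len g \<le> n})" using real_arch_simple by auto
  then show ?thesis using G_discrete by (elim countable_subset) (auto intro: countable_finite)
qed

text \<open>A finite group has empty limit set, so the exponent is positive as soon as it governs the
  growth of the group.\<close>

lemma exponent_pos: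
  assumes "\<And>t. t > 0 \<Longrightarrow> card {g\<in>G. len g \<le> t} \<le> c * b powr (\<delta> * t)"
  shows "\<delta> > 0"
proof (rule ccontr)
  assume "\<not> \<delta> > 0"
  then have "\<delta> = 0" using \<delta>_nonneg by simp
  then have bound: "card {g\<in>G. len g \<le> t} \<le> c" if "t > 0" for t using assms[OF that] b_gt_1 by simp
  have "finite G"
  proof -
    have "card F \<le> nat \<lfloor>c\<rfloor>" if F: "F \<subseteq> G" "finite F" for F
    proof -
      define t where "t = 1 + (\<Sum>g\<in>F. len g)"
      have t: "t > 0" unfolding t_def by (intro add_pos_nonneg sum_nonneg) auto
      have "len g \<le> t" if "g \<in> F" for g
        using member_le_sum[OF that, of len] F by (simp add: t_def)
      then have "card F \<le> card {g\<in>G. len g \<le> t}" using F G_discrete by (intro card_mono) auto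
      then have "real (card F) \<le> c" using bound[OF t] by linarith
      then show ?thesis by linarith
    qed
    then show ?thesis using finite_if_finite_subsets_card_bdd[of G "nat \<lfloor>c\<rfloor>"] by blast
  qed
  have "limit_set o\<^sub>X G = {}"
  proof (rule ccontr)
    assume "limit_set o\<^sub>X G \<noteq> {}"
    then obtain \<eta> h where \<eta>: "\<eta> \<in> boundary" and h: "range h \<subseteq> G"
      and lim: "(\<lambda>n. boundary_point_product \<eta> (h n o\<^sub>X) o\<^sub>X) \<longlonglongrightarrow> \<infinity>"
      by (auto simp: limit_set_def)
    have "boundary_point_product \<eta> (h n o\<^sub>X) o\<^sub>X \<le> ereal (\<Sum>g\<in>G. len g)" for n
    proof -
      have "len (h n) \<le> (\<Sum>g\<in>G. len g)" using h \<open>finite G\<close> by (intro member_le_sum) auto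
      then show ?thesis
        using boundary_point_product_eq[OF boundary_nonempty[OF \<eta>], of "h n o\<^sub>X" o\<^sub>X] by (simp add: dist_commute)
    qed
    then have "\<infinity> \<le> ereal (\<Sum>g\<in>G. len g)" by (intro LIMSEQ_le_const2[OF lim]) auto
    then show False by simp
  qed
  then show False using limit_set_full by simp
qed

lemma cball_mono: "r \<le> s \<Longrightarrow> cball \<eta> r \<subseteq> cball \<eta> s"
  by (auto simp: mem_cball)

lemma limit_set_measurable: "limit_set o\<^sub>X G \<in> sets \<mu>"
  using limit_set_full emeasure_notin_sets[of "limit_set o\<^sub>X G" \<mu>] by auto

text \<open>The points approximated with a fixed constant \<open>K\<close>; these sets decrease as \<open>K\<close> grows, and
  within the limit set their intersection is the set of well approximable points.\<close>

definition approximable :: "real \<Rightarrow> (nat \<Rightarrow> 'a) set set" where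
  "approximable K = (\<Union>g\<in>G. cball (boundary_act g \<xi>) (approx_radius K g))"

lemma approximable_measurable: "approximable K \<in> sets \<mu>"
  unfolding approximable_def using countable_G by (intro sets.countable_UN'') auto

lemma approximable_antimono: "0 < K \<Longrightarrow> K \<le> K' \<Longrightarrow> approximable K' \<subseteq> approximable K"
  unfolding approximable_def by (intro UN_mono order_refl cball_mono approx_radius_antimono)

lemma WA_eq: "WA o\<^sub>X b D G \<Phi> \<xi> = limit_set o\<^sub>X G \<inter> (\<Inter>k. approximable (real (Suc k)))"
proof -
  have bd: "boundary_act g \<xi> \<in> boundary" if "g \<in> G" for g
    using that base_point by (intro boundary_act_in_boundary G_isometry)
  have mem: "\<eta> \<in> approximable K \<longleftrightarrow> (\<exists>g\<in>G. D (boundary_act g \<xi>) \<eta> \<le> approx_radius K g)"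
    if "\<eta> \<in> boundary" for \<eta> K
    using that bd by (auto simp: approximable_def mem_cball)
  have "(\<forall>K>0. \<eta> \<in> approximable K) \<longleftrightarrow> (\<forall>k. \<eta> \<in> approximable (real (Suc k)))" for \<eta>
  proof safe
    fix K :: real assume K: "K > 0" and all: "\<forall>k. \<eta> \<in> approximable (real (Suc k))"
    obtain k where "K \<le> real k" using real_arch_simple by blast
    then have "approximable (real (Suc k)) \<subseteq> approximable K" using K by (intro approximable_antimono) auto
    then show "\<eta> \<in> approximable K" using all by blast
  qed auto
  moreover have "limit_set o\<^sub>X G \<subseteq> boundary" by (auto simp: limit_set_def)
  ultimately have "\<eta> \<in> WA o\<^sub>X b D G \<Phi> \<xi> \<longleftrightarrow>
      \<eta> \<in> limit_set o\<^sub>X G \<and> (\<forall>k. \<eta> \<in> approximable (real (Suc k)))" for \<eta>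
    using mem[of \<eta>] unfolding WA_def mem_Collect_eq by (metis subsetD)
  then show ?thesis by blast
qed

lemma WA_measurable: "WA o\<^sub>X b D G \<Phi> \<xi> \<in> sets \<mu>"
  unfolding WA_eq using limit_set_measurable approximable_measurable by (intro sets.Int sets.countable_INT) auto

lemma measure_WA: "measure \<mu> (WA o\<^sub>X b D G \<Phi> \<xi>) = measure \<mu> (\<Inter>k. approximable (real (Suc k)))"
proof -
  let ?X = "\<Inter>k. approximable (real (Suc k))"
  have X: "?X \<in> sets \<mu>" using approximable_measurable by (intro sets.countable_INT) auto
  have "AE \<eta> in \<mu>. \<eta> \<in> limit_set o\<^sub>X G"
    using limit_set_full limit_set_measurable
    by (subst AE_in_set_eq_1) (auto simp: emeasure_eq_measure)
  then show ?thesis unfolding WA_eq using X limit_set_measurable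
    by (intro finite_measure_eq_AE) auto
qed

end

text \<open>The same when the measure satisfies condition (a) at \<open>\<xi>\<close>, with constant \<open>R\<close>.\<close>

locale regular_khinchin_action =
  khinchin_action o\<^sub>X C b V D G \<mu> \<delta> Q \<Phi> \<xi> + regular_point o\<^sub>X C b V D G \<mu> \<delta> Q \<xi> R
  for o\<^sub>X :: "'a::metric_space" and C b V D G \<mu> \<delta> Q \<Phi> \<xi> R
begin

text \<open>The convergence half: by the Borel--Cantelli lemma almost no point lies in infinitely many of
  the balls, and a well approximable point lying in only finitely many of them is in the orbit of \<open>\<xi>\<close>.\<close>

lemma WA_null:
  assumes conv: "\<And>K. K > 0 \<Longrightarrow> (\<Sum>\<^sub>\<infinity>g\<in>G. ennreal (approx_radius K g powr \<delta>)) < \<infinity>"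
  shows "WA o\<^sub>X b D G \<Phi> \<xi> \<in> null_sets \<mu>"
proof -
  obtain A where A: "A > 0" and upper: "\<And>g r. g \<in> G \<Longrightarrow> 0 < r \<Longrightarrow> r \<le> radius_const * b powr (- len g) \<Longrightarrow>
    measure \<mu> (cball (orbit_point g) r) \<le> A * r powr \<delta>"
    using orbit_ball_upper by blast
  define K where "K = max 1 (\<Phi> 1 / radius_const)"
  have K: "K \<ge> 1" "K > 0" "\<Phi> 1 / K \<le> radius_const"
    using radius_const by (auto simp: K_def field_simps max_def)
  define S where "S = enn2real (\<Sum>\<^sub>\<infinity>g\<in>G. ennreal (approx_radius K g powr \<delta>))"
  have S: "(\<Sum>g\<in>F. approx_radius K g powr \<delta>) \<le> S" if "finite F" "F \<subseteq> G" for F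
  proof -
    have "ennreal (\<Sum>g\<in>F. approx_radius K g powr \<delta>) = (\<Sum>g\<in>F. ennreal (approx_radius K g powr \<delta>))"
      by (simp add: sum_ennreal)
    also have "\<dots> \<le> (\<Sum>\<^sub>\<infinity>g\<in>G. ennreal (approx_radius K g powr \<delta>))"
      by (rule sum_le_infsum_ennreal[OF that])
    also have "\<dots> = ennreal S" using conv[OF K(2)] by (simp add: S_def)
    finally show ?thesis by (simp add: S_def)
  qed
  define B where "B n = (\<Union>g\<in>layer G len 1 n. cball (orbit_point g) (approx_radius K g))" for n
  have B_meas: "B n \<in> sets \<mu>" for n
    unfolding B_def using G_finite_layer by (intro sets.finite_UN) auto
  have LG: "layer G len 1 n \<subseteq> G" for n by (auto simp: layer_def)
  have B_le: "measure \<mu> (B n) \<le> (\<Sum>g\<in>layer G len 1 n. A * approx_radius K g powr \<delta>)" for n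
  proof -
    have "measure \<mu> (B n) \<le> (\<Sum>g\<in>layer G len 1 n. measure \<mu> (cball (orbit_point g) (approx_radius K g)))"
      unfolding B_def using G_finite_layer by (intro finite_measure_subadditive_finite) auto
    also have "\<dots> \<le> (\<Sum>g\<in>layer G len 1 n. A * approx_radius K g powr \<delta>)"
      using LG approx_radius_pos[OF K(2)] approx_radius_small[OF K(1,3)]
      by (intro sum_mono upper) auto
    finally show ?thesis .
  qed
  have "limsup B \<in> null_sets \<mu>"
  proof (rule borel_cantelli_limsup1[OF B_meas])
    show "emeasure \<mu> (B n) < \<infinity>" for n by (simp add: less_top[symmetric])
    show "summable (\<lambda>n. measure \<mu> (B n))"
    proof (rule summableI_nonneg_bounded)
      fix N
      have "(\<Sum>n<N. measure \<mu> (B n)) \<le> (\<Sum>n<N. \<Sum>g\<in>layer G len 1 n. A * approx_radius K g powr \<delta>)"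
        by (intro sum_mono B_le)
      also have "\<dots> = (\<Sum>g\<in>(\<Union>n<N. layer G len 1 n). A * approx_radius K g powr \<delta>)"
      proof (intro sum.UNION_disjoint[symmetric] ballI impI)
        fix m n :: nat assume "m \<noteq> n"
        then show "layer G len 1 m \<inter> layer G len 1 n = {}"
          using layer_iff[of 1 _ G len] by (auto simp: layer_def)
      qed (use G_finite_layer in auto)
      also have "\<dots> = A * (\<Sum>g\<in>(\<Union>n<N. layer G len 1 n). approx_radius K g powr \<delta>)"
        by (simp add: sum_distrib_left)
      also have "\<dots> \<le> A * S"
        using A G_finite_layer LG by (intro mult_left_mono S) auto
      finally show "(\<Sum>n<N. measure \<mu> (B n)) \<le> A * S" .
    qed simp
  qed
  moreover have "(\<Union>g\<in>G. {orbit_point g}) \<in> null_sets \<mu>"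
    using countable_G emeasure_act_singleton[OF _ \<xi> no_atom] singleton_measurable orbit_point_in_boundary
    by (intro null_sets_UN') auto
  moreover have "WA o\<^sub>X b D G \<Phi> \<xi> \<subseteq> (\<Union>g\<in>G. {orbit_point g}) \<union> limsup B"
  proof
    fix \<eta> assume "\<eta> \<in> WA o\<^sub>X b D G \<Phi> \<xi>"
    then have \<eta>: "\<eta> \<in> boundary" and approx: "\<And>K. K > 0 \<Longrightarrow> \<exists>g\<in>G. D (orbit_point g) \<eta> \<le> approx_radius K g"
      by (auto simp: WA_def limit_set_def)
    show "\<eta> \<in> (\<Union>g\<in>G. {orbit_point g}) \<union> limsup B"
    proof (cases "\<eta> \<in> (\<Union>g\<in>G. {orbit_point g})")
      case False
      have "\<exists>n\<ge>N. \<eta> \<in> B n" for N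
      proof -
        \<comment> \<open>Finitely many elements keep a positive distance from \<open>\<eta>\<close>, so that for a large constant \<open>K'\<close>
          the approximating element is not among them.\<close>
        define E where "E = {g\<in>G. len g \<le> real N}"
        define m where "m = Min (insert 1 ((\<lambda>g. D (orbit_point g) \<eta>) ` E))"
        have finE: "finite E" unfolding E_def by (rule G_discrete)
        have "D (orbit_point g) \<eta> > 0" if "g \<in> E" for g
        proof -
          have g: "g \<in> G" using that by (auto simp: E_def)
          then have "D (orbit_point g) \<eta> \<noteq> 0"
            using False Metric_space.zero[OF metric orbit_point_in_boundary[OF g] \<eta>] by auto
          then show ?thesis using Metric_space.nonneg[OF metric, of "orbit_point g" \<eta>] by linarith
        qed
        then have m: "m > 0" using finE by (auto simp: m_def)
        define K' where "K' = max K (2 * \<Phi> 1 / m)"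
        have K': "K' \<ge> K" "K' \<ge> 1" using K by (auto simp: K'_def)
        have "2 * \<Phi> 1 / m \<le> K'" by (simp add: K'_def)
        then have small: "\<Phi> 1 / K' \<le> m / 2" using m K' by (simp add: field_simps)
        obtain g where g: "g \<in> G" "D (orbit_point g) \<eta> \<le> approx_radius K' g"
          using approx[of K'] K' by auto
        have "approx_radius K' g \<le> m / 2 * b powr (- len g)"
          using approx_radius_small[OF K'(2) small] .
        also have "\<dots> \<le> m / 2 * b powr 0" using m b_gt_1 by (intro mult_left_mono) (auto simp del: powr_zero_eq_one)
        also have "\<dots> < m" using m b_gt_1 by simp
        finally have "D (orbit_point g) \<eta> < m" using g by simp
        moreover have "m \<le> D (orbit_point h) \<eta>" if "h \<in> E" for h
          using that finE unfolding m_def by (intro Min_le) auto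
        ultimately have "g \<notin> E" by force
        then have N: "real N < len g" using g by (auto simp: E_def)
        let ?n = "nat \<lfloor>len g\<rfloor>"
        have "g \<in> layer G len 1 ?n" using g by (subst layer_iff) auto
        moreover have "D (orbit_point g) \<eta> \<le> approx_radius K g"
          using g(2) approx_radius_antimono[OF K(2) K'(1)] by (rule order_trans)
        ultimately have "\<eta> \<in> B ?n"
          using \<eta> g orbit_point_in_boundary by (auto simp: B_def mem_cball)
        moreover have "?n \<ge> N" using N by linarith
        ultimately show ?thesis by blast
      qed
      then have "\<eta> \<in> limsup B" by (auto simp: limsup_INF_SUP)
      then show ?thesis by simp
    qed simp
  qed
  ultimately show ?thesis
    using null_sets_subset[OF _ WA_measurable] null_sets.Un by blast
qed

text \<open>The divergence half: every set of \<open>K\<close>-approximable points has measure bounded below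
  independently of \<open>K\<close>, and so has their intersection.\<close>

lemma WA_not_null:
  assumes \<delta>: "\<delta> > 0" and f: "f \<in> G" "orbit_point f \<noteq> \<xi>" and c: "c > 0"
    and count: "\<And>t. t > 0 \<Longrightarrow> c * b powr (\<delta> * t) \<le> card {g\<in>G. len g \<le> t}"
      "\<And>t. t > 0 \<Longrightarrow> card {g\<in>G. len g \<le> t} \<le> c' * b powr (\<delta> * t)"
    and div: "\<And>K L. K > 0 \<Longrightarrow> L > 0 \<Longrightarrow>
      (\<Sum>n. ennreal (b powr (\<delta> * (real n * L)) * \<Phi> (K * b powr (real (Suc n) * L)) powr \<delta>)) = \<infinity>"
  shows "WA o\<^sub>X b D G \<Phi> \<xi> \<notin> null_sets \<mu>"
proof -
  obtain L \<theta> \<kappa> where L: "L \<ge> 1" and \<theta>: "\<theta> > 0" and \<kappa>: "\<kappa> > 0"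
    and cover: "\<And>r N. (\<And>n. 0 < r n) \<Longrightarrow> (\<And>n. r n \<le> \<theta> * b powr (- (real (Suc n) * L))) \<Longrightarrow>
      (\<Sum>n<N. b powr (\<delta> * (real n * L)) * r n powr \<delta>) \<ge> 1 \<Longrightarrow>
      \<kappa> \<le> measure \<mu> (\<Union>n<N. \<Union>g\<in>layer G len L n. cball (orbit_point g) (r n))"
    using orbit_balls_cover[OF \<delta> f c count] by blast
  have large: "\<kappa> \<le> measure \<mu> (approximable K)" if K: "K \<ge> 1" "\<Phi> 1 / K \<le> \<theta>" for K
  proof -
    define r where "r n = \<Phi> (K * b powr (real (Suc n) * L))" for n
    have bL: "b powr (real (Suc n) * L) \<ge> 1" for n
      using b_gt_1 L by (intro ge_one_powr_ge_zero) auto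
    have r0: "r n > 0" for n unfolding r_def using K bL[of n] by (intro \<Phi>_pos) auto
    have r_le: "r n \<le> \<theta> * b powr (- (real (Suc n) * L))" for n
      using \<Phi>_scaled_le[OF K bL[of n]] by (simp add: r_def powr_minus divide_inverse)
    have "\<exists>N. (\<Sum>n<N. b powr (\<delta> * (real n * L)) * r n powr \<delta>) \<ge> 1"
    proof (rule ccontr)
      assume "\<not> ?thesis"
      then have "(\<Sum>n<N. b powr (\<delta> * (real n * L)) * r n powr \<delta>) \<le> 1" for N
        by (meson linear)
      then have "(\<Sum>n<N. ennreal (b powr (\<delta> * (real n * L)) * r n powr \<delta>)) \<le> 1" for N
        by (subst sum_ennreal) (auto simp: ennreal_le_1)
      then have "(\<Sum>n. ennreal (b powr (\<delta> * (real n * L)) * r n powr \<delta>)) \<le> 1"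
        by (rule suminf_ennreal_leI)
      moreover have "(\<Sum>n. ennreal (b powr (\<delta> * (real n * L)) * r n powr \<delta>)) = \<infinity>"
        unfolding r_def by (rule div) (use K L in auto)
      ultimately show False by (simp only: infinity_ennreal_def top_unique) simp
    qed
    then obtain N where N: "(\<Sum>n<N. b powr (\<delta> * (real n * L)) * r n powr \<delta>) \<ge> 1" by blast
    have "\<kappa> \<le> measure \<mu> (\<Union>n<N. \<Union>g\<in>layer G len L n. cball (orbit_point g) (r n))"
      using cover[of r N] r0 r_le N by blast
    also have "\<dots> \<le> measure \<mu> (approximable K)"
    proof (intro finite_measure_mono approximable_measurable)
      have "r n \<le> approx_radius K g" if "g \<in> layer G len L n" for g n
      proof -
        have "len g \<le> real (Suc n) * L" using that by (simp add: layer_def)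
        then have "b powr len g \<le> b powr (real (Suc n) * L)" using b_gt_1 by simp
        then show ?thesis unfolding r_def using K b_gt_1 by (intro \<Phi>_antimono mult_left_mono) auto
      qed
      then have "cball (orbit_point g) (r n) \<subseteq> cball (orbit_point g) (approx_radius K g)"
        if "g \<in> layer G len L n" for g n using that by (intro cball_mono)
      moreover have "cball (orbit_point g) (approx_radius K g) \<subseteq> approximable K"
        if "g \<in> layer G len L n" for g n
        using that unfolding approximable_def by (intro UN_upper) (simp add: layer_def)
      ultimately show "(\<Union>n<N. \<Union>g\<in>layer G len L n. cball (orbit_point g) (r n)) \<subseteq> approximable K"
        by blast
    qed
    finally show ?thesis .
  qed
  have "decseq (\<lambda>k. approximable (real (Suc k)))"
    by (intro decseq_SucI approximable_antimono) auto
  then have "(\<lambda>k. measure \<mu> (approximable (real (Suc k)))) \<longlonglongrightarrow> measure \<mu> (\<Inter>k. approximable (real (Suc k)))"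
    using approximable_measurable by (intro finite_Lim_measure_decseq) auto
  moreover obtain k0 :: nat where k0: "\<Phi> 1 / \<theta> \<le> real k0" using real_arch_simple by blast
  have "\<kappa> \<le> measure \<mu> (approximable (real (Suc k)))" if "k \<ge> k0" for k
  proof (rule large)
    have "\<Phi> 1 / \<theta> \<le> real (Suc k)" using k0 that by linarith
    then show "\<Phi> 1 / real (Suc k) \<le> \<theta>" using \<theta> by (simp add: field_simps)
  qed simp
  ultimately have "\<kappa> \<le> measure \<mu> (\<Inter>k. approximable (real (Suc k)))"
    by (intro LIMSEQ_le_const) auto
  then have "measure \<mu> (WA o\<^sub>X b D G \<Phi> \<xi>) > 0" using \<kappa> by (simp add: measure_WA)
  then show ?thesis by (auto simp: null_sets_def emeasure_eq_measure)
qed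

end

section \<open>The Khinchin series and integrals\<close>

context khinchin_action
begin

text \<open>The integrals are in terms of the logarithm \<open>t\<close> of the scale; an element of length \<open>l\<close> corresponds
  to \<open>t = ln K + l * ln b\<close>.\<close>

lemma scale_exp: "exp (ln K + l * ln b) = K * b powr l" if "K > 0"
  using that b_gt_1 by (simp add: exp_add powr_def)

lemma exp_mult_\<Phi>_antimono: "s \<le> t \<Longrightarrow> exp t * \<Phi> (exp t) \<le> exp s * \<Phi> (exp s)"
  by (intro mult_\<Phi>_antimono) auto

lemma series1_asymp_integral:
  assumes c: "c > 0"
    and count: "\<And>t. t > 0 \<Longrightarrow> c * b powr (\<delta> * t) \<le> card {g\<in>G. len g \<le> t}"
      "\<And>t. t > 0 \<Longrightarrow> card {g\<in>G. len g \<le> t} \<le> c' * b powr (\<delta> * t)"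
    and K: "K > 0"
  shows "asymp_plus_times (khinchin_series1 o\<^sub>X b D G \<delta> \<mu> \<Phi> \<xi> K)
    (\<integral>\<^sup>+t\<in>{0..}. ball_mass o\<^sub>X D \<mu> \<xi> (inverse K * exp t * \<Phi> (exp t)) \<partial>lborel)"
proof -
  define V where "V t = ball_mass o\<^sub>X D \<mu> \<xi> (inverse K * exp t * \<Phi> (exp t))" for t
  have "antimono V"
  proof (rule antimonoI)
    fix s t :: real assume "s \<le> t"
    then have "inverse K * exp t * \<Phi> (exp t) \<le> inverse K * exp s * \<Phi> (exp s)"
      using exp_mult_\<Phi>_antimono[of s t] K by (simp add: mult.assoc mult_left_mono)
    then show "V t \<le> V s" unfolding V_def ball_mass_def by (intro emeasure_mono cball_mono) auto
  qed
  moreover have "V t < \<infinity>" for t by (simp add: V_def ball_mass_def less_top[symmetric])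
  ultimately have "asymp_plus_times (\<Sum>\<^sub>\<infinity>g\<in>G. ennreal (b powr (- \<delta> * len g)) * V (ln K + len g * ln b))
      (\<integral>\<^sup>+t\<in>{0..}. V t \<partial>lborel)"
    using exponent_pos[OF count(2)] by (intro asymp_plus_times_weighted_sum_integral[OF b_gt_1 _ c _ G_discrete count]) auto
  moreover have "V (ln K + l * ln b) = ball_mass o\<^sub>X D \<mu> \<xi> (b powr l * \<Phi> (K * b powr l))" for l
  proof -
    have "inverse K * (K * b powr l) = b powr l" using K by simp
    then show ?thesis using K by (simp only: V_def scale_exp)
  qed
  ultimately show ?thesis by (simp add: khinchin_series1_def V_def)
qed

text \<open>The series with terms \<open>\<Phi> (K * b powr len g) powr \<delta>\<close>, the corresponding integral, and its
  integrand in the monotone form \<open>(e^t \<Phi> (e^t)) powr \<delta>\<close>.\<close>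

definition power_series :: "real \<Rightarrow> ennreal" where
  "power_series K = (\<Sum>\<^sub>\<infinity>g\<in>G. ennreal (approx_radius K g powr \<delta>))"

definition power_integral :: ennreal where
  "power_integral = (\<integral>\<^sup>+t\<in>{0..}. ennreal (exp (\<delta> * t) * \<Phi> (exp t) powr \<delta>) \<partial>lborel)"

definition scale_power :: "real \<Rightarrow> ennreal" where
  "scale_power t = ennreal ((exp t * \<Phi> (exp t)) powr \<delta>)"

lemma scale_power_antimono: "antimono scale_power"
  unfolding scale_power_def using \<delta>_nonneg \<Phi>_pos
  by (intro antimonoI ennreal_leI powr_mono2 exp_mult_\<Phi>_antimono) (auto simp: less_imp_le)

lemma scale_power_finite: "scale_power t < \<infinity>"
  by (simp add: scale_power_def)

lemma power_integral_eq: "power_integral = (\<integral>\<^sup>+t\<in>{0..}. scale_power t \<partial>lborel)"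
  unfolding power_integral_def scale_power_def
  by (simp add: powr_mult powr_def[of "exp _"])

lemma scale_power_eq:
  assumes "K > 0"
  shows "scale_power (ln K + l * ln b) = ennreal (K powr \<delta>) * ennreal (b powr (\<delta> * l) * \<Phi> (K * b powr l) powr \<delta>)"
proof -
  have "scale_power (ln K + l * ln b) = ennreal ((K * b powr l * \<Phi> (K * b powr l)) powr \<delta>)"
    using assms by (simp add: scale_power_def scale_exp)
  also have "(K * b powr l * \<Phi> (K * b powr l)) powr \<delta> = K powr \<delta> * (b powr (\<delta> * l) * \<Phi> (K * b powr l) powr \<delta>)"
    using assms b_gt_1 \<Phi>_pos[of "K * b powr l"] by (simp add: powr_mult powr_powr mult_ac)
  finally show ?thesis using assms by (simp add: ennreal_mult)
qed

lemma power_series_asymp_integral: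
  assumes c: "c > 0"
    and count: "\<And>t. t > 0 \<Longrightarrow> c * b powr (\<delta> * t) \<le> card {g\<in>G. len g \<le> t}"
      "\<And>t. t > 0 \<Longrightarrow> card {g\<in>G. len g \<le> t} \<le> c' * b powr (\<delta> * t)"
    and K: "K > 0"
  shows "asymp_plus_times (power_series K) power_integral"
proof -
  have "asymp_plus_times (\<Sum>\<^sub>\<infinity>g\<in>G. ennreal (b powr (- \<delta> * len g)) * scale_power (ln K + len g * ln b)) power_integral"
    unfolding power_integral_eq
    using exponent_pos[OF count(2)] scale_power_antimono scale_power_finite
    by (intro asymp_plus_times_weighted_sum_integral[OF b_gt_1 _ c _ G_discrete count]) auto
  moreover have "ennreal (b powr (- \<delta> * len g)) * scale_power (ln K + len g * ln b)
      = ennreal (K powr \<delta>) * ennreal (approx_radius K g powr \<delta>)" for g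
  proof -
    have "b powr (- \<delta> * len g) * (b powr (\<delta> * len g) * approx_radius K g powr \<delta>) = approx_radius K g powr \<delta>"
      using b_gt_1 by (simp add: mult.assoc[symmetric] powr_add[symmetric])
    then show ?thesis unfolding scale_power_eq[OF K]
      by (simp add: mult.left_commute ennreal_mult'[symmetric])
  qed
  ultimately have *: "asymp_plus_times (ennreal (K powr \<delta>) * power_series K) power_integral"
    by (simp add: power_series_def infsum_cmult_ennreal)
  have "asymp_times (power_series K) (ennreal (K powr \<delta>) * power_series K)"
    using K by (intro asymp_timesI[of _ "K powr (- \<delta>)" _ "K powr \<delta>"])
      (auto simp: mult.assoc[symmetric] ennreal_mult'[symmetric] powr_add[symmetric])
  from asymp_plus_times_trans[OF asymp_times_imp_plus[OF this] *] show ?thesis .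
qed

text \<open>Divergence of the integral, read off along a geometric sequence of scales.\<close>

lemma geometric_series_diverges:
  assumes "power_integral = \<infinity>" "K > 0" "L > 0"
  shows "(\<Sum>n. ennreal (b powr (\<delta> * (real n * L)) * \<Phi> (K * b powr (real (Suc n) * L)) powr \<delta>)) = \<infinity>"
proof -
  let ?s = "\<Sum>n. ennreal (b powr (\<delta> * (real n * L)) * \<Phi> (K * b powr (real (Suc n) * L)) powr \<delta>)"
  have "asymp_plus_times (\<Sum>n. scale_power ((ln K + L * ln b) + real n * (L * ln b))) power_integral"
    unfolding power_integral_eq using assms b_gt_1
    by (intro asymp_plus_times_sum_integral scale_power_antimono scale_power_finite) auto
  from asymp_plus_times_finite_iff[OF this]
  have "(\<Sum>n. scale_power ((ln K + L * ln b) + real n * (L * ln b))) = \<infinity>"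
    using assms(1) by (simp add: less_top[symmetric])
  also have "(\<Sum>n. scale_power ((ln K + L * ln b) + real n * (L * ln b))) =
      (\<Sum>n. ennreal (K powr \<delta> * b powr (\<delta> * L)) *
        ennreal (b powr (\<delta> * (real n * L)) * \<Phi> (K * b powr (real (Suc n) * L)) powr \<delta>))"
  proof (intro suminf_cong)
    fix n
    have "(ln K + L * ln b) + real n * (L * ln b) = ln K + (real (Suc n) * L) * ln b" by (simp add: algebra_simps)
    then have "scale_power ((ln K + L * ln b) + real n * (L * ln b)) =
      ennreal (K powr \<delta>) * ennreal (b powr (\<delta> * (real (Suc n) * L)) * \<Phi> (K * b powr (real (Suc n) * L)) powr \<delta>)"
      using scale_power_eq[OF assms(2), of "real (Suc n) * L"] by metis
    also have "b powr (\<delta> * (real (Suc n) * L)) = b powr (\<delta> * L) * b powr (\<delta> * (real n * L))"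
      by (simp add: powr_add[symmetric] algebra_simps)
    finally show "scale_power ((ln K + L * ln b) + real n * (L * ln b)) =
      ennreal (K powr \<delta> * b powr (\<delta> * L)) *
        ennreal (b powr (\<delta> * (real n * L)) * \<Phi> (K * b powr (real (Suc n) * L)) powr \<delta>)"
      by (simp add: ennreal_mult mult_ac)
  qed
  also have "\<dots> = ennreal (K powr \<delta> * b powr (\<delta> * L)) * ?s" by simp
  finally show ?thesis by (auto simp: ennreal_mult_eq_top_iff)
qed

lemma metric_deriv_ge_len:
  assumes "g \<in> G"
  shows "b powr (- len g) \<le> metric_deriv o\<^sub>X b g \<xi>"
proof -
  have "b powr (- len g) \<le> b powr (2 * point_product \<xi> (inv_into UNIV g o\<^sub>X) o\<^sub>X - len g)"
    using boundary_point_product_eq(2)[OF boundary_nonempty[OF base_point], of "inv_into UNIV g o\<^sub>X" o\<^sub>X] b_gt_1 by simp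
  also have "\<dots> \<le> metric_deriv o\<^sub>X b g \<xi>"
    by (intro metric_deriv_ge G_isometry assms base_point)
  finally show ?thesis .
qed

end

context regular_khinchin_action
begin

text \<open>The regularity of the measure at \<open>\<xi>\<close> extends to radii in a bounded interval, and the coefficient
  \<open>s powr \<delta>\<close> cancels the division of the radius by \<open>s\<close>.\<close>

lemma ball_mass_scaled:
  assumes "0 < r" "r \<le> M" "0 < s" "s * x = r" "1 \<le> M"
  shows "ennreal (s powr \<delta>) * ball_mass o\<^sub>X D \<mu> \<xi> x \<le> ennreal R * ennreal (r powr \<delta>)"
    and "x \<le> M \<Longrightarrow> ennreal (r powr \<delta>) \<le> ennreal (R * M powr \<delta>) * (ennreal (s powr \<delta>) * ball_mass o\<^sub>X D \<mu> \<xi> x)"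
proof -
  have x: "x > 0" using assms zero_less_mult_pos by blast
  have rx: "r powr \<delta> = s powr \<delta> * x powr \<delta>" using assms x by (auto simp: powr_mult)
  have "s powr \<delta> * measure \<mu> (cball \<xi> x) \<le> s powr \<delta> * (R * x powr \<delta>)"
    using x by (intro mult_left_mono ball_upper') auto
  then show "ennreal (s powr \<delta>) * ball_mass o\<^sub>X D \<mu> \<xi> x \<le> ennreal R * ennreal (r powr \<delta>)"
    using R_ge_1 by (simp add: ball_mass_def emeasure_eq_measure ennreal_mult[symmetric] rx mult_ac)
  assume "x \<le> M"
  then have xM: "0 < x / M" "x / M \<le> 1" "x / M \<le> x" using x assms by (auto simp: field_simps)
  have "x powr \<delta> = M powr \<delta> * (x / M) powr \<delta>" using x assms by (simp add: powr_divide)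
  also have "\<dots> \<le> M powr \<delta> * (R * measure \<mu> (cball \<xi> (x / M)))"
    using xM by (intro mult_left_mono ball_lower) auto
  also have "\<dots> \<le> M powr \<delta> * (R * measure \<mu> (cball \<xi> x))"
    using xM R_ge_1 by (intro mult_left_mono finite_measure_mono cball_mono) auto
  finally have "s powr \<delta> * x powr \<delta> \<le> s powr \<delta> * (M powr \<delta> * (R * measure \<mu> (cball \<xi> x)))"
    by (intro mult_left_mono) auto
  then show "ennreal (r powr \<delta>) \<le> ennreal (R * M powr \<delta>) * (ennreal (s powr \<delta>) * ball_mass o\<^sub>X D \<mu> \<xi> x)"
    using R_ge_1 by (simp add: ball_mass_def emeasure_eq_measure ennreal_mult[symmetric] rx mult_ac)
qed

text \<open>Both series have this form, with \<open>s g\<close> equal to \<open>b powr (- len g)\<close> and to \<open>g'(\<xi>)\<close>, respectively.\<close>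

lemma ball_mass_series_asymp:
  assumes K: "K > 0" and s: "\<And>g. g \<in> G \<Longrightarrow> b powr (- len g) \<le> s g"
  shows "asymp_times (\<Sum>\<^sub>\<infinity>g\<in>G. ennreal (s g powr \<delta>) * ball_mass o\<^sub>X D \<mu> \<xi> (approx_radius K g / s g)) (power_series K)"
  unfolding power_series_def
proof (rule asymp_times_infsumI)
  define M where "M = max 1 (\<Phi> K)"
  have M: "M \<ge> 1" "\<Phi> K \<le> M" by (auto simp: M_def)
  fix g assume g: "g \<in> G"
  have s0: "s g > 0" using s[OF g] b_gt_1 less_le_trans[of 0 "b powr (- len g)"] by simp
  have x_le: "approx_radius K g / s g \<le> M"
  proof -
    have "(K * b powr len g) * approx_radius K g \<le> K * \<Phi> K"
      using K b_powr_len[of g] by (intro mult_\<Phi>_antimono) auto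
    then have "b powr len g * approx_radius K g \<le> \<Phi> K" using K by simp
    then have "approx_radius K g \<le> b powr (- len g) * \<Phi> K"
      using b_gt_1 by (simp add: powr_minus field_simps)
    also have "\<dots> \<le> s g * M"
      using s[OF g] s0 M \<Phi>_pos[of K] K by (intro mult_mono) auto
    finally show ?thesis using s0 by (simp add: field_simps)
  qed
  have r: "0 < approx_radius K g" "approx_radius K g \<le> M" "s g * (approx_radius K g / s g) = approx_radius K g"
  proof -
    show "0 < approx_radius K g" using K by (rule approx_radius_pos)
    have "approx_radius K g \<le> \<Phi> K" using K b_powr_len[of g] by (intro \<Phi>_antimono) auto
    then show "approx_radius K g \<le> M" using M by simp
  qed (use s0 in simp)
  show "ennreal (s g powr \<delta>) * ball_mass o\<^sub>X D \<mu> \<xi> (approx_radius K g / s g) \<le> ennreal R * ennreal (approx_radius K g powr \<delta>)"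
    by (rule ball_mass_scaled(1)[OF r(1,2) s0 r(3) M(1)])
  show "ennreal (approx_radius K g powr \<delta>) \<le> ennreal (R * (max 1 (\<Phi> K)) powr \<delta>) *
      (ennreal (s g powr \<delta>) * ball_mass o\<^sub>X D \<mu> \<xi> (approx_radius K g / s g))"
    using ball_mass_scaled(2)[OF r(1,2) s0 r(3) M(1) x_le] by (simp add: M_def)
qed

lemma series1_asymp_power_series:
  assumes "K > 0"
  shows "asymp_times (khinchin_series1 o\<^sub>X b D G \<delta> \<mu> \<Phi> \<xi> K) (power_series K)"
proof -
  have "ennreal ((b powr (- len g)) powr \<delta>) * ball_mass o\<^sub>X D \<mu> \<xi> (approx_radius K g / b powr (- len g)) =
    ennreal (b powr (- \<delta> * len g)) * ball_mass o\<^sub>X D \<mu> \<xi> (b powr len g * approx_radius K g)" for g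
  proof -
    have "(b powr (- len g)) powr \<delta> = b powr (- \<delta> * len g)" by (simp add: powr_powr mult.commute)
    moreover have "approx_radius K g / b powr (- len g) = b powr len g * approx_radius K g"
      by (simp add: powr_minus divide_inverse mult.commute)
    ultimately show ?thesis by simp
  qed
  then show ?thesis using ball_mass_series_asymp[OF assms, of "\<lambda>g. b powr (- len g)"]
    by (simp add: khinchin_series1_def)
qed

lemma series2_asymp_power_series:
  assumes "K > 0"
  shows "asymp_times (khinchin_series2 o\<^sub>X b D G \<delta> \<mu> \<Phi> \<xi> K) (power_series K)"
  using ball_mass_series_asymp[OF assms, of "\<lambda>g. metric_deriv o\<^sub>X b g \<xi>"] metric_deriv_ge_len
  by (simp add: khinchin_series2_def)

end

section \<open>Khinchin's theorem\<close>

theorem proposition8p10: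
  fixes o\<^sub>X :: "'a::metric_space"
    and b \<delta> :: real
    and D :: "(nat \<Rightarrow> 'a) set \<Rightarrow> (nat \<Rightarrow> 'a) set \<Rightarrow> real"
    and G :: "('a \<Rightarrow> 'a) set"
    and \<xi> :: "(nat \<Rightarrow> 'a) set"
    and \<mu> :: "(nat \<Rightarrow> 'a) set measure"
    and \<Phi> :: "real \<Rightarrow> real"
  assumes "gromov_hyperbolic TYPE('a)"
    and "b > 1"
    and "visual_metric o\<^sub>X b D"
    and "subgroup G isom_group"
    and "strongly_discrete o\<^sub>X G"
    and "general_type o\<^sub>X D G"
    and "poincare_exponent o\<^sub>X b G = ereal \<delta>"
    and "\<xi> \<in> gromov_boundary o\<^sub>X"
    and "sets \<mu> = sets (boundary_borel o\<^sub>X D)"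
    and "prob_space \<mu>"
    and "emeasure \<mu> (limit_set o\<^sub>X G) = 1"
    and "quasiconformal o\<^sub>X b G \<delta> \<mu>"
    and "ergodic_measure G \<mu>"
    and "emeasure \<mu> {\<xi>} = 0"
    and "\<forall>t\<ge>0. \<Phi> t > 0"
    and "antimono_on {0<..} (\<lambda>t. t * \<Phi> t)"
  defines "cond_a \<equiv> asymp_times_on {0<..1} (ball_mass o\<^sub>X D \<mu> \<xi>) (\<lambda>r. ennreal (r powr \<delta>))"
    and "cond_b \<equiv> asymp_times_on {0<..} (\<lambda>t. of_nat (orbit_count o\<^sub>X G t)) (\<lambda>t. ennreal (b powr (\<delta> * t)))"
    and "S1 \<equiv> khinchin_series1 o\<^sub>X b D G \<delta> \<mu> \<Phi> \<xi>"
    and "S2 \<equiv> khinchin_series2 o\<^sub>X b D G \<delta> \<mu> \<Phi> \<xi>"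
    and "I \<equiv> \<integral>\<^sup>+t\<in>{0..}. ennreal (exp (\<delta> * t) * \<Phi> (exp t) powr \<delta>) \<partial>lborel"
  shows "(cond_b \<longrightarrow> (\<forall>K>0. asymp_plus_times (S1 K)
            (\<integral>\<^sup>+t\<in>{0..}. ball_mass o\<^sub>X D \<mu> \<xi> (inverse K * exp t * \<Phi> (exp t)) \<partial>lborel))) \<and>
         (cond_a \<longrightarrow> (\<forall>K>0. asymp_times (S1 K) (S2 K) \<and>
            asymp_times (S2 K) (\<Sum>\<^sub>\<infinity>g\<in>G. ennreal (\<Phi> (K * b powr dist o\<^sub>X (g o\<^sub>X)) powr \<delta>)))) \<and>
         (cond_a \<and> cond_b \<longrightarrow>
            (\<forall>K>0. asymp_times (S1 K) (S2 K) \<and> asymp_plus_times (S2 K) I) \<and>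
            (WA o\<^sub>X b D G \<Phi> \<xi> \<in> null_sets \<mu> \<longleftrightarrow> I < \<infinity>))"
proof -
  obtain C where "C \<ge> 0" and C: "\<And>x y z w :: 'a.
      min (gromov_product x y w) (gromov_product y z w) - C \<le> gromov_product x z w"
    using assms(1) unfolding gromov_hyperbolic_def by blast
  obtain V where V: "V \<ge> 1" "Metric_space (gromov_boundary o\<^sub>X) D"
    "\<And>\<xi> \<eta>. \<xi> \<in> gromov_boundary o\<^sub>X \<Longrightarrow> \<eta> \<in> gromov_boundary o\<^sub>X \<Longrightarrow>
      inverse V * neg_power b (boundary_product \<xi> \<eta> o\<^sub>X) \<le> D \<xi> \<eta> \<and>
      D \<xi> \<eta> \<le> V * neg_power b (boundary_product \<xi> \<eta> o\<^sub>X)"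
    using assms(3) unfolding visual_metric_def by blast
  obtain Q where Q: "Q \<ge> 1" "\<And>g A. g \<in> G \<Longrightarrow> A \<in> sets \<mu> \<Longrightarrow>
      ennreal (inverse Q) * (\<integral>\<^sup>+\<eta>\<in>A. ennreal (metric_deriv o\<^sub>X b g \<eta> powr \<delta>) \<partial>\<mu>)
          \<le> emeasure \<mu> (boundary_act g ` A) \<and>
        emeasure \<mu> (boundary_act g ` A)
          \<le> ennreal Q * (\<integral>\<^sup>+\<eta>\<in>A. ennreal (metric_deriv o\<^sub>X b g \<eta> powr \<delta>) \<partial>\<mu>)"
    using assms(12) unfolding quasiconformal_def by blast
  have G_sub: "G \<subseteq> isometries" using assms(4) by (rule subgroup.subset)
  have G_inv: "inv_into UNIV g \<in> G" if g: "g \<in> G" for g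
  proof -
    have gi: "g \<in> isometries" using g G_sub by blast
    have "inv_into UNIV g \<otimes>\<^bsub>isom_group\<^esub> g = \<one>\<^bsub>isom_group\<^esub>"
      using isometry_inv_apply(2)[OF gi] by (auto simp: isom_group_def)
    then have "inv\<^bsub>isom_group\<^esub> g = inv_into UNIV g"
      by (intro group.inv_equality[OF group_isom_group] gi isometry_inv)
    then show ?thesis using subgroup.m_inv_closed[OF assms(4) g] by simp
  qed
  have G_comp: "g \<circ> h \<in> G" if "g \<in> G" "h \<in> G" for g h
    using subgroup.m_closed[OF assms(4) that] by (simp add: isom_group_def)
  have G_id: "id \<in> G" using subgroup.one_closed[OF assms(4)] by (simp add: isom_group_def)
  have discrete: "finite {g\<in>G. dist o\<^sub>X (g o\<^sub>X) \<le> t}" for t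
  proof -
    have "finite {g\<in>G. dist o\<^sub>X (g o\<^sub>X) \<le> max t 1}" using assms(5) by (auto simp: strongly_discrete_def)
    then show ?thesis by (rule rev_finite_subset) auto
  qed
  have "0 \<le> poincare_exponent o\<^sub>X b G"
    unfolding poincare_exponent_def by (intro Inf_greatest) auto
  then have \<delta>: "\<delta> \<ge> 0" using assms(7) by simp
  have \<Phi>_pos: "\<Phi> t > 0" if "t \<ge> 0" for t using assms(15) that by simp
  have "hyperbolic_space TYPE('a) C"
    by (rule hyperbolic_space.intro[OF \<open>C \<ge> 0\<close> C])
  then have "visual_boundary o\<^sub>X C b V D"
    by (rule visual_boundary.intro[OF _ visual_boundary_axioms.intro
          [OF assms(2) V(1,2) conjunct1[OF V(3)] conjunct2[OF V(3)]]])
  then have "quasiconformal_action o\<^sub>X C b V D G \<mu> \<delta> Q"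
    by (rule quasiconformal_action.intro[OF _ quasiconformal_action_axioms.intro
          [OF G_sub G_id G_comp G_inv discrete \<delta> assms(9,10) Q(1) conjunct1[OF Q(2)] conjunct2[OF Q(2)]]])
  then have kh: "khinchin_action o\<^sub>X C b V D G \<mu> \<delta> Q \<Phi> \<xi>"
    by (rule khinchin_action.intro[OF _ approximation_function.intro[OF \<Phi>_pos assms(16)]
          khinchin_action_axioms.intro[OF assms(8,11,14)]])
  interpret khinchin_action o\<^sub>X C b V D G \<mu> \<delta> Q \<Phi> \<xi>
    by (rule kh)
  have regular: "\<exists>R. regular_khinchin_action o\<^sub>X C b V D G \<mu> \<delta> Q \<Phi> \<xi> R" if a: cond_a
  proof -
    obtain R where R: "R \<ge> 1" "\<forall>r\<in>{0<..1}. comparable_times R (ball_mass o\<^sub>X D \<mu> \<xi> r) (ennreal (r powr \<delta>))"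
      using a unfolding cond_a_def asymp_times_on_def by (elim exE conjE)
    have "measure \<mu> (cball \<xi> r) \<le> R * r powr \<delta>" "r powr \<delta> \<le> R * measure \<mu> (cball \<xi> r)" if "0 < r" "r \<le> 1" for r
    proof -
      have "comparable_times R (ball_mass o\<^sub>X D \<mu> \<xi> r) (ennreal (r powr \<delta>))" using that by (intro bspec[OF R(2)]) simp
      from comparable_timesD[OF this R(1)]
      show "measure \<mu> (cball \<xi> r) \<le> R * r powr \<delta>" "r powr \<delta> \<le> R * measure \<mu> (cball \<xi> r)"
        using R(1) by (simp_all add: ball_mass_def emeasure_eq_measure ennreal_mult[symmetric])
    qed
    then have "regular_khinchin_action o\<^sub>X C b V D G \<mu> \<delta> Q \<Phi> \<xi> R"
      using R(1) assms(8)
      by (intro regular_khinchin_action.intro khinchin_action_axioms regular_point.intro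
          quasiconformal_action_axioms regular_point_axioms.intro) auto
    then show ?thesis by blast
  qed
  have growth: "\<exists>c>0. \<exists>c'. \<forall>t>0. c * b powr (\<delta> * t) \<le> card {g\<in>G. len g \<le> t} \<and> card {g\<in>G. len g \<le> t} \<le> c' * b powr (\<delta> * t)"
    if b': cond_b
  proof -
    obtain c where c: "c \<ge> 1" "\<forall>t\<in>{0<..}. comparable_times c (of_nat (orbit_count o\<^sub>X G t)) (ennreal (b powr (\<delta> * t)))"
      using b' unfolding cond_b_def asymp_times_on_def by (elim exE conjE)
    have "inverse c * b powr (\<delta> * t) \<le> card {g\<in>G. len g \<le> t} \<and> card {g\<in>G. len g \<le> t} \<le> c * b powr (\<delta> * t)" if "t > 0" for t
      using comparable_timesD[OF bspec[OF c(2)] c(1), of t] that c(1)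
      by (simp add: orbit_count_def ennreal_of_nat_eq_real_of_nat ennreal_mult[symmetric] field_simps)
    then show ?thesis using c(1) by (intro exI[of _ "inverse c"]) auto
  qed
  have part_b: "asymp_plus_times (S1 K) (\<integral>\<^sup>+t\<in>{0..}. ball_mass o\<^sub>X D \<mu> \<xi> (inverse K * exp t * \<Phi> (exp t)) \<partial>lborel)"
    if cond_b "K > 0" for K
    using growth[OF that(1)] series1_asymp_integral that(2) unfolding S1_def by blast
  have part_a: "asymp_times (S1 K) (S2 K)" "asymp_times (S2 K) (power_series K)" if a: cond_a "K > 0" for K
  proof -
    obtain R where "regular_khinchin_action o\<^sub>X C b V D G \<mu> \<delta> Q \<Phi> \<xi> R" using regular[OF a(1)] by blast
    then interpret regular_khinchin_action o\<^sub>X C b V D G \<mu> \<delta> Q \<Phi> \<xi> R .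
    show "asymp_times (S2 K) (power_series K)"
      unfolding S2_def using series2_asymp_power_series a(2) by blast
    then show "asymp_times (S1 K) (S2 K)"
      unfolding S1_def using series1_asymp_power_series a(2) asymp_times_sym asymp_times_trans by blast
  qed
  have I_eq: "I = power_integral" by (simp add: I_def power_integral_def)
  have part_ab: "asymp_plus_times (power_series K) I" if cond_b "K > 0" for K
    using growth[OF that(1)] power_series_asymp_integral that(2) unfolding I_eq by blast
  have khinchin: "WA o\<^sub>X b D G \<Phi> \<xi> \<in> null_sets \<mu> \<longleftrightarrow> I < \<infinity>" if ab: cond_a cond_b
  proof -
    obtain R where "regular_khinchin_action o\<^sub>X C b V D G \<mu> \<delta> Q \<Phi> \<xi> R" using regular[OF ab(1)] by blast
    then interpret regular_khinchin_action o\<^sub>X C b V D G \<mu> \<delta> Q \<Phi> \<xi> R .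
    obtain c c' where c: "c > 0"
      "\<And>t. t > 0 \<Longrightarrow> c * b powr (\<delta> * t) \<le> card {g\<in>G. len g \<le> t}"
      "\<And>t. t > 0 \<Longrightarrow> card {g\<in>G. len g \<le> t} \<le> c' * b powr (\<delta> * t)"
      using growth[OF ab(2)] by blast
    \<comment> \<open>Two loxodromic elements without common fixed points cannot both fix \<open>\<xi>\<close>.\<close>
    have "\<exists>f\<in>G. boundary_act f \<xi> \<noteq> \<xi>"
      using assms(6,8) unfolding general_type_def boundary_fixed_def by blast
    then obtain f where f: "f \<in> G" "boundary_act f \<xi> \<noteq> \<xi>" by blast
    show ?thesis
    proof
      assume fin: "I < \<infinity>"
      have "power_series K < \<infinity>" if "K > 0" for K
        using asymp_plus_times_finite_iff[OF part_ab[OF ab(2) that]] fin by simp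
      then show "WA o\<^sub>X b D G \<Phi> \<xi> \<in> null_sets \<mu>"
        unfolding power_series_def by (rule WA_null)
    next
      assume null: "WA o\<^sub>X b D G \<Phi> \<xi> \<in> null_sets \<mu>"
      show "I < \<infinity>"
      proof (rule ccontr)
        assume "\<not> I < \<infinity>"
        then have "power_integral = \<infinity>" by (simp add: I_eq less_top[symmetric])
        then show False
          using WA_not_null[OF exponent_pos[OF c(3)] f c] geometric_series_diverges null by blast
      qed
    qed
  qed
  have "asymp_plus_times (S2 K) I" if "cond_a" "cond_b" "K > 0" for K
    using asymp_plus_times_trans[OF asymp_times_imp_plus[OF part_a(2)[OF that(1,3)]] part_ab[OF that(2,3)]] .
  then show ?thesis
    using part_a part_b khinchin unfolding power_series_def by blast
qed

end
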